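(* Consider the linear model $y_i=\mathbf x_i^\top\boldsymbol\theta^*+\epsilon_i$ with i.i.d. observations $Z_i=(\mathbf x_i,y_i)\in\mathbb R^p\times\mathbb R$, $i=1,\dots,n$, where $\mathbb E[\epsilon_i\mid\mathbf x_i]=0$ and $\|\boldsymbol\theta^*\|_0\le s^*$, with the least-squares loss. Let $s\ge2$ and $\bar s=2s+s^*$. Suppose that (i) there exist tail indices $\lambda\in(0,1]$ and $\delta\in(0,1]$ such that $M_{\mathbf x,2+2\lambda,\bar s}<\infty$ and $M_{\epsilon,1+\delta}<\infty$; (ii) the matrix $\boldsymbol\Sigma_{\mathbf x}=\mathbb E[\mathbf x_i\mathbf x_i^\top]$ satisfies $\kappa_-\|\mathbf v\|_2^2\le\mathbf v^\top\boldsymbol\Sigma_{\mathbf x}\mathbf v\le\kappa_+\|\mathbf v\|_2^2$ for all $\mathbf v\in\mathbb R^p$ with $\|\mathbf v\|_0\le\bar s$, where $0<\kappa_-\le\kappa_+<\infty$; write $\kappa=\kappa_+/\kappa_-$ for the condition number. Put $a=\kappa_-/(2\kappa_+^2)$ and $b=\kappa_-/2$. There is a constant $c_s>1$, depending only on $a$, $b$ and $\eta_0$, such that the following holds. Run the TS-RIGHT algorithm with $n_1\asymp n_2\asymp n$, working sparsity $s\ge c_s s^*$ with $s\asymp s^*$, step size $\eta=2a\eta_0$ for some $\eta_0\in(0,1]$, MoM block numbers $K_1\asymp\bar s\log p$ and $K_2\asymp\log p$, and iteration numbers $T_1\asymp\log n$ and $T_2\asymp\log s$. Suppose the initialization satisfies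 $\|\boldsymbol\theta^0\|_0\le s$ and $\|\boldsymbol\theta^0-\boldsymbol\theta^*\|_2\le R_0$, where $R_0$ is at most polynomial in $n$. If $$n\gtrsim_{\kappa,\lambda,\eta_0} M_{\mathbf x,2+2\lambda,\bar s}^{1/\lambda}\,\bar s^{\,1+(1+\lambda)/(2\lambda)}\log p,$$ then, with probability at least $1-C\exp(-c\bar s\log p)-Cp^{-c}$, the Phase I estimator satisfies $$\|\boldsymbol\theta^{T_1}-\boldsymbol\theta^*\|_2\lesssim_{\kappa,\lambda,\delta,\eta_0}\sqrt{\bar s}\,M_{\mathrm{eff},1+\delta}^{1/(1+\delta)}\left(\frac{\bar s\log p}{n}\right)^{\delta/(1+\delta)}$$ and the final estimator $\widehat{\boldsymbol\theta}$ satisfies $$\|\widehat{\boldsymbol\theta}-\boldsymbol\theta^*\|_2\lesssim_{\kappa,\lambda,\delta,\eta_0}\sqrt{\bar s}\,M_{\mathrm{eff},1+\delta}^{1/(1+\delta)}\left(\frac{\log s\cdot\log p}{n}\right)^{\delta/(1+\delta)}.$$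
   Context: Moments: $M_{\mathbf x,q,\ell}=\sup_{\|\mathbf v\|_2=1,\|\mathbf v\|_0\le\ell}\mathbb E[|\mathbf x_i^\top\mathbf v|^q]$; $M_{\epsilon,q}=\sup_{\mathbf x}\mathbb E[|\epsilon_i|^q\mid\mathbf x_i=\mathbf x]$; $M_{\mathrm{eff},1+\delta}=M_{\epsilon,1+\delta}\,M_{\mathbf x,1+\delta,\bar s}$. $\|\mathbf v\|_0$ is the number of nonzero entries of $\mathbf v$. Loss: $\mathcal L(\boldsymbol\theta;Z_i)=\frac12(y_i-\mathbf x_i^\top\boldsymbol\theta)^2$, so $\nabla_{\boldsymbol\theta}\mathcal L(\boldsymbol\theta;Z_i)=(\mathbf x_i^\top\boldsymbol\theta-y_i)\mathbf x_i$. $\mathcal P_s$ is the hard-thresholding operator on $\mathbb R^p$ that keeps the $s$ largest coordinates in absolute value and sets the rest to zero. Median-of-means (MoM) gradient: for a data subset $\mathcal A$ partitioned into $K$ disjoint blocks $\mathcal B_1(\mathcal A),\dots,\mathcal B_K(\mathcal A)$ of equal or nearly equal sizes, $g(\boldsymbol\theta;K,\mathcal A)\in\mathbb R^p$ has $j$-th coordinate $\operatorname{median}_{1\le k\le K}\big[|\mathcal B_k(\mathcal A)|^{-1}\sum_{Z_i\in\mathcal B_k(\mathcal A)}\nabla_j\mathcal L(\boldsymbol\theta;Z_i)\big]$. TS-RIGHT algorithm: split $\mathcal D_n=\{Z_i\}_{i=1}^n$ into disjoint parts $\mathcal D^{(1)}$ (size $n_1$) and $\mathcal D^{(2)}$ (size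 $n_2$). Phase I: for $t=0,\dots,T_1-1$, $\boldsymbol\theta^{t+1}=\mathcal P_s\{\boldsymbol\theta^t-\eta g(\boldsymbol\theta^t;K_1,\mathcal D^{(1)})\}$. Split $\mathcal D^{(2)}$ into $T_2$ disjoint batches $\mathcal D^{(2)}_1,\dots,\mathcal D^{(2)}_{T_2}$ of (nearly) equal sizes. Phase II: for $\ell=1,\dots,T_2$, $\boldsymbol\theta^{T_1+\ell}=\mathcal P_s\{\boldsymbol\theta^{T_1+\ell-1}-\eta g(\boldsymbol\theta^{T_1+\ell-1};K_2,\mathcal D^{(2)}_\ell)\}$. Output $\widehat{\boldsymbol\theta}=\boldsymbol\theta^{T_1+T_2}$. Notation: $u\lesssim v$ means $u\le Cv$ for a universal constant $C>0$ independent of $n$, $p$ and problem-specific parameters; $u\asymp v$ means $u\lesssim v$ and $v\lesssim u$; a subscript on $\lesssim$ or $\gtrsim$ lists the quantities on which the implicit constant may depend. $C,c>0$ denote generic positive constants.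
   Formalization: Constants may also depend on a positive lower bound for κ₋ (κ alone fails under rescaling x); M_eff>0 is required and the constant in T₁≍log n may depend on a lower bound for M_eff (exact recovery fails without noise); K₁,K₂,T₁,T₂ have sufficiently large lower constants. *)

theory Defs
  imports "HOL-Probability.Probability"
begin

text \<open>
  The dimension \<open>p\<close> has to be quantified inside the statement (no constant may depend on it), so a
  vector of \<open>\<real>\<^sup>p\<close> is a function \<open>nat \<Rightarrow> real\<close> of which only the coordinates \<open>j < p\<close> are read.
  Its Euclidean norm is \<open>L2_set v {..<p}\<close>.
\<close>

type_synonym vec = "nat \<Rightarrow> real"
type_synonym obs = "vec \<times> real"

definition dot :: "nat \<Rightarrow> vec \<Rightarrow> vec \<Rightarrow> real" where
  "dot p u v = (\<Sum>j<p. u j * v j)"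

definition l0_norm :: "nat \<Rightarrow> vec \<Rightarrow> nat" where
  "l0_norm p v = card {j. j < p \<and> v j \<noteq> 0}"

definition l2_dist :: "nat \<Rightarrow> vec \<Rightarrow> vec \<Rightarrow> real" where
  "l2_dist p u v = L2_set (\<lambda>j. u j - v j) {..<p}"

text \<open>The relation \<open>u \<asymp> v\<close> with explicit implicit constants.\<close>

definition comparable :: "real \<Rightarrow> real \<Rightarrow> real \<Rightarrow> real \<Rightarrow> bool" where
  "comparable lo hi u v \<longleftrightarrow> lo * v \<le> u \<and> u \<le> hi * v"


subsection \<open>The linear model\<close>

text \<open>
  \<open>P\<close> is the law of one observation \<open>Z = (x, y)\<close>; an i.i.d. sample of size \<open>n\<close> is a point of
  \<open>Pi\<^sub>M {..<n} (\<lambda>_. P)\<close>. Working with laws keeps the statement free of a type variable for the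
  sample space, on which existentially quantified constants could otherwise depend.
\<close>

definition obs_space :: "nat \<Rightarrow> obs measure" where
  "obs_space p = Pi\<^sub>M {..<p} (\<lambda>_. borel) \<Otimes>\<^sub>M borel"

definition sample :: "nat \<Rightarrow> obs measure \<Rightarrow> (nat \<Rightarrow> obs) measure" where
  "sample n P = Pi\<^sub>M {..<n} (\<lambda>_. P)"

definition noise :: "nat \<Rightarrow> vec \<Rightarrow> obs \<Rightarrow> real" where
  "noise p \<theta> z = snd z - dot p (fst z) \<theta>"

definition covariate_algebra :: "nat \<Rightarrow> obs measure \<Rightarrow> obs measure" where
  "covariate_algebra p P = vimage_algebra (space P) fst (Pi\<^sub>M {..<p} (\<lambda>_. borel))"

definition linear_model :: "nat \<Rightarrow> vec \<Rightarrow> obs measure \<Rightarrow> bool" where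
  "linear_model p \<theta> P \<longleftrightarrow>
     prob_space P \<and> sets P = sets (obs_space p) \<and> integrable P (noise p \<theta>) \<and>
     (AE z in P. real_cond_exp P (covariate_algebra p P) (noise p \<theta>) z = 0)"

definition moment_x :: "nat \<Rightarrow> obs measure \<Rightarrow> real \<Rightarrow> nat \<Rightarrow> ennreal" where
  "moment_x p P q l =
     (SUP v\<in>{v. L2_set v {..<p} = 1 \<and> l0_norm p v \<le> l}.
        \<integral>\<^sup>+ z. ennreal (\<bar>dot p (fst z) v\<bar> powr q) \<partial>P)"

text \<open>
  A conditional expectation is determined only almost surely, so the supremum over the values of the
  covariate is the essential supremum.
\<close>

definition moment_eps :: "nat \<Rightarrow> vec \<Rightarrow> obs measure \<Rightarrow> real \<Rightarrow> ennreal" where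
  "moment_eps p \<theta> P q =
     esssup P (nn_cond_exp P (covariate_algebra p P) (\<lambda>z. ennreal (\<bar>noise p \<theta> z\<bar> powr q)))"

definition moment_eff :: "nat \<Rightarrow> vec \<Rightarrow> obs measure \<Rightarrow> real \<Rightarrow> nat \<Rightarrow> ennreal" where
  "moment_eff p \<theta> P q l = moment_eps p \<theta> P q * moment_x p P q l"

definition Sigma_x :: "obs measure \<Rightarrow> nat \<Rightarrow> nat \<Rightarrow> real" where
  "Sigma_x P j k = (\<integral>z. fst z j * fst z k \<partial>P)"

definition sparse_eigenvalues :: "nat \<Rightarrow> obs measure \<Rightarrow> nat \<Rightarrow> real \<Rightarrow> real \<Rightarrow> bool" where
  "sparse_eigenvalues p P l \<kappa>m \<kappa>p \<longleftrightarrow>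
     (\<forall>v. l0_norm p v \<le> l \<longrightarrow>
        \<kappa>m * (L2_set v {..<p})\<^sup>2 \<le> (\<Sum>j<p. \<Sum>k<p. v j * Sigma_x P j k * v k) \<and>
        (\<Sum>j<p. \<Sum>k<p. v j * Sigma_x P j k * v k) \<le> \<kappa>p * (L2_set v {..<p})\<^sup>2)"


subsection \<open>The algorithm\<close>

definition loss :: "nat \<Rightarrow> vec \<Rightarrow> obs \<Rightarrow> real" where
  "loss p \<theta> z = (snd z - dot p (fst z) \<theta>)\<^sup>2 / 2"

definition grad_loss :: "nat \<Rightarrow> vec \<Rightarrow> obs \<Rightarrow> nat \<Rightarrow> real" where
  "grad_loss p \<theta> z j = (dot p (fst z) \<theta> - snd z) * fst z j"

lemma grad_loss_partial_derivative:
  assumes "j < p"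
  shows "((\<lambda>t. loss p (\<theta>(j := t)) z) has_real_derivative grad_loss p \<theta> z j) (at (\<theta> j))"
proof -
  have dot_upd: "dot p (fst z) (\<theta>(j := t)) = dot p (fst z) \<theta> + fst z j * (t - \<theta> j)" for t
  proof -
    have "dot p (fst z) (\<theta>(j := t)) = (\<Sum>i<p. fst z i * \<theta> i + (if i = j then fst z j * (t - \<theta> j) else 0))"
      unfolding dot_def by (rule sum.cong) (auto simp: algebra_simps)
    also have "\<dots> = dot p (fst z) \<theta> + fst z j * (t - \<theta> j)"
      using assms by (simp add: sum.distrib dot_def)
    finally show ?thesis .
  qed
  show ?thesis
    unfolding loss_def grad_loss_def dot_upd
    by (auto intro!: derivative_eq_intros simp: field_simps)
qed

text \<open>
  Both positions coincide when the length is odd; when it is even, the two middle order statistics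
  are averaged.
\<close>

definition median :: "real list \<Rightarrow> real" where
  "median xs = (sort xs ! ((length xs - 1) div 2) + sort xs ! (length xs div 2)) / 2"

text \<open>Data subsets, batches and blocks are represented by sets of observation indices.\<close>

definition near_equal_partition :: "nat \<Rightarrow> nat set \<Rightarrow> (nat \<Rightarrow> nat set) \<Rightarrow> bool" where
  "near_equal_partition K A B \<longleftrightarrow>
     disjoint_family_on B {..<K} \<and> (\<Union>k<K. B k) = A \<and>
     (\<forall>k<K. \<forall>l<K. card (B k) \<le> card (B l) + 1)"

definition mom_grad ::
    "nat \<Rightarrow> nat \<Rightarrow> (nat \<Rightarrow> nat set) \<Rightarrow> (nat \<Rightarrow> obs) \<Rightarrow> vec \<Rightarrow> vec" where
  "mom_grad p K B z \<theta> =
     (\<lambda>j. median (map (\<lambda>k. (\<Sum>i\<in>B k. grad_loss p \<theta> (z i) j) / real (card (B k))) [0..<K]))"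

text \<open>Ties in absolute value are broken in favour of the smaller index.\<close>

definition hard_threshold :: "nat \<Rightarrow> nat \<Rightarrow> vec \<Rightarrow> vec" where
  "hard_threshold p s v =
     (\<lambda>j. if j < p \<and> card {i. i < p \<and> (\<bar>v i\<bar> > \<bar>v j\<bar> \<or> \<bar>v i\<bar> = \<bar>v j\<bar> \<and> i < j)} < s then v j else 0)"

text \<open>The \<open>t\<close>-th step uses the blocks \<open>Bs t\<close>.\<close>

primrec mom_iht ::
    "nat \<Rightarrow> nat \<Rightarrow> real \<Rightarrow> nat \<Rightarrow> (nat \<Rightarrow> nat \<Rightarrow> nat set) \<Rightarrow> (nat \<Rightarrow> obs) \<Rightarrow> vec \<Rightarrow> nat \<Rightarrow> vec" where
  "mom_iht p s \<eta> K Bs z \<theta>0 0 = \<theta>0"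
| "mom_iht p s \<eta> K Bs z \<theta>0 (Suc t) =
     (let \<theta> = mom_iht p s \<eta> K Bs z \<theta>0 t
      in hard_threshold p s (\<lambda>j. \<theta> j - \<eta> * mom_grad p K (Bs t) z \<theta> j))"

definition phase_one ::
    "nat \<Rightarrow> nat \<Rightarrow> real \<Rightarrow> nat \<Rightarrow> (nat \<Rightarrow> nat set) \<Rightarrow> nat \<Rightarrow> vec \<Rightarrow> (nat \<Rightarrow> obs) \<Rightarrow> vec" where
  "phase_one p s \<eta> K1 B1 T1 \<theta>0 z = mom_iht p s \<eta> K1 (\<lambda>_. B1) z \<theta>0 T1"

definition ts_right ::
    "nat \<Rightarrow> nat \<Rightarrow> real \<Rightarrow> nat \<Rightarrow> (nat \<Rightarrow> nat set) \<Rightarrow> nat \<Rightarrow> nat \<Rightarrow> (nat \<Rightarrow> nat \<Rightarrow> nat set) \<Rightarrow> nat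
     \<Rightarrow> vec \<Rightarrow> (nat \<Rightarrow> obs) \<Rightarrow> vec" where
  "ts_right p s \<eta> K1 B1 T1 K2 B2 T2 \<theta>0 z =
     mom_iht p s \<eta> K2 B2 z (phase_one p s \<eta> K1 B1 T1 \<theta>0 z) T2"

text \<open>
  \<open>D1\<close> and \<open>D2\<close> are the two parts of the sample, \<open>B1\<close> the blocks of \<open>D1\<close>, \<open>D2b l\<close> the batches of
  \<open>D2\<close>, and \<open>B2 l\<close> the blocks of the batch \<open>D2b l\<close>; batches are numbered from \<open>0\<close>.
\<close>

definition ts_right_split ::
    "nat \<Rightarrow> nat set \<Rightarrow> nat set \<Rightarrow> nat \<Rightarrow> (nat \<Rightarrow> nat set) \<Rightarrow> nat \<Rightarrow> (nat \<Rightarrow> nat set)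
     \<Rightarrow> nat \<Rightarrow> (nat \<Rightarrow> nat \<Rightarrow> nat set) \<Rightarrow> bool" where
  "ts_right_split n D1 D2 K1 B1 T2 D2b K2 B2 \<longleftrightarrow>
     D1 \<union> D2 = {..<n} \<and> D1 \<inter> D2 = {} \<and>
     near_equal_partition K1 D1 B1 \<and>
     near_equal_partition T2 D2 D2b \<and>
     (\<forall>l<T2. near_equal_partition K2 (D2b l) (B2 l))"

end

theory Submission
  imports Defs
begin

text \<open>
  On sparse vectors a gradient step contracts the squared error by the factor \<open>1 - \<eta>\<^sub>0 / \<kappa>\<^sup>2\<close>, since
  the step size is at most \<open>1 / \<kappa>\<^sub>+\<close>, and hard thresholding with enough spare sparsity expands
  it by a factor so close to one that a contraction remains. It therefore suffices that in every
  coordinate the median-of-means gradient errs by a small multiple of \<open>\<parallel>\<theta> - \<theta>\<^sup>*\<parallel> / sqrt s\<close> plus the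
  noise level.

  In one block the deviations of signal and noise are controlled by the inequality of von Bahr and
  Esseen, so a block fails with small constant probability, and a constant fraction of \<open>K\<close> blocks
  fails with probability exponentially small in \<open>K\<close>. For a fixed parameter \<open>K \<asymp> log p\<close> blocks then suffice for all
  coordinates at once; this is enough in phase two, where the batch is independent of the iterate.
  Phase one reuses its data and needs all sparse parameters simultaneously: \<open>K \<asymp> s log p\<close> blocks pay for
  a union bound over a grid of sparse vectors of polynomial fineness, and the rounding error is bounded in
  most blocks by crude coordinatewise deviations.
\<close>

section \<open>Medians and hard thresholding\<close>

text \<open>Failure probabilities are traded against the number of ways to fail. A block may fail
  with probability \<open>y ^ 6\<close>; there are at most \<open>2 ^ K\<close> sets of blocks, so a
  sixth of them fails with probability at most \<open>(2 * y) ^ K\<close>. For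
  \<open>y = exp (- L) / 2\<close> this is \<open>exp (- (L * K))\<close>, and the choice of
  \<open>L\<close> decides which union bound it can pay for.

  The sample size comes from the tolerance. An error \<open>t\<close> in every coordinate costs
  \<open>sqrt l * t\<close> in norm, so \<open>t\<close> is a multiple of
  \<open>\<kappa>m / sqrt l\<close>. A block of size \<open>m\<close> fails with probability of
  order \<open>Mx / (m powr lam * t powr (1 + lam))\<close>, so \<open>m\<close> has the order
  \<open>Mx powr (1 / lam) * l powr ((1 + lam) / (2 * lam))\<close>, and phase one has about
  \<open>l * ln p\<close> blocks. For the noise the same relation, solved for the tolerance, gives
  the error rate.

  Phase two improves the rate because its batches together have only about
  \<open>ln s * ln p\<close> blocks. The ratio of the two rates is polynomial in \<open>s\<close>,
  so \<open>ln s\<close> steps and batches are enough.\<close>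

lemma sort_nth_le_iff:
  fixes xs :: "real list"
  assumes "i < length xs"
  shows "sort xs ! i \<le> c \<longleftrightarrow> i < card {j. j < length xs \<and> xs ! j \<le> c}"
proof -
  define ys where "ys = sort xs"
  have len: "length ys = length xs" by (simp add: ys_def)
  have "card {j. j < length xs \<and> xs ! j \<le> c} = length (filter (\<lambda>x. x \<le> c) xs)"
    by (simp add: length_filter_conv_card)
  also have "\<dots> = length (filter (\<lambda>x. x \<le> c) ys)"
    by (simp add: ys_def filter_sort)
  also have "\<dots> = card {j. j < length ys \<and> ys ! j \<le> c}"
    by (simp add: length_filter_conv_card)
  finally have eq: "card {j. j < length xs \<and> xs ! j \<le> c} = card {j. j < length ys \<and> ys ! j \<le> c}" .
  \<comment> \<open>Sorting preserves the count, and monotonicity makes the entries at most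
    \<open>c\<close> an initial segment; position \<open>i\<close> lies in it exactly when its
    length exceeds \<open>i\<close>.\<close>
  have mono: "ys ! j \<le> ys ! k" if "j \<le> k" "k < length ys" for j k
    using that sorted_nth_mono[of ys j k] by (simp add: ys_def)
  show ?thesis
  proof
    assume "sort xs ! i \<le> c"
    then have "{..i} \<subseteq> {j. j < length ys \<and> ys ! j \<le> c}"
      using mono assms len by (force simp: ys_def)
    then have "card {..i} \<le> card {j. j < length ys \<and> ys ! j \<le> c}"
      by (intro card_mono) auto
    then show "i < card {j. j < length xs \<and> xs ! j \<le> c}" using eq by simp
  next
    assume a: "i < card {j. j < length xs \<and> xs ! j \<le> c}"
    show "sort xs ! i \<le> c"
    proof (rule ccontr)
      assume n: "\<not> sort xs ! i \<le> c"
      have "{j. j < length ys \<and> ys ! j \<le> c} \<subseteq> {..<i}"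
      proof
        fix j assume j: "j \<in> {j. j < length ys \<and> ys ! j \<le> c}"
        show "j \<in> {..<i}"
        proof (rule ccontr)
          assume "j \<notin> {..<i}"
          then have "ys ! i \<le> ys ! j" using j by (intro mono) auto
          then show False using j n by (simp add: ys_def)
        qed
      qed
      then have "card {j. j < length ys \<and> ys ! j \<le> c} \<le> card {..<i}" by (intro card_mono) auto
      then show False using a eq by simp
    qed
  qed
qed

text \<open>A middle order statistic outside the interval would put itself and everything beyond it
  among the bad values, at least half of all. Treating all positions from
  \<open>(K - 1) div 2\<close> to \<open>K div 2\<close> alike spares a distinction by
  parity.\<close>

lemma median_close:
  assumes "2 * card {k. k < K \<and> \<bar>f k - \<mu>\<bar> > t} < K"
  shows "\<bar>median (map f [0..<K]) - \<mu>\<bar> \<le> t"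
proof -
  define bad where "bad = {k. k < K \<and> \<bar>f k - \<mu>\<bar> > t}"
  have bad: "2 * card bad < K" using assms by (simp add: bad_def)
  let ?xs = "map f [0..<K]"
  have set_eq: "{j. j < length ?xs \<and> ?xs ! j \<le> c} = {k. k < K \<and> f k \<le> c}" for c by auto
  have close: "\<bar>sort ?xs ! i - \<mu>\<bar> \<le> t" if i: "(K - 1) div 2 \<le> i" "i \<le> K div 2" for i
  proof -
    have iK: "i < length ?xs" using i bad by simp
    have "card ({..<K} - bad) = K - card bad"
      by (subst card_Diff_subset) (auto simp: bad_def)
    moreover have "card ({..<K} - bad) \<le> card {k. k < K \<and> f k \<le> \<mu> + t}"
      by (rule card_mono) (auto simp: bad_def)
    ultimately have "i < card {k. k < K \<and> f k \<le> \<mu> + t}" using i bad by linarith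
    then have up: "sort ?xs ! i \<le> \<mu> + t" using sort_nth_le_iff[OF iK] set_eq by simp
    have lo: "sort ?xs ! i \<ge> \<mu> - t"
    proof (rule ccontr)
      assume n: "\<not> ?thesis"
      have "i < card {k. k < K \<and> f k \<le> sort ?xs ! i}"
        using sort_nth_le_iff[OF iK, of "sort ?xs ! i"] set_eq by simp
      also have "\<dots> \<le> card bad" unfolding bad_def using n by (intro card_mono) auto
      finally show False using i bad by linarith
    qed
    show ?thesis using up lo by linarith
  qed
  have "\<bar>sort ?xs ! ((K - 1) div 2) - \<mu>\<bar> \<le> t" "\<bar>sort ?xs ! (K div 2) - \<mu>\<bar> \<le> t"
    by (intro close; simp add: div_le_mono)+
  then show ?thesis unfolding median_def by (simp add: abs_le_iff field_simps)
qed

section \<open>Hard thresholding and its expansion factor\<close>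

definition kept :: "nat \<Rightarrow> nat \<Rightarrow> vec \<Rightarrow> nat set" where
  "kept p s v = {j. j < p \<and> card {i. i < p \<and> (\<bar>v i\<bar> > \<bar>v j\<bar> \<or> \<bar>v i\<bar> = \<bar>v j\<bar> \<and> i < j)} < s}"

lemma kept_subset: "kept p s v \<subseteq> {..<p}"
  by (auto simp: kept_def)

lemma finite_kept: "finite (kept p s v)"
  by (rule finite_subset[OF kept_subset]) simp

lemma hard_threshold_kept: "hard_threshold p s v j = (if j \<in> kept p s v then v j else 0)"
  by (simp add: hard_threshold_def kept_def)

text \<open>Breaking ties by the index makes the comparison a strict total order on the coordinates.
  The number of predecessors is then an injective rank into \<open>{..<p}\<close>, hence a
  bijection, and exactly \<open>s\<close> coordinates have rank below \<open>s\<close>.\<close>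

lemma
  assumes "s \<le> p"
  shows card_kept: "card (kept p s v) = s"
    and kept_dominates: "\<lbrakk>j \<in> kept p s v; i < p; i \<notin> kept p s v\<rbrakk> \<Longrightarrow> \<bar>v i\<bar> \<le> \<bar>v j\<bar>"
proof -
  define R where "R j = {i. i < p \<and> (\<bar>v i\<bar> > \<bar>v j\<bar> \<or> \<bar>v i\<bar> = \<bar>v j\<bar> \<and> i < j)}" for j
  define r where "r j = card (R j)" for j
  have fin: "finite (R j)" for j by (auto simp: R_def)
  have less: "r i < r j" if "i \<in> R j" for i j
  proof -
    have "R i \<subset> R j"
    proof
      show "R i \<subseteq> R j" using that by (auto simp: R_def)
      show "R i \<noteq> R j" using that by (auto simp: R_def)
    qed
    then show ?thesis unfolding r_def by (intro psubset_card_mono fin)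
  qed
  have tri: "i \<in> R j \<or> j \<in> R i \<or> i = j" if "i < p" "j < p" for i j
    using that by (auto simp: R_def)
  have inj: "inj_on r {..<p}"
  proof (rule inj_onI)
    fix i j assume "i \<in> {..<p}" "j \<in> {..<p}" "r i = r j"
    then show "i = j" using tri[of i j] less[of i j] less[of j i] by auto
  qed
  have lt: "r j < p" if "j < p" for j
  proof -
    have "R j \<subset> {..<p}" using that by (auto simp: R_def)
    then have "card (R j) < card {..<p}" by (intro psubset_card_mono) auto
    then show ?thesis by (simp add: r_def)
  qed
  have img: "r ` {..<p} = {..<p}"
    using inj lt by (intro card_subset_eq) (auto simp: card_image)
  have kept: "kept p s v = {j. j < p \<and> r j < s}" by (simp add: kept_def r_def R_def)
  have "r ` kept p s v = {..<s}"
  proof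
    show "{..<s} \<subseteq> r ` kept p s v"
    proof
      fix k assume k: "k \<in> {..<s}"
      then have "k \<in> r ` {..<p}" using assms img by auto
      then show "k \<in> r ` kept p s v" using k kept by auto
    qed
  qed (auto simp: kept)
  moreover have "inj_on r (kept p s v)" by (rule inj_on_subset[OF inj kept_subset])
  ultimately show "card (kept p s v) = s" by (metis card_image card_lessThan)
  show "\<bar>v i\<bar> \<le> \<bar>v j\<bar>" if j: "j \<in> kept p s v" and i: "i < p" "i \<notin> kept p s v"
  proof (rule ccontr)
    assume "\<not> ?thesis"
    then have "i \<in> R j" using i by (auto simp: R_def)
    then have "r i < r j" by (rule less)
    then show False using i j kept by auto
  qed
qed

lemma l0_hard_threshold:
  assumes "s \<le> p"
  shows "l0_norm p (hard_threshold p s v) \<le> s"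
proof -
  have "{j. j < p \<and> hard_threshold p s v j \<noteq> 0} \<subseteq> kept p s v"
    by (auto simp: hard_threshold_kept split: if_splits)
  then have "l0_norm p (hard_threshold p s v) \<le> card (kept p s v)"
    unfolding l0_norm_def by (intro card_mono finite_kept)
  then show ?thesis using card_kept[OF assms] by simp
qed

text \<open>Young's inequality with the slack on \<open>b\<close>: the error \<open>b - a\<close>
  keeps a coefficient close to one, and the large coefficient falls on a term that domination makes
  small.\<close>

lemma square_split:
  fixes a b \<beta> :: real
  assumes "\<beta> > 0"
  shows "a\<^sup>2 \<le> (1 + \<beta>) * (b - a)\<^sup>2 + (1 + 1 / \<beta>) * b\<^sup>2"
proof -
  have "0 \<le> (\<beta> * (b - a) + b)\<^sup>2 / \<beta>" using assms by simp
  also have "\<dots> = (1 + \<beta>) * (b - a)\<^sup>2 + (1 + 1 / \<beta>) * b\<^sup>2 - a\<^sup>2"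
    using assms by (simp add: field_simps power2_eq_square)
  finally show ?thesis by simp
qed

text \<open>The kept coordinates off the support of \<open>w\<close> outnumber the missed coordinates of \<open>w\<close>
  and dominate them in absolute value; this makes the expansion factor close to one.\<close>

lemma hard_threshold_expansion:
  assumes s: "s \<le> p" and w: "l0_norm p w \<le> s'" and ss: "s' < s" and \<beta>: "\<beta> > 0"
    and ratio: "(1 + 1 / \<beta>) * real s' \<le> \<beta> * (real s - real s')"
    and S: "kept p s u \<subseteq> S" "{j. j < p \<and> w j \<noteq> 0} \<subseteq> S" "S \<subseteq> {..<p}"
  shows "(\<Sum>j<p. (hard_threshold p s u j - w j)\<^sup>2) \<le> (1 + \<beta>) * (\<Sum>j\<in>S. (u j - w j)\<^sup>2)"
proof -
  define I where "I = kept p s u"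
  define W where "W = {j. j < p \<and> w j \<noteq> 0}"
  have fin: "finite I" "finite W" "finite S"
    using finite_kept finite_subset[OF S(3)] by (auto simp: I_def W_def)
  have sub: "I \<subseteq> {..<p}" "W \<subseteq> {..<p}" using kept_subset by (auto simp: I_def W_def)
  have cW: "card W \<le> s'" using w by (simp add: l0_norm_def W_def)
  have cI: "card I = s" using card_kept[OF s] by (simp add: I_def)
  let ?d = "\<lambda>j. (u j - w j)\<^sup>2"
  have d0: "0 \<le> sum ?d A" for A by (intro sum_nonneg) auto
  have "(\<Sum>j<p. (hard_threshold p s u j - w j)\<^sup>2) = (\<Sum>j\<in>I \<union> W. (hard_threshold p s u j - w j)\<^sup>2)"
    using sub by (intro sum.mono_neutral_right) (auto simp: hard_threshold_kept I_def W_def)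
  also have "\<dots> = (\<Sum>j\<in>I \<union> (W - I). (hard_threshold p s u j - w j)\<^sup>2)" by simp
  also have "\<dots> = (\<Sum>j\<in>I. (hard_threshold p s u j - w j)\<^sup>2) + (\<Sum>j\<in>W - I. (hard_threshold p s u j - w j)\<^sup>2)"
    using fin by (intro sum.union_disjoint) auto
  also have "\<dots> = sum ?d I + (\<Sum>j\<in>W - I. (w j)\<^sup>2)"
    by (intro arg_cong2[where f = "(+)"] sum.cong) (auto simp: hard_threshold_kept I_def)
  finally have eq: "(\<Sum>j<p. (hard_threshold p s u j - w j)\<^sup>2) = sum ?d I + (\<Sum>j\<in>W - I. (w j)\<^sup>2)" .
  define N where "N = I - W"
  have cN: "card N \<ge> s - s'"
    using diff_card_le_card_Diff[OF fin(2), of I] cI cW by (simp add: N_def)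
  then have cNr: "real (card N) \<ge> real s - real s'" by linarith
  have N0: "real (card N) > 0" using cNr ss by linarith
  have cWI: "card (W - I) \<le> s'" using cW card_mono[OF fin(2), of "W - I"] by force
  \<comment> \<open>A missed entry is at most every entry on \<open>N\<close>, hence at most their
    mean square. The surplus of kept coordinates enters through this division by
    \<open>card N\<close>.\<close>
  have dom: "(u j)\<^sup>2 \<le> (\<Sum>i\<in>N. (u i)\<^sup>2) / real (card N)" if "j \<in> W - I" for j
  proof -
    have "(\<Sum>i\<in>N. (u j)\<^sup>2) \<le> (\<Sum>i\<in>N. (u i)\<^sup>2)"
    proof (rule sum_mono)
      fix i assume "i \<in> N"
      then have "\<bar>u j\<bar> \<le> \<bar>u i\<bar>"
        using that sub by (intro kept_dominates[OF s, of i u j]) (auto simp: N_def I_def)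
      then show "(u j)\<^sup>2 \<le> (u i)\<^sup>2" by (simp add: abs_le_square_iff)
    qed
    then show ?thesis using N0 by (simp add: field_simps)
  qed
  \<comment> \<open>The target vanishes on \<open>N\<close>, so \<open>u\<close> is pure error there
    and can be charged to the right-hand side.\<close>
  have sN: "(\<Sum>i\<in>N. (u i)\<^sup>2) = sum ?d N"
    by (intro sum.cong) (use sub in \<open>auto simp: N_def W_def\<close>)
  have "(\<Sum>j\<in>W - I. (u j)\<^sup>2) \<le> (\<Sum>j\<in>W - I. sum ?d N / real (card N))"
    using dom sN by (intro sum_mono) auto
  also have "\<dots> = real (card (W - I)) * (sum ?d N / real (card N))" by simp
  also have "\<dots> \<le> real s' * (sum ?d N / real (card N))"
    using cWI d0 by (intro mult_right_mono) auto
  finally have uW: "(\<Sum>j\<in>W - I. (u j)\<^sup>2) \<le> real s' * (sum ?d N / real (card N))" .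
  have "(\<Sum>j\<in>W - I. (w j)\<^sup>2) \<le> (\<Sum>j\<in>W - I. (1 + \<beta>) * ?d j + (1 + 1 / \<beta>) * (u j)\<^sup>2)"
    using square_split[OF \<beta>] by (intro sum_mono)
  also have "\<dots> = (1 + \<beta>) * sum ?d (W - I) + (1 + 1 / \<beta>) * (\<Sum>j\<in>W - I. (u j)\<^sup>2)"
    by (simp add: sum.distrib sum_distrib_left)
  also have "(1 + 1 / \<beta>) * (\<Sum>j\<in>W - I. (u j)\<^sup>2) \<le> (1 + 1 / \<beta>) * (real s' * (sum ?d N / real (card N)))"
    using uW \<beta> by (intro mult_left_mono) auto
  also have "\<dots> = ((1 + 1 / \<beta>) * real s') * (sum ?d N / real (card N))" by simp
  also have "\<dots> \<le> (\<beta> * real (card N)) * (sum ?d N / real (card N))"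
  proof (intro mult_right_mono)
    have "\<beta> * (real s - real s') \<le> \<beta> * real (card N)" using cNr \<beta> by simp
    then show "(1 + 1 / \<beta>) * real s' \<le> \<beta> * real (card N)" using ratio by linarith
  qed (use d0 in auto)
  also have "\<dots> = \<beta> * sum ?d N" using N0 by simp
  also have "\<beta> * sum ?d N \<le> \<beta> * sum ?d I"
    using \<beta> fin by (intro mult_left_mono sum_mono2) (auto simp: N_def)
  finally have "(\<Sum>j\<in>W - I. (w j)\<^sup>2) \<le> (1 + \<beta>) * sum ?d (W - I) + \<beta> * sum ?d I" by simp
  then have "(\<Sum>j<p. (hard_threshold p s u j - w j)\<^sup>2) \<le> (1 + \<beta>) * (sum ?d I + sum ?d (W - I))"
    using eq by (simp add: algebra_simps)
  also have "sum ?d I + sum ?d (W - I) = sum ?d (I \<union> (W - I))"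
    using fin by (intro sum.union_disjoint[symmetric]) auto
  also have "\<dots> \<le> sum ?d S"
    using S fin by (intro sum_mono2) (auto simp: I_def W_def)
  finally show ?thesis using \<beta> by (simp add: mult_left_mono)
qed

section \<open>The gradient step on sparse vectors\<close>

definition sparse_spectrum :: "nat \<Rightarrow> (nat \<Rightarrow> nat \<Rightarrow> real) \<Rightarrow> nat \<Rightarrow> real \<Rightarrow> real \<Rightarrow> bool" where
  "sparse_spectrum p G l \<kappa>m \<kappa>p \<longleftrightarrow>
     (\<forall>v. l0_norm p v \<le> l \<longrightarrow>
        \<kappa>m * (\<Sum>j<p. (v j)\<^sup>2) \<le> (\<Sum>j<p. \<Sum>k<p. v j * G j k * v k) \<and>
        (\<Sum>j<p. \<Sum>k<p. v j * G j k * v k) \<le> \<kappa>p * (\<Sum>j<p. (v j)\<^sup>2))"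

text \<open>With \<open>w\<close> the part of the gradient on \<open>S\<close>, the squared norm of
  \<open>h - \<eta> * w\<close> expands into the norm of \<open>h\<close>, minus
  \<open>2 * \<eta>\<close> times the quadratic form of \<open>h\<close>, plus
  \<open>\<eta>\<^sup>2\<close> times the norm of \<open>w\<close>. The last is at most
  \<open>\<kappa>p\<close> times the same form, so half of the decrease survives when
  \<open>\<eta> * \<kappa>p \<le> 1\<close>.\<close>

lemma gradient_step_contraction:
  assumes sym: "\<And>j k. G j k = G k j" and spec: "sparse_spectrum p G l \<kappa>m \<kappa>p"
    and S: "S \<subseteq> {..<p}" "card S \<le> l" and h: "\<And>j. j < p \<Longrightarrow> j \<notin> S \<Longrightarrow> h j = 0"
    and \<kappa>: "0 < \<kappa>m" "0 < \<kappa>p" and \<eta>: "0 \<le> \<eta>" "\<eta> * \<kappa>p \<le> 1"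
  shows "(\<Sum>j\<in>S. (h j - \<eta> * (\<Sum>k<p. G j k * h k))\<^sup>2) \<le> (1 - \<eta> * \<kappa>m) * (\<Sum>j<p. (h j)\<^sup>2)"
proof -
  define Q where "Q u v = (\<Sum>j<p. \<Sum>k<p. u j * G j k * v k)" for u v
  define N where "N v = (\<Sum>j<p. (v j)\<^sup>2)" for v :: vec
  define w where "w j = (if j \<in> S then (\<Sum>k<p. G j k * h k) else 0)" for j
  have finS: "finite S" using S finite_subset by blast
  have sparse: "l0_norm p v \<le> l" if "\<And>j. j < p \<Longrightarrow> j \<notin> S \<Longrightarrow> v j = 0" for v
  proof -
    have "{j. j < p \<and> v j \<noteq> 0} \<subseteq> S" using that by auto
    then have "card {j. j < p \<and> v j \<noteq> 0} \<le> card S" using finS by (rule card_mono[rotated])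
    then show ?thesis using S by (simp add: l0_norm_def)
  qed
  have spec': "\<kappa>m * N v \<le> Q v v" "Q v v \<le> \<kappa>p * N v" if "\<And>j. j < p \<Longrightarrow> j \<notin> S \<Longrightarrow> v j = 0" for v
    using sparse[OF that] spec by (auto simp: sparse_spectrum_def Q_def N_def)
  have sumS: "(\<Sum>j<p. f j) = (\<Sum>j\<in>S. f j)" if "\<And>j. j < p \<Longrightarrow> j \<notin> S \<Longrightarrow> f j = 0" for f :: "nat \<Rightarrow> real"
    using that S by (intro sum.mono_neutral_right) auto
  have Qw: "Q w h = N w"
  proof -
    have "Q w h = (\<Sum>j<p. w j * (\<Sum>k<p. G j k * h k))"
      by (simp add: Q_def sum_distrib_left mult.assoc)
    also have "\<dots> = (\<Sum>j<p. (w j)\<^sup>2)"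
      by (intro sum.cong) (auto simp: w_def power2_eq_square)
    finally show ?thesis by (simp add: N_def)
  qed
  have Qsym: "Q u v = Q v u" for u v
  proof -
    have "Q u v = (\<Sum>k<p. \<Sum>j<p. u j * G j k * v k)" unfolding Q_def by (rule sum.swap)
    also have "\<dots> = Q v u" unfolding Q_def
      by (intro sum.cong refl) (metis sym mult.commute mult.assoc)
    finally show ?thesis .
  qed
  \<comment> \<open>A bound on the gradient without operator norms or matrix roots: the form is
    nonnegative at \<open>w - \<kappa>p * h\<close>, which is again supported on \<open>S\<close>,
    and its cross term is \<open>N w\<close>.\<close>
  have Nw: "N w \<le> \<kappa>p * Q h h"
  proof -
    let ?v = "\<lambda>j. w j - \<kappa>p * h j"
    have "Q ?v ?v = Q w w - \<kappa>p * Q w h - \<kappa>p * Q h w + \<kappa>p\<^sup>2 * Q h h"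
      unfolding Q_def
      by (simp add: algebra_simps sum.distrib sum_subtractf sum_distrib_left power2_eq_square)
    then have eq: "Q ?v ?v = Q w w - 2 * \<kappa>p * N w + \<kappa>p\<^sup>2 * Q h h"
      using Qw Qsym[of h w] by simp
    have "0 \<le> \<kappa>m * N ?v" using \<kappa> by (simp add: N_def sum_nonneg)
    also have "\<dots> \<le> Q ?v ?v" using h by (intro spec'(1)) (auto simp: w_def)
    finally have "2 * \<kappa>p * N w \<le> Q w w + \<kappa>p\<^sup>2 * Q h h" using eq by simp
    moreover have "Q w w \<le> \<kappa>p * N w" by (intro spec'(2)) (auto simp: w_def)
    ultimately have "\<kappa>p * N w \<le> \<kappa>p * (\<kappa>p * Q h h)"
      by (simp add: power2_eq_square algebra_simps)
    then show ?thesis using \<kappa> by simp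
  qed
  have Qhh: "Q h h = (\<Sum>j<p. h j * (\<Sum>k<p. G j k * h k))"
    by (simp add: Q_def sum_distrib_left mult.assoc)
  also have "\<dots> = (\<Sum>j\<in>S. h j * w j)"
    by (subst sumS) (auto simp: h w_def)
  finally have Qhw: "Q h h = (\<Sum>j\<in>S. h j * w j)" .
  have "(\<Sum>j\<in>S. (h j - \<eta> * (\<Sum>k<p. G j k * h k))\<^sup>2) = (\<Sum>j\<in>S. (h j - \<eta> * w j)\<^sup>2)"
    by (intro sum.cong) (auto simp: w_def)
  also have "\<dots> = (\<Sum>j\<in>S. (h j)\<^sup>2) - 2 * \<eta> * (\<Sum>j\<in>S. h j * w j) + \<eta>\<^sup>2 * (\<Sum>j\<in>S. (w j)\<^sup>2)"
    by (simp add: power2_diff power_mult_distrib sum.distrib sum_subtractf sum_distrib_left algebra_simps)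
  also have "\<dots> = N h - 2 * \<eta> * Q h h + \<eta>\<^sup>2 * N w"
    unfolding N_def by (simp add: Qhw sumS h w_def)
  also have "\<dots> \<le> N h - 2 * \<eta> * Q h h + \<eta>\<^sup>2 * (\<kappa>p * Q h h)"
    using Nw by (intro add_left_mono mult_left_mono) auto
  also have "\<dots> = N h - \<eta> * Q h h * (2 - \<eta> * \<kappa>p)" by (simp add: algebra_simps power2_eq_square)
  also have "\<dots> \<le> N h - \<eta> * Q h h"
  proof -
    have "0 \<le> Q h h" using spec'(1)[of h] h \<kappa> by (smt (verit) N_def sum_nonneg mult_nonneg_nonneg zero_le_power2)
    then have "\<eta> * Q h h * 1 \<le> \<eta> * Q h h * (2 - \<eta> * \<kappa>p)" using \<eta> by (intro mult_left_mono) auto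
    then show ?thesis by simp
  qed
  also have "\<dots> \<le> N h - \<eta> * (\<kappa>m * N h)"
    using spec'(1)[of h] h \<eta> by (simp add: mult_left_mono)
  finally show ?thesis by (simp add: N_def algebra_simps)
qed

section \<open>Contraction of the iteration\<close>

lemma L2_set_le_const:
  assumes "finite S" "real (card S) \<le> l" "\<And>j. j \<in> S \<Longrightarrow> \<bar>f j\<bar> \<le> e" "0 \<le> e"
  shows "L2_set f S \<le> sqrt l * e"
proof -
  have "(\<Sum>j\<in>S. (f j)\<^sup>2) \<le> (\<Sum>j\<in>S. e\<^sup>2)"
    using assms by (intro sum_mono) (metis abs_ge_zero power2_abs power_mono)
  also have "\<dots> = real (card S) * e\<^sup>2" by simp
  also have "\<dots> \<le> l * e\<^sup>2" using assms by (intro mult_right_mono) auto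
  finally have "L2_set f S \<le> sqrt (l * e\<^sup>2)" unfolding L2_set_def by (rule real_sqrt_le_mono)
  then show ?thesis using assms by (simp add: real_sqrt_mult)
qed

text \<open>The budget of one iteration: expansion \<open>1 + x / 2\<close> from thresholding,
  contraction \<open>1 - x\<close> from the gradient step, both for squared norms, and gradient
  error \<open>x / 12\<close>. The first two leave \<open>1 - x / 4\<close>; the error, enlarged by
  at most \<open>3 / 2\<close>, consumes half of this gain.\<close>

lemma contraction_factor:
  fixes x :: real
  assumes "0 < x" "x \<le> 1"
  shows "sqrt (1 + x / 2) * (sqrt (1 - x) + x / 12) \<le> 1 - x / 8"
proof -
  have "sqrt (1 + x / 2) * sqrt (1 - x) = sqrt ((1 + x / 2) * (1 - x))"
    by (simp add: real_sqrt_mult)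
  also have "\<dots> \<le> sqrt ((1 - x / 4)\<^sup>2)"
    using zero_le_power2[of x] by (intro real_sqrt_le_mono) (simp add: power2_eq_square algebra_simps)
  also have "\<dots> = 1 - x / 4" using assms by simp
  finally have 1: "sqrt (1 + x / 2) * sqrt (1 - x) \<le> 1 - x / 4" .
  have "sqrt (1 + x / 2) \<le> sqrt ((3 / 2)\<^sup>2)"
    using assms by (intro real_sqrt_le_mono) (simp add: power2_eq_square)
  then have "sqrt (1 + x / 2) \<le> 3 / 2" by simp
  then have "sqrt (1 + x / 2) * (x / 12) \<le> 3 / 2 * (x / 12)"
    using assms by (intro mult_right_mono) auto
  then show ?thesis using 1 unfolding distrib_left by linarith
qed

lemma l0_norm_diff: "l0_norm p (\<lambda>j. u j - v j) \<le> l0_norm p u + l0_norm p v"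
proof -
  have "card {j. j < p \<and> u j - v j \<noteq> 0} \<le> card ({j. j < p \<and> u j \<noteq> 0} \<union> {j. j < p \<and> v j \<noteq> 0})"
    by (intro card_mono) auto
  also have "\<dots> \<le> l0_norm p u + l0_norm p v" unfolding l0_norm_def by (rule card_Un_le)
  finally show ?thesis by (simp add: l0_norm_def)
qed

text \<open>Everything is measured by \<open>x = \<eta> * \<kappa>m\<close>. Thresholding is used
  with \<open>\<beta> = x / 2\<close>, and the tolerance \<open>\<kappa>m / (12 * sqrt l)\<close>
  per coordinate becomes a relative error \<open>x / 12\<close>, since the norm over the joint
  support costs \<open>sqrt l\<close>.\<close>

lemma iht_step:
  assumes sym: "\<And>j k. G j k = G k j" and spec: "sparse_spectrum p G l \<kappa>m \<kappa>p"
    and s: "s \<le> p" "s' < s" "2 * s + s' \<le> l" and w: "l0_norm p w \<le> s'" and \<theta>: "l0_norm p \<theta> \<le> s"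
    and \<kappa>: "0 < \<kappa>m" "\<kappa>m \<le> \<kappa>p" and \<eta>0: "0 < \<eta>0" "\<eta>0 \<le> 1"
    and \<eta>: "\<eta> = \<kappa>m * \<eta>0 / \<kappa>p\<^sup>2" and x: "x = \<eta>0 * (\<kappa>m / \<kappa>p)\<^sup>2"
    and ratio: "(1 + 1 / (x / 2)) * real s' \<le> x / 2 * (real s - real s')"
    and grad: "\<And>j. j < p \<Longrightarrow> \<bar>g j - (\<Sum>k<p. G j k * (\<theta> k - w k))\<bar>
                       \<le> \<kappa>m / (12 * sqrt l) * l2_dist p \<theta> w + \<tau>"
    and \<tau>: "0 \<le> \<tau>"
  shows "l2_dist p (hard_threshold p s (\<lambda>j. \<theta> j - \<eta> * g j)) w
           \<le> (1 - x / 8) * l2_dist p \<theta> w + 2 * \<eta> * sqrt l * \<tau>"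
proof -
  define h where "h j = \<theta> j - w j" for j
  define D where "D = l2_dist p \<theta> w"
  define u where "u j = \<theta> j - \<eta> * g j" for j
  \<comment> \<open>The supports of the new iterate, the old one and the target together have at
    most \<open>2 * s + s'\<close> elements; this is the sparsity at which the spectrum has to be
    controlled.\<close>
  define S where "S = kept p s u \<union> {j. j < p \<and> \<theta> j \<noteq> 0} \<union> {j. j < p \<and> w j \<noteq> 0}"
  have S: "S \<subseteq> {..<p}" using kept_subset by (auto simp: S_def)
  have finS: "finite S" by (rule finite_subset[OF S]) simp
  have "card S \<le> card (kept p s u \<union> {j. j < p \<and> \<theta> j \<noteq> 0}) + card {j. j < p \<and> w j \<noteq> 0}"
    unfolding S_def by (rule card_Un_le)
  also have "card (kept p s u \<union> {j. j < p \<and> \<theta> j \<noteq> 0}) \<le> card (kept p s u) + card {j. j < p \<and> \<theta> j \<noteq> 0}"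
    by (rule card_Un_le)
  finally have cS: "card S \<le> l"
    using w \<theta> s card_kept[OF s(1), of u] by (simp add: l0_norm_def)
  have l0: "real l > 0" using s by simp
  have D0: "0 \<le> D" by (simp add: D_def l2_dist_def)
  have r: "0 < \<kappa>m / \<kappa>p" "\<kappa>m / \<kappa>p \<le> 1" using \<kappa> by auto
  have "0 < (\<kappa>m / \<kappa>p)\<^sup>2" "(\<kappa>m / \<kappa>p)\<^sup>2 \<le> 1" using r by (intro zero_less_power power_le_one; linarith)+
  then have x01: "0 < x" "x \<le> 1"
    unfolding x using \<eta>0 by (intro mult_pos_pos mult_le_one; linarith)+
  have \<eta>pos: "0 \<le> \<eta>" using \<eta> \<kappa> \<eta>0 by simp
  have \<eta>x: "\<eta> * \<kappa>m = x" by (simp add: \<eta> x power2_eq_square)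
  have "\<eta> * \<kappa>p = \<eta>0 * (\<kappa>m / \<kappa>p)" using \<kappa> by (simp add: \<eta> power2_eq_square)
  then have \<eta>\<kappa>: "\<eta> * \<kappa>p \<le> 1" using r \<eta>0 by (simp only:) (intro mult_le_one; simp)
  have D2: "(\<Sum>j<p. (h j)\<^sup>2) = D\<^sup>2"
    by (simp add: D_def l2_dist_def L2_set_def h_def sum_nonneg)
  define e where "e = \<kappa>m / (12 * sqrt l) * D + \<tau>"
  have e0: "0 \<le> e" using D0 \<kappa> \<tau> by (simp add: e_def)
  have "(\<Sum>j\<in>S. (h j - \<eta> * (\<Sum>k<p. G j k * h k))\<^sup>2) \<le> (1 - \<eta> * \<kappa>m) * (\<Sum>j<p. (h j)\<^sup>2)"
    using \<kappa> by (intro gradient_step_contraction[OF sym spec S cS _ _ _ \<eta>pos \<eta>\<kappa>]) (auto simp: h_def S_def)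
  then have "L2_set (\<lambda>j. h j - \<eta> * (\<Sum>k<p. G j k * h k)) S \<le> sqrt ((1 - x) * D\<^sup>2)"
    unfolding L2_set_def by (intro real_sqrt_le_mono) (simp add: D2 \<eta>x)
  then have A: "L2_set (\<lambda>j. h j - \<eta> * (\<Sum>k<p. G j k * h k)) S \<le> sqrt (1 - x) * D"
    using D0 by (simp add: real_sqrt_mult)
  have B: "L2_set (\<lambda>j. - \<eta> * (g j - (\<Sum>k<p. G j k * h k))) S \<le> sqrt l * (\<eta> * e)"
  proof (rule L2_set_le_const[OF finS])
    fix j assume "j \<in> S"
    then have "j < p" using S by auto
    then show "\<bar>- \<eta> * (g j - (\<Sum>k<p. G j k * h k))\<bar> \<le> \<eta> * e"
      using grad[of j] \<eta>pos by (simp add: abs_mult e_def D_def h_def mult_left_mono)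
  qed (use cS e0 \<eta>pos in auto)
  have "L2_set (\<lambda>j. u j - w j) S
      = L2_set (\<lambda>j. (h j - \<eta> * (\<Sum>k<p. G j k * h k)) + - \<eta> * (g j - (\<Sum>k<p. G j k * h k))) S"
    by (intro L2_set_cong) (auto simp: u_def h_def algebra_simps)
  also have "\<dots> \<le> sqrt (1 - x) * D + sqrt l * (\<eta> * e)"
    using A B L2_set_triangle_ineq[of "\<lambda>j. h j - \<eta> * (\<Sum>k<p. G j k * h k)"
      "\<lambda>j. - \<eta> * (g j - (\<Sum>k<p. G j k * h k))" S] by linarith
  also have "sqrt l * (\<eta> * e) = x / 12 * D + \<eta> * sqrt l * \<tau>"
  proof -
    have "sqrt l * (\<eta> * (\<kappa>m / (12 * sqrt l) * D)) = (\<eta> * \<kappa>m) / 12 * D" using l0 by (simp add: field_simps)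
    then show ?thesis by (simp add: e_def distrib_left \<eta>x)
  qed
  finally have U: "L2_set (\<lambda>j. u j - w j) S \<le> (sqrt (1 - x) + x / 12) * D + \<eta> * sqrt l * \<tau>"
    by (simp add: algebra_simps)
  have "(\<Sum>j<p. (hard_threshold p s u j - w j)\<^sup>2) \<le> (1 + x / 2) * (\<Sum>j\<in>S. (u j - w j)\<^sup>2)"
    by (rule hard_threshold_expansion[OF s(1) w s(2) _ ratio]) (use x01 S in \<open>auto simp: S_def\<close>)
  then have "l2_dist p (hard_threshold p s u) w \<le> sqrt ((1 + x / 2) * (\<Sum>j\<in>S. (u j - w j)\<^sup>2))"
    unfolding l2_dist_def L2_set_def by (rule real_sqrt_le_mono)
  also have "\<dots> = sqrt (1 + x / 2) * L2_set (\<lambda>j. u j - w j) S"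
    by (simp add: real_sqrt_mult L2_set_def)
  also have "\<dots> \<le> sqrt (1 + x / 2) * ((sqrt (1 - x) + x / 12) * D + \<eta> * sqrt l * \<tau>)"
    using U x01 by (intro mult_left_mono) auto
  also have "\<dots> = (sqrt (1 + x / 2) * (sqrt (1 - x) + x / 12)) * D + sqrt (1 + x / 2) * (\<eta> * sqrt l * \<tau>)"
    by (simp add: algebra_simps)
  also have "\<dots> \<le> (1 - x / 8) * D + 2 * (\<eta> * sqrt l * \<tau>)"
  proof (intro add_mono mult_right_mono contraction_factor x01 D0)
    have "sqrt (1 + x / 2) \<le> sqrt (2\<^sup>2)" using x01 by (intro real_sqrt_le_mono) simp
    then show "sqrt (1 + x / 2) \<le> 2" by simp
    show "0 \<le> \<eta> * sqrt l * \<tau>" using \<eta>pos \<tau> by simp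
  qed
  finally show ?thesis by (simp add: D_def u_def[abs_def] algebra_simps)
qed

lemma linear_recursion_bound:
  fixes d :: "nat \<Rightarrow> real"
  assumes "\<And>t. t < T \<Longrightarrow> d (Suc t) \<le> (1 - y) * d t + c" "0 < y" "y \<le> 1" "0 \<le> c" "t \<le> T"
  shows "d t \<le> (1 - y) ^ t * d 0 + c / y"
  using assms(5)
proof (induction t)
  case (Suc t)
  have "d (Suc t) \<le> (1 - y) * d t + c" using Suc.prems assms(1) by simp
  also have "\<dots> \<le> (1 - y) * ((1 - y) ^ t * d 0 + c / y) + c"
    using Suc assms by (intro add_right_mono mult_left_mono) auto
  also have "\<dots> = (1 - y) ^ Suc t * d 0 + c / y" using assms by (simp add: field_simps)
  finally show ?case .
qed (use assms in auto)

lemma l0_mom_iht: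
  assumes "s \<le> p" "l0_norm p \<theta>0 \<le> s"
  shows "l0_norm p (mom_iht p s \<eta> K Bs z \<theta>0 t) \<le> s"
  using assms by (cases t) (auto simp: Let_def l0_hard_threshold)

text \<open>The gradient bound is assumed along the trajectory only, so that the uniform bound of
  phase one and the batchwise bounds of phase two can both supply it.\<close>

lemma mom_iht_error:
  assumes sym: "\<And>j k. G j k = G k j" and spec: "sparse_spectrum p G l \<kappa>m \<kappa>p"
    and s: "s \<le> p" "s' < s" "2 * s + s' \<le> l" and w: "l0_norm p w \<le> s'" and \<theta>: "l0_norm p \<theta>0 \<le> s"
    and \<kappa>: "0 < \<kappa>m" "\<kappa>m \<le> \<kappa>p" and \<eta>0: "0 < \<eta>0" "\<eta>0 \<le> 1"
    and \<eta>: "\<eta> = \<kappa>m * \<eta>0 / \<kappa>p\<^sup>2" and x: "x = \<eta>0 * (\<kappa>m / \<kappa>p)\<^sup>2"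
    and ratio: "(1 + 1 / (x / 2)) * real s' \<le> x / 2 * (real s - real s')"
    and grad: "\<And>t j. t < T \<Longrightarrow> j < p \<Longrightarrow>
        \<bar>mom_grad p K (Bs t) z (mom_iht p s \<eta> K Bs z \<theta>0 t) j
            - (\<Sum>k<p. G j k * (mom_iht p s \<eta> K Bs z \<theta>0 t k - w k))\<bar>
          \<le> \<kappa>m / (12 * sqrt l) * l2_dist p (mom_iht p s \<eta> K Bs z \<theta>0 t) w + \<tau>"
    and \<tau>: "0 \<le> \<tau>"
  shows "l2_dist p (mom_iht p s \<eta> K Bs z \<theta>0 T) w
           \<le> (1 - x / 8) ^ T * l2_dist p \<theta>0 w + 16 * sqrt l * \<tau> / \<kappa>m"
proof -
  define d where "d t = l2_dist p (mom_iht p s \<eta> K Bs z \<theta>0 t) w" for t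
  have r: "0 < \<kappa>m / \<kappa>p" "\<kappa>m / \<kappa>p \<le> 1" using \<kappa> by auto
  have "0 < (\<kappa>m / \<kappa>p)\<^sup>2" "(\<kappa>m / \<kappa>p)\<^sup>2 \<le> 1" using r by (intro zero_less_power power_le_one; linarith)+
  then have x01: "0 < x" "x \<le> 1"
    unfolding x using \<eta>0 by (intro mult_pos_pos mult_le_one; linarith)+
  have \<eta>pos: "0 \<le> \<eta>" using \<eta> \<kappa> \<eta>0 by simp
  have "d (Suc t) \<le> (1 - x / 8) * d t + 2 * \<eta> * sqrt l * \<tau>" if "t < T" for t
    unfolding d_def mom_iht.simps Let_def
    by (rule iht_step[OF sym spec s w l0_mom_iht[OF s(1) \<theta>] \<kappa> \<eta>0 \<eta> x ratio grad[OF that] \<tau>])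
  from linear_recursion_bound[of T d "x / 8", OF this, of T]
  have "d T \<le> (1 - x / 8) ^ T * d 0 + 2 * \<eta> * sqrt l * \<tau> / (x / 8)"
    using x01 \<eta>pos \<tau> by simp
  \<comment> \<open>The step size cancels because \<open>\<eta> / x\<close> is
    \<open>1 / \<kappa>m\<close>: the accumulated noise is free of \<open>\<eta>0\<close>.\<close>
  also have "2 * \<eta> * sqrt l * \<tau> / (x / 8) = 16 * (\<eta> / x) * sqrt l * \<tau>"
    by simp
  also have "\<eta> / x = 1 / \<kappa>m" using \<kappa> \<eta>0 by (simp add: \<eta> x power2_eq_square field_simps)
  finally show ?thesis by (simp add: d_def)
qed

section \<open>Deviations of block means under weak moments\<close>

text \<open>For \<open>\<bar>y\<bar> < 1\<close> the concave function
  \<open>(1 + y) powr (r - 1)\<close> lies below its tangent; this leaves a quadratic remainder, and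
  \<open>y\<^sup>2 \<le> \<bar>y\<bar> powr r\<close> in this range. For larger
  \<open>\<bar>y\<bar>\<close> all terms are compared with \<open>\<bar>y\<bar> powr r\<close>: the
  power costs four and the linear term two, which gives the constant six.\<close>

lemma one_plus_powr_le:
  fixes y r :: real
  assumes r: "1 \<le> r" "r \<le> 2"
  shows "\<bar>1 + y\<bar> powr r \<le> 1 + r * y + 6 * \<bar>y\<bar> powr r"
proof (cases "\<bar>y\<bar> < 1")
  case True
  then have pos: "1 + y > 0" by linarith
  have "(1 + y) powr (r - 1) * 1 powr (2 - r) \<le> (r - 1) * (1 + y) + (2 - r) * 1"
    using r pos by (intro Youngs_inequality_0) auto
  then have b: "(1 + y) powr (r - 1) \<le> 1 + (r - 1) * y" by (simp add: algebra_simps)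
  have "\<bar>1 + y\<bar> powr r = (1 + y) powr (1 + (r - 1))" using pos by simp
  also have "\<dots> = (1 + y) * (1 + y) powr (r - 1)" using pos by (simp only: powr_add powr_one)
  also have "\<dots> \<le> (1 + y) * (1 + (r - 1) * y)" using b pos by (intro mult_left_mono) auto
  also have "\<dots> = 1 + r * y + (r - 1) * y\<^sup>2" by (simp add: algebra_simps power2_eq_square)
  finally have 1: "\<bar>1 + y\<bar> powr r \<le> 1 + r * y + (r - 1) * y\<^sup>2" .
  have "y\<^sup>2 \<le> \<bar>y\<bar> powr r"
  proof (cases "y = 0")
    case False
    then have "y\<^sup>2 = \<bar>y\<bar> powr 2" by simp
    also have "\<dots> \<le> \<bar>y\<bar> powr r" using True False r by (intro powr_mono') auto
    finally show ?thesis .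
  qed simp
  moreover have "(r - 1) * y\<^sup>2 \<le> 1 * y\<^sup>2" using r by (intro mult_right_mono) auto
  moreover have "0 \<le> \<bar>y\<bar> powr r" by simp
  ultimately show ?thesis using 1 by linarith
next
  case False
  then have y1: "\<bar>y\<bar> \<ge> 1" by simp
  have "\<bar>1 + y\<bar> powr r \<le> (2 * \<bar>y\<bar>) powr r" using y1 r by (intro powr_mono2) auto
  also have "\<dots> = 2 powr r * \<bar>y\<bar> powr r" by (simp add: powr_mult)
  also have "\<dots> \<le> 2 powr 2 * \<bar>y\<bar> powr r" using r by (intro mult_right_mono powr_mono) auto
  finally have 1: "\<bar>1 + y\<bar> powr r \<le> 4 * \<bar>y\<bar> powr r" by simp
  have "\<bar>y\<bar> powr 1 \<le> \<bar>y\<bar> powr r" using y1 r by (intro powr_mono) auto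
  then have "\<bar>y\<bar> \<le> \<bar>y\<bar> powr r" by simp
  moreover have "- (r * y) \<le> 2 * \<bar>y\<bar>"
  proof -
    have "- (r * y) \<le> r * \<bar>y\<bar>" using r by (metis abs_ge_minus_self abs_mult abs_of_nonneg order_trans zero_le_one)
    also have "\<dots> \<le> 2 * \<bar>y\<bar>" using r by (intro mult_right_mono) auto
    finally show ?thesis .
  qed
  ultimately show ?thesis using 1 by linarith
qed

text \<open>The previous inequality rescaled by \<open>a\<close>. The middle term is the derivative
  of the power at \<open>a\<close> times \<open>b\<close>; being linear in \<open>b\<close>, it
  disappears in expectation when \<open>b\<close> is centred and independent of
  \<open>a\<close>.\<close>

lemma abs_add_powr_le:
  fixes a b r :: real
  assumes r: "1 \<le> r" "r \<le> 2"
  shows "\<bar>a + b\<bar> powr r \<le> \<bar>a\<bar> powr r + r * (sgn a * \<bar>a\<bar> powr (r - 1)) * b + 6 * \<bar>b\<bar> powr r"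
proof (cases "a = 0")
  case False
  have "\<bar>a + b\<bar> powr r = \<bar>a * (1 + b / a)\<bar> powr r" using False by (simp add: distrib_left)
  also have "\<dots> = \<bar>a\<bar> powr r * \<bar>1 + b / a\<bar> powr r" by (simp only: abs_mult powr_mult)
  also have "\<dots> \<le> \<bar>a\<bar> powr r * (1 + r * (b / a) + 6 * \<bar>b / a\<bar> powr r)"
    by (intro mult_left_mono one_plus_powr_le r) auto
  also have "\<dots> = \<bar>a\<bar> powr r + r * (\<bar>a\<bar> powr r / a) * b + 6 * (\<bar>a\<bar> powr r * \<bar>b / a\<bar> powr r)"
    by (simp add: algebra_simps)
  also have "\<bar>a\<bar> powr r * \<bar>b / a\<bar> powr r = \<bar>b\<bar> powr r"
  proof -
    have "\<bar>a\<bar> powr r * \<bar>b / a\<bar> powr r = \<bar>a * (b / a)\<bar> powr r" by (simp only: abs_mult powr_mult)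
    then show ?thesis using False by simp
  qed
  also have "\<bar>a\<bar> powr r / a = sgn a * \<bar>a\<bar> powr (r - 1)"
    using False by (simp add: powr_diff sgn_if)
  finally show ?thesis .
qed simp

text \<open>Summands are added one at a time. The linear term of the expansion has mean zero, so
  each new summand costs only six times its own moment, and the bound is additive as it is for
  variances.\<close>

lemma (in prob_space) von_Bahr_Esseen:
  fixes X :: "'i \<Rightarrow> 'a \<Rightarrow> real"
  assumes r: "1 \<le> r" "r \<le> 2" and B: "finite B" and ind: "indep_vars (\<lambda>_. borel) X B"
    and int: "\<And>i. i \<in> B \<Longrightarrow> integrable M (X i)" and mean: "\<And>i. i \<in> B \<Longrightarrow> expectation (X i) = 0"
    and intr: "\<And>i. i \<in> B \<Longrightarrow> integrable M (\<lambda>\<omega>. \<bar>X i \<omega>\<bar> powr r)"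
  shows "integrable M (\<lambda>\<omega>. \<bar>\<Sum>i\<in>B. X i \<omega>\<bar> powr r) \<and>
         expectation (\<lambda>\<omega>. \<bar>\<Sum>i\<in>B. X i \<omega>\<bar> powr r) \<le> 6 * (\<Sum>i\<in>B. expectation (\<lambda>\<omega>. \<bar>X i \<omega>\<bar> powr r))"
  using B ind int mean intr
proof (induction B)
  case (insert b B)
  define S where "S \<omega> = (\<Sum>i\<in>B. X i \<omega>)" for \<omega>
  define \<phi> :: "real \<Rightarrow> real" where "\<phi> a = sgn a * \<bar>a\<bar> powr (r - 1)" for a
  have IH: "integrable M (\<lambda>\<omega>. \<bar>S \<omega>\<bar> powr r)"
      "expectation (\<lambda>\<omega>. \<bar>S \<omega>\<bar> powr r) \<le> 6 * (\<Sum>i\<in>B. expectation (\<lambda>\<omega>. \<bar>X i \<omega>\<bar> powr r))"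
    using insert.IH[OF indep_vars_subset[OF insert.prems(1)]] insert.prems by (auto simp: S_def)
  have Sm [measurable]: "S \<in> borel_measurable M" unfolding S_def
    using insert.prems(2) by (intro borel_measurable_sum) (auto dest: borel_measurable_integrable)
  have Xm [measurable]: "X b \<in> borel_measurable M" using insert.prems(2) by auto
  have \<phi>m [measurable]: "\<phi> \<in> borel_measurable borel" unfolding \<phi>_def by measurable
  \<comment> \<open>Needed for the product rule of expectations. The derivative grows with the
    smaller exponent \<open>r - 1\<close> and is dominated by
    \<open>1 + \<bar>S \<omega>\<bar> powr r\<close>.\<close>
  have int\<phi>: "integrable M (\<lambda>\<omega>. \<phi> (S \<omega>))"
  proof (rule Bochner_Integration.integrable_bound[of M "\<lambda>\<omega>. 1 + \<bar>S \<omega>\<bar> powr r"])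
    show "AE \<omega> in M. norm (\<phi> (S \<omega>)) \<le> norm (1 + \<bar>S \<omega>\<bar> powr r)"
    proof (rule AE_I2)
      fix \<omega>
      have "\<bar>S \<omega>\<bar> powr (r - 1) \<le> 1 + \<bar>S \<omega>\<bar> powr r"
      proof (cases "\<bar>S \<omega>\<bar> \<le> 1")
        case True
        then have "\<bar>S \<omega>\<bar> powr (r - 1) \<le> 1" using r by (intro powr_le1) auto
        then show ?thesis by (simp add: add_increasing2)
      next
        case False
        then have "\<bar>S \<omega>\<bar> powr (r - 1) \<le> \<bar>S \<omega>\<bar> powr r" by (intro powr_mono) auto
        then show ?thesis by linarith
      qed
      then show "norm (\<phi> (S \<omega>)) \<le> norm (1 + \<bar>S \<omega>\<bar> powr r)"
        by (auto simp: \<phi>_def abs_mult sgn_if)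
    qed
  qed (use IH in auto)
  have "indep_var borel (X b) borel S"
    unfolding S_def using insert.hyps insert.prems by (intro indep_vars_sum) auto
  then have "indep_var borel ((\<lambda>x. x) \<circ> X b) borel (\<phi> \<circ> S)"
    by (rule indep_var_compose) auto
  then have iv: "indep_var borel (X b) borel (\<lambda>\<omega>. \<phi> (S \<omega>))"
    by (simp add: comp_def)
  have Xb: "integrable M (X b)" "expectation (X b) = 0" using insert.prems by auto
  have cross: "integrable M (\<lambda>\<omega>. \<phi> (S \<omega>) * X b \<omega>)" "expectation (\<lambda>\<omega>. \<phi> (S \<omega>) * X b \<omega>) = 0"
    using indep_var_integrable[OF iv Xb(1) int\<phi>] indep_var_lebesgue_integral[OF iv Xb(1) int\<phi>] Xb(2)
    by (auto simp: mult.commute)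
  have intX: "integrable M (\<lambda>\<omega>. \<bar>X b \<omega>\<bar> powr r)" using insert.prems by auto
  let ?U = "\<lambda>\<omega>. \<bar>S \<omega>\<bar> powr r + r * (\<phi> (S \<omega>) * X b \<omega>) + 6 * \<bar>X b \<omega>\<bar> powr r"
  have sum: "(\<Sum>i\<in>insert b B. X i \<omega>) = S \<omega> + X b \<omega>" for \<omega>
    using insert.hyps by (simp add: S_def)
  have le: "\<bar>S \<omega> + X b \<omega>\<bar> powr r \<le> ?U \<omega>" for \<omega>
    using abs_add_powr_le[OF r, of "S \<omega>" "X b \<omega>"] by (simp add: \<phi>_def mult.assoc)
  have intU: "integrable M ?U" using IH(1) cross(1) intX by simp
  have int': "integrable M (\<lambda>\<omega>. \<bar>S \<omega> + X b \<omega>\<bar> powr r)"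
  proof (rule Bochner_Integration.integrable_bound[OF intU])
    show "AE \<omega> in M. norm (\<bar>S \<omega> + X b \<omega>\<bar> powr r) \<le> norm (?U \<omega>)"
    proof (rule AE_I2)
      fix \<omega> show "norm (\<bar>S \<omega> + X b \<omega>\<bar> powr r) \<le> norm (?U \<omega>)"
        using le[of \<omega>] by (metis abs_ge_self norm_powr_real_powr order_trans powr_ge_zero real_norm_def abs_of_nonneg)
    qed
  qed auto
  have "expectation (\<lambda>\<omega>. \<bar>S \<omega> + X b \<omega>\<bar> powr r) \<le> expectation ?U"
    using int' intU le by (intro integral_mono)
  also have "\<dots> = expectation (\<lambda>\<omega>. \<bar>S \<omega>\<bar> powr r) + 6 * expectation (\<lambda>\<omega>. \<bar>X b \<omega>\<bar> powr r)"
    using IH(1) cross intX by simp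
  also have "\<dots> \<le> 6 * (\<Sum>i\<in>insert b B. expectation (\<lambda>\<omega>. \<bar>X i \<omega>\<bar> powr r))"
    using IH(2) insert.hyps by (simp add: distrib_left)
  finally show ?case using int' unfolding sum by blast
qed simp

section \<open>Independent blocks in a product space\<close>

abbreviation iid :: "'i set \<Rightarrow> 'a measure \<Rightarrow> ('i \<Rightarrow> 'a) measure" where
  "iid J P \<equiv> Pi\<^sub>M J (\<lambda>_. P)"

lemma indep_coordinates:
  assumes "prob_space P" "J \<noteq> {}"
  shows "prob_space.indep_vars (iid J P) (\<lambda>_. P) (\<lambda>i z. z i) J"
proof -
  interpret P: prob_space "iid J P" by (intro prob_space_PiM assms)
  have "distr (iid J P) (iid J P) (\<lambda>x. \<lambda>i\<in>J. x i) = distr (iid J P) (iid J P) (\<lambda>x. x)"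
    by (intro distr_cong) (auto simp: space_PiM PiE_restrict)
  also have "\<dots> = iid J P" by simp
  also have "\<dots> = (\<Pi>\<^sub>M i\<in>J. distr (iid J P) P (\<lambda>z. z i))"
    by (intro PiM_cong refl distr_PiM_component[symmetric] assms)
  finally show ?thesis
    by (subst P.indep_vars_iff_distr_eq_PiM'[OF assms(2)]) auto
qed

lemma prob_PiM_restrict:
  assumes P: "prob_space P" and J: "finite J" "B \<subseteq> J" and A: "A \<in> sets (iid B P)"
  shows "measure (iid J P) {z \<in> space (iid J P). restrict z B \<in> A} = measure (iid B P) A"
proof -
  interpret product_prob_space "\<lambda>_. P" J
    by (simp add: product_prob_space_def product_prob_space_axioms_def product_sigma_finite_def
        P prob_space_imp_sigma_finite)
  have m: "(\<lambda>z. restrict z B) \<in> measurable (iid J P) (iid B P)"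
    using J(2) by (rule measurable_restrict_subset)
  have "measure (iid B P) A = measure (distr (iid J P) (iid B P) (\<lambda>z. restrict z B)) A"
    using distr_restrict[OF J(2,1)] by simp
  also have "\<dots> = measure (iid J P) ((\<lambda>z. restrict z B) -` A \<inter> space (iid J P))"
    by (rule measure_distr[OF m A])
  also have "(\<lambda>z. restrict z B) -` A \<inter> space (iid J P) = {z \<in> space (iid J P). restrict z B \<in> A}"
    by auto
  finally show ?thesis by simp
qed

text \<open>Variances may be infinite, so Markov's inequality is applied to the power
  \<open>r\<close> of the centred sum. Its moment is linear in the block size \<open>m\<close>,
  while the threshold is \<open>(m * t) powr r\<close>; the quotient gains
  \<open>m powr (r - 1)\<close>.\<close>

lemma block_mean_tail:
  fixes B :: "'i set" and P :: "'a measure" and F :: "'a \<Rightarrow> real"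
  assumes P: "prob_space P" and B: "finite B" "B \<noteq> {}" and r: "1 \<le> r" "r \<le> 2" and t: "0 < t"
    and int: "integrable P F" and mean: "(\<integral>z. F z \<partial>P) = \<mu>"
    and intr: "integrable P (\<lambda>z. \<bar>F z - \<mu>\<bar> powr r)" and V: "(\<integral>z. \<bar>F z - \<mu>\<bar> powr r \<partial>P) \<le> V"
  shows "measure (iid B P) {z \<in> space (iid B P). \<bar>(\<Sum>i\<in>B. F (z i)) / real (card B) - \<mu>\<bar> > t}
           \<le> 6 * V / (real (card B) powr (r - 1) * t powr r)"
proof -
  let ?M = "iid B P"
  interpret M: prob_space ?M by (intro prob_space_PiM P)
  define X where "X i z = F (z i) - \<mu>" for i :: 'i and z
  have [measurable]: "F \<in> borel_measurable P" using int by auto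
  have comp: "distr ?M P (\<lambda>z. z i) = P" if "i \<in> B" for i
    using that P by (intro distr_PiM_component)
  have tr: "integral\<^sup>L ?M (\<lambda>z. f (z i)) = integral\<^sup>L P f" if "i \<in> B" "f \<in> borel_measurable P" for f :: "_ \<Rightarrow> real" and i
    using that by (subst comp[OF that(1), symmetric], subst integral_distr) auto
  have tri: "integrable ?M (\<lambda>z. f (z i))" if "i \<in> B" "integrable P f" for f :: "_ \<Rightarrow> real" and i
    using that comp[OF that(1)] by (intro integrable_distr[of "\<lambda>z. z i" ?M P]) auto
  have ind: "M.indep_vars (\<lambda>_. borel) X B"
    unfolding X_def
    by (rule M.indep_vars_compose2[OF indep_coordinates[OF P B(2)], of "\<lambda>i x. F x - \<mu>" "\<lambda>_. borel"]) simp
  interpret P: prob_space P by (rule P)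
  have X1: "integrable ?M (X i)" "M.expectation (X i) = 0" if "i \<in> B" for i
    unfolding X_def using tri[OF that, of "\<lambda>z. F z - \<mu>"] tr[OF that, of "\<lambda>z. F z - \<mu>"] int mean
    by (auto simp: P.prob_space)
  have Xr: "integrable ?M (\<lambda>z. \<bar>X i z\<bar> powr r)" "M.expectation (\<lambda>z. \<bar>X i z\<bar> powr r) \<le> V" if "i \<in> B" for i
    unfolding X_def using tri[OF that intr] tr[OF that, of "\<lambda>z. \<bar>F z - \<mu>\<bar> powr r"] V by auto
  define m where "m = real (card B)"
  have m0: "m > 0" using B by (simp add: m_def card_gt_0_iff)
  have vBE: "integrable ?M (\<lambda>z. \<bar>\<Sum>i\<in>B. X i z\<bar> powr r)"
     "M.expectation (\<lambda>z. \<bar>\<Sum>i\<in>B. X i z\<bar> powr r) \<le> 6 * (\<Sum>i\<in>B. M.expectation (\<lambda>z. \<bar>X i z\<bar> powr r))"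
    using M.von_Bahr_Esseen[OF r B(1) ind X1 Xr(1)] by auto
  have "(\<Sum>i\<in>B. M.expectation (\<lambda>z. \<bar>X i z\<bar> powr r)) \<le> (\<Sum>i\<in>B. V)"
    using Xr by (intro sum_mono)
  then have E: "M.expectation (\<lambda>z. \<bar>\<Sum>i\<in>B. X i z\<bar> powr r) \<le> 6 * m * V"
    using vBE(2) by (simp add: m_def)
  have dev: "(\<Sum>i\<in>B. F (z i)) / m - \<mu> = (\<Sum>i\<in>B. X i z) / m" for z
    using m0 by (simp add: X_def sum_subtractf m_def field_simps)
  have Sm [measurable]: "(\<lambda>z. \<Sum>i\<in>B. X i z) \<in> borel_measurable ?M"
    unfolding X_def by measurable
  have "M.prob {z \<in> space ?M. \<bar>(\<Sum>i\<in>B. F (z i)) / m - \<mu>\<bar> > t}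
      \<le> M.prob {z \<in> space ?M. (m * t) powr r \<le> \<bar>\<Sum>i\<in>B. X i z\<bar> powr r}"
  proof (intro M.finite_measure_mono subsetI)
    fix z assume "z \<in> {z \<in> space ?M. \<bar>(\<Sum>i\<in>B. F (z i)) / m - \<mu>\<bar> > t}"
    then have z: "z \<in> space ?M" "m * t \<le> \<bar>\<Sum>i\<in>B. X i z\<bar>"
      using m0 unfolding dev by (auto simp: field_simps)
    then show "z \<in> {z \<in> space ?M. (m * t) powr r \<le> \<bar>\<Sum>i\<in>B. X i z\<bar> powr r}"
      using m0 t r by (auto intro!: powr_mono2)
  qed measurable
  also have "\<dots> \<le> M.expectation (\<lambda>z. \<bar>\<Sum>i\<in>B. X i z\<bar> powr r) / (m * t) powr r"
    using m0 t by (intro integral_Markov_inequality_measure[where A = "{}"] vBE(1)) auto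
  also have "\<dots> \<le> 6 * m * V / (m * t) powr r"
    using E by (intro divide_right_mono) auto
  also have "\<dots> = 6 * V / (m powr (r - 1) * t powr r)"
    using m0 t by (simp add: powr_mult powr_diff)
  finally show ?thesis by (simp add: m_def)
qed

text \<open>If a sixth of the blocks fails, then all blocks of some set \<open>S\<close> with
  \<open>6 * card S \<ge> K\<close> fail. Disjoint blocks are independent, so this has probability
  at most \<open>y ^ (6 * card S) \<le> y ^ K\<close>, and there are at most \<open>2 ^ K\<close>
  such sets. The sixth power in the hypothesis is matched to the fraction one sixth.\<close>

lemma block_vote:
  fixes B :: "nat \<Rightarrow> 'i set"
  assumes P: "prob_space P" and J: "finite J" "J \<noteq> {}" and B: "\<And>k. k < K \<Longrightarrow> B k \<subseteq> J"
    and disj: "disjoint_family_on B {..<K}"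
    and A: "\<And>k. k < K \<Longrightarrow> A k \<in> sets (iid (B k) P)"
    and q: "\<And>k. k < K \<Longrightarrow> measure (iid (B k) P) (A k) \<le> y ^ 6" and y: "0 \<le> y" "y \<le> 1"
  shows "{z \<in> space (iid J P). K \<le> 6 * card {k. k < K \<and> restrict z (B k) \<in> A k}}
            \<in> sets (iid J P)" (is "?E \<in> _")
    and "measure (iid J P) {z \<in> space (iid J P). K \<le> 6 * card {k. k < K \<and> restrict z (B k) \<in> A k}}
            \<le> (2 * y) ^ K"
proof -
  let ?M = "iid J P"
  interpret M: prob_space ?M by (intro prob_space_PiM P)
  define X where "X k z = restrict z (B k)" for k and z :: "'i \<Rightarrow> 'a"
  define E where "E k = X k -` A k \<inter> space ?M" for k
  have Em: "E k \<in> sets ?M" if "k < K" for k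
    unfolding E_def X_def using measurable_restrict_subset[OF B[OF that]] A[OF that] by (rule measurable_sets)
  define F where "F = {S. S \<subseteq> {..<K} \<and> K \<le> 6 * card S}"
  have finF: "finite F" by (rule finite_subset[of _ "Pow {..<K}"]) (auto simp: F_def)
  define G where "G S = {z \<in> space ?M. \<forall>k\<in>S. z \<in> E k}" for S
  have Gm: "G S \<in> sets ?M" if "S \<in> F" for S
  proof -
    have "S \<subseteq> {..<K}" using that by (simp add: F_def)
    then show ?thesis unfolding G_def using Em finite_subset[of S "{..<K}"]
      by (intro sets.sets_Collect_finite_All) (auto dest: sets.sets_into_space simp: Collect_conj_eq Int_def[symmetric] intro!: sets.Int)
  qed
  have eq: "?E = (\<Union>S\<in>F. G S)"
  proof (intro equalityI subsetI)
    fix z assume "z \<in> ?E"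
    then show "z \<in> (\<Union>S\<in>F. G S)"
      by (intro UN_I[of "{k. k < K \<and> restrict z (B k) \<in> A k}"]) (auto simp: F_def G_def E_def X_def)
  next
    fix z assume "z \<in> (\<Union>S\<in>F. G S)"
    then obtain S where S: "S \<subseteq> {..<K}" "K \<le> 6 * card S" "z \<in> space ?M" "\<And>k. k \<in> S \<Longrightarrow> restrict z (B k) \<in> A k"
      by (auto simp: F_def G_def E_def X_def)
    then have "card S \<le> card {k. k < K \<and> restrict z (B k) \<in> A k}" by (intro card_mono) auto
    then show "z \<in> ?E" using S by simp
  qed
  show "?E \<in> sets ?M" unfolding eq using finF Gm by (intro sets.finite_UN)
  have ind: "M.indep_vars (\<lambda>k. iid (B k) P) X {..<K}"
    using M.indep_vars_restrict[OF indep_coordinates[OF P J(2)], of "{..<K}" B] B disj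
    by (simp add: X_def[abs_def])
  have prG: "M.prob (G S) \<le> y ^ K" if "S \<in> F" for S
  proof (cases "S = {}")
    \<comment> \<open>The product rule for independent events requires a nonempty index set. An
      empty \<open>S\<close> occurs only for \<open>K = 0\<close>, where the bound equals
      one.\<close>
    case True
    then have "K = 0" using that by (simp add: F_def)
    then show ?thesis by simp
  next
    case False
    have S: "S \<subseteq> {..<K}" "K \<le> 6 * card S" "finite S"
      using that finite_subset[of S "{..<K}"] by (auto simp: F_def)
    have "G S = (\<Inter>k\<in>S. X k -` A k \<inter> space ?M)" using False by (auto simp: G_def E_def)
    moreover have "M.prob (\<Inter>k\<in>S. X k -` A k \<inter> space ?M) = (\<Prod>k\<in>S. M.prob (X k -` A k \<inter> space ?M))"
      using S A by (intro M.indep_varsD[OF ind False]) auto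
    ultimately have "M.prob (G S) = (\<Prod>k\<in>S. M.prob (X k -` A k \<inter> space ?M))" by simp
    also have "\<dots> \<le> (\<Prod>k\<in>S. y ^ 6)"
    proof (intro prod_mono conjI)
      fix k assume "k \<in> S"
      then have k: "k < K" using S by auto
      have "X k -` A k \<inter> space ?M = {z \<in> space ?M. restrict z (B k) \<in> A k}" by (auto simp: X_def)
      then have "M.prob (X k -` A k \<inter> space ?M) = measure (iid (B k) P) (A k)"
        using prob_PiM_restrict[OF P J(1) B[OF k] A[OF k]] by simp
      then show "M.prob (X k -` A k \<inter> space ?M) \<le> y ^ 6" using q[OF k] by simp
    qed simp
    also have "\<dots> = y ^ (6 * card S)" by (simp add: power_mult)
    also have "\<dots> \<le> y ^ K" using y S by (intro power_decreasing)
    finally show ?thesis .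
  qed
  have "M.prob ?E \<le> (\<Sum>S\<in>F. M.prob (G S))"
    unfolding eq using finF Gm by (intro M.finite_measure_subadditive_finite) auto
  also have "\<dots> \<le> (\<Sum>S\<in>F. y ^ K)" using prG by (intro sum_mono)
  also have "\<dots> = real (card F) * y ^ K" by simp
  also have "\<dots> \<le> 2 ^ K * y ^ K"
  proof (intro mult_right_mono)
    have "card F \<le> card (Pow {..<K})" by (intro card_mono) (auto simp: F_def)
    also have "\<dots> = 2 ^ K" by (simp add: card_Pow)
    finally show "real (card F) \<le> 2 ^ K" by (metis of_nat_le_iff of_nat_numeral of_nat_power)
  qed (use y in auto)
  finally show "M.prob ?E \<le> (2 * y) ^ K" by (simp add: power_mult_distrib)
qed

section \<open>Moments of the linear model\<close>

lemma powr_le_one_plus_powr: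
  fixes x a b :: real
  assumes "0 \<le> a" "a \<le> b"
  shows "\<bar>x\<bar> powr a \<le> 1 + \<bar>x\<bar> powr b"
proof (cases "\<bar>x\<bar> \<le> 1")
  case True
  then have "\<bar>x\<bar> powr a \<le> 1" using assms by (intro powr_le1) auto
  then show ?thesis by (simp add: add_increasing2)
next
  case False
  then have "\<bar>x\<bar> powr a \<le> \<bar>x\<bar> powr b" using assms by (intro powr_mono) auto
  then show ?thesis by linarith
qed

text \<open>The origin of the order \<open>2 + 2 * lam\<close>: the signal part of the gradient is a
  product of two linear forms in the covariate, and \<open>1 + lam\<close> moments of it are
  wanted.\<close>

lemma abs_mult_powr_le:
  fixes a b r :: real
  shows "\<bar>a * b\<bar> powr r \<le> (\<bar>a\<bar> powr (2 * r) + \<bar>b\<bar> powr (2 * r)) / 2"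
proof -
  have sq: "\<bar>c\<bar> powr (2 * r) = (\<bar>c\<bar> powr r)\<^sup>2" for c :: real
    by (simp add: power2_eq_square flip: powr_add)
  have "0 \<le> (\<bar>a\<bar> powr r - \<bar>b\<bar> powr r)\<^sup>2" by simp
  then have "2 * (\<bar>a\<bar> powr r * \<bar>b\<bar> powr r) \<le> (\<bar>a\<bar> powr r)\<^sup>2 + (\<bar>b\<bar> powr r)\<^sup>2"
    by (simp add: power2_diff)
  then show ?thesis unfolding sq by (simp add: abs_mult powr_mult)
qed

lemma abs_diff_powr_le:
  fixes a b r :: real
  assumes "1 \<le> r" "r \<le> 2"
  shows "\<bar>a - b\<bar> powr r \<le> 4 * (\<bar>a\<bar> powr r + \<bar>b\<bar> powr r)"
proof -
  have "\<bar>a - b\<bar> powr r \<le> (2 * max \<bar>a\<bar> \<bar>b\<bar>) powr r" using assms by (intro powr_mono2) auto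
  also have "\<dots> = 2 powr r * max \<bar>a\<bar> \<bar>b\<bar> powr r" by (simp add: powr_mult)
  also have "\<dots> \<le> 2 powr 2 * max \<bar>a\<bar> \<bar>b\<bar> powr r" using assms by (intro mult_right_mono powr_mono) auto
  also have "max \<bar>a\<bar> \<bar>b\<bar> powr r \<le> \<bar>a\<bar> powr r + \<bar>b\<bar> powr r" by (auto simp: max_def)
  finally show ?thesis by simp
qed

text \<open>Truncation at level \<open>c\<close>. With \<open>c\<close> of the size of the moment it
  yields Jensen's inequality up to a constant; with \<open>c\<close> half of a lower bound on a mean
  it yields a lower bound on a higher moment.\<close>

lemma abs_le_powr_split:
  fixes x c r :: real
  assumes "0 < c" "1 \<le> r"
  shows "\<bar>x\<bar> \<le> c + c powr (1 - r) * \<bar>x\<bar> powr r"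
proof (cases "\<bar>x\<bar> \<le> c")
  case False
  then have x: "0 < \<bar>x\<bar>" "c \<le> \<bar>x\<bar>" using assms by auto
  have "\<bar>x\<bar> = \<bar>x\<bar> powr (1 - r) * \<bar>x\<bar> powr r" using x by (simp flip: powr_add)
  also have "\<dots> \<le> c powr (1 - r) * \<bar>x\<bar> powr r"
    using assms x by (intro mult_right_mono powr_mono2') auto
  finally show ?thesis using assms by linarith
qed (simp add: add_increasing2)

lemma (in prob_space) abs_expectation_powr_le:
  fixes X :: "'a \<Rightarrow> real"
  assumes r: "1 \<le> r" "r \<le> 2" and int: "integrable M X" "integrable M (\<lambda>\<omega>. \<bar>X \<omega>\<bar> powr r)"
    and V: "expectation (\<lambda>\<omega>. \<bar>X \<omega>\<bar> powr r) \<le> V" "0 < V"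
  shows "\<bar>expectation X\<bar> powr r \<le> 4 * V"
proof -
  \<comment> \<open>At this level both terms of the truncation contribute \<open>c\<close>.\<close>
  define c where "c = V powr (1 / r)"
  have c: "0 < c" "c powr r = V" using V r by (auto simp: c_def powr_powr)
  have "\<bar>expectation X\<bar> \<le> expectation (\<lambda>\<omega>. \<bar>X \<omega>\<bar>)" by (rule integral_abs_bound)
  also have "\<dots> \<le> expectation (\<lambda>\<omega>. c + c powr (1 - r) * \<bar>X \<omega>\<bar> powr r)"
    using int abs_le_powr_split[OF c(1) r(1)] by (intro integral_mono) auto
  also have "\<dots> = c + c powr (1 - r) * expectation (\<lambda>\<omega>. \<bar>X \<omega>\<bar> powr r)"
    using int by (simp add: prob_space)
  also have "\<dots> \<le> c + c powr (1 - r) * c powr r"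
    using V c by (intro add_left_mono mult_left_mono) auto
  also have "c powr (1 - r) * c powr r = c" using c(1) by (subst powr_add[symmetric]) simp
  finally have "\<bar>expectation X\<bar> powr r \<le> (2 * c) powr r" using r by (intro powr_mono2) auto
  also have "\<dots> = 2 powr r * V" using c by (simp add: powr_mult)
  also have "\<dots> \<le> 2 powr 2 * V" using r V by (intro mult_right_mono powr_mono) auto
  finally show ?thesis by simp
qed

lemma (in prob_space) centered_moment_le:
  fixes X :: "'a \<Rightarrow> real"
  assumes r: "1 \<le> r" "r \<le> 2" and m [measurable]: "X \<in> borel_measurable M"
    and int: "integrable M (\<lambda>\<omega>. \<bar>X \<omega>\<bar> powr r)"
    and V: "expectation (\<lambda>\<omega>. \<bar>X \<omega>\<bar> powr r) \<le> V" "0 < V"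
  shows "integrable M X" "integrable M (\<lambda>\<omega>. \<bar>X \<omega> - expectation X\<bar> powr r)"
    "expectation (\<lambda>\<omega>. \<bar>X \<omega> - expectation X\<bar> powr r) \<le> 20 * V"
proof -
  show i: "integrable M X"
  proof (rule Bochner_Integration.integrable_bound[of M "\<lambda>\<omega>. 1 + \<bar>X \<omega>\<bar> powr r"])
    show "AE \<omega> in M. norm (X \<omega>) \<le> norm (1 + \<bar>X \<omega>\<bar> powr r)"
      using powr_le_one_plus_powr[of 1 r] r by (intro AE_I2) (simp add: abs_of_nonneg add_nonneg_nonneg)
  qed (use int in auto)
  define \<mu> where "\<mu> = expectation X"
  have le: "\<bar>X \<omega> - \<mu>\<bar> powr r \<le> 4 * (\<bar>X \<omega>\<bar> powr r + \<bar>\<mu>\<bar> powr r)" for \<omega>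
    by (rule abs_diff_powr_le[OF r])
  have i2: "integrable M (\<lambda>\<omega>. 4 * (\<bar>X \<omega>\<bar> powr r + \<bar>\<mu>\<bar> powr r))" using int by simp
  show ic: "integrable M (\<lambda>\<omega>. \<bar>X \<omega> - expectation X\<bar> powr r)"
    using le by (intro Bochner_Integration.integrable_bound[OF i2]) (auto simp: \<mu>_def intro!: AE_I2)
  have "expectation (\<lambda>\<omega>. \<bar>X \<omega> - \<mu>\<bar> powr r) \<le> expectation (\<lambda>\<omega>. 4 * (\<bar>X \<omega>\<bar> powr r + \<bar>\<mu>\<bar> powr r))"
    using le i2 ic by (intro integral_mono) (auto simp: \<mu>_def)
  also have "\<dots> = 4 * (expectation (\<lambda>\<omega>. \<bar>X \<omega>\<bar> powr r) + \<bar>\<mu>\<bar> powr r)"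
    using int by (simp add: prob_space)
  also have "\<dots> \<le> 4 * (V + 4 * V)"
    using V abs_expectation_powr_le[OF r i int V] unfolding \<mu>_def by (intro mult_left_mono add_mono) auto
  finally show "expectation (\<lambda>\<omega>. \<bar>X \<omega> - expectation X\<bar> powr r) \<le> 20 * V" by (simp add: \<mu>_def)
qed

section \<open>Sparse directions and the moments of the covariate\<close>

definition unit_vec :: "nat \<Rightarrow> vec" where
  "unit_vec j = (\<lambda>i. if i = j then 1 else 0)"

lemma unit_vec:
  assumes "j < p"
  shows "dot p u (unit_vec j) = u j" "l0_norm p (unit_vec j) = 1" "L2_set (unit_vec j) {..<p} = 1"
proof -
  show "dot p u (unit_vec j) = u j" using assms by (simp add: dot_def unit_vec_def if_distrib cong: if_cong)
  have "{i. i < p \<and> unit_vec j i \<noteq> 0} = {j}" using assms by (auto simp: unit_vec_def)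
  then show "l0_norm p (unit_vec j) = 1" by (simp add: l0_norm_def)
  have "(\<Sum>i<p. (unit_vec j i)\<^sup>2) = (\<Sum>i<p. if i = j then 1 else 0)"
    by (intro sum.cong) (auto simp: unit_vec_def)
  then show "L2_set (unit_vec j) {..<p} = 1" using assms by (simp add: L2_set_def)
qed

text \<open>The supremum runs over the unit sphere, but vectors rounded to a grid are only known to
  stay in the unit ball. Normalizing a nonzero vector can only enlarge the integrand.\<close>

lemma moment_x_ge:
  assumes v: "L2_set v {..<p} \<le> 1" "l0_norm p v \<le> l" and q: "0 < q"
  shows "(\<integral>\<^sup>+ z. ennreal (\<bar>dot p (fst z) v\<bar> powr q) \<partial>P) \<le> moment_x p P q l"
proof -
  define c where "c = L2_set v {..<p}"
  have c01: "0 \<le> c" "c \<le> 1" using v by (auto simp: c_def)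
  show ?thesis
  proof (cases "c = 0")
    case True
    then have "v j = 0" if "j < p" for j using that by (simp add: c_def L2_set_eq_0_iff)
    then have "dot p u v = 0" for u by (simp add: dot_def)
    then show ?thesis using q by simp
  next
    case False
    define u where "u j = v j / c" for j
    have "L2_set u {..<p} = L2_set v {..<p} * (1 / c)"
      unfolding u_def using L2_set_left_distrib[of "1 / c" v "{..<p}"] c01 by simp
    then have u1: "L2_set u {..<p} = 1" using False by (simp add: c_def)
    have u2: "l0_norm p u \<le> l" using v False by (simp add: l0_norm_def u_def)
    have d: "dot p x v = c * dot p x u" for x
      using False by (simp add: dot_def u_def sum_distrib_left)
    have "(\<integral>\<^sup>+ z. ennreal (\<bar>dot p (fst z) v\<bar> powr q) \<partial>P) \<le> (\<integral>\<^sup>+ z. ennreal (\<bar>dot p (fst z) u\<bar> powr q) \<partial>P)"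
    proof (intro nn_integral_mono ennreal_leI powr_mono2)
      fix z show "\<bar>dot p (fst z) v\<bar> \<le> \<bar>dot p (fst z) u\<bar>"
        unfolding d abs_mult using c01 by (intro mult_left_le_one_le) auto
    qed (use q in auto)
    also have "\<dots> \<le> moment_x p P q l"
      unfolding moment_x_def using u1 u2 by (intro SUP_upper) auto
    finally show ?thesis .
  qed
qed

lemma integral_le_enn2real:
  fixes f :: "'a \<Rightarrow> real"
  assumes "f \<in> borel_measurable M" "\<And>x. 0 \<le> f x" "(\<integral>\<^sup>+ x. ennreal (f x) \<partial>M) \<le> V" "V < \<infinity>"
  shows "integrable M f" "integral\<^sup>L M f \<le> enn2real V"
proof -
  have "(\<integral>\<^sup>+ x. ennreal (f x) \<partial>M) < \<infinity>" using assms by (metis order_le_less_trans)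
  then show i: "integrable M f" using assms by (intro integrableI_nonneg) auto
  have "integral\<^sup>L M f = enn2real (\<integral>\<^sup>+ x. ennreal (f x) \<partial>M)"
    using assms by (intro integral_eq_nn_integral) auto
  also have "\<dots> \<le> enn2real V" using assms by (intro enn2real_mono) (auto simp: top.not_eq_extremum)
  finally show "integral\<^sup>L M f \<le> enn2real V" .
qed

text \<open>\<open>l\<close> is the sparsity level at which moments and eigenvalues are controlled;
  in the end it is \<open>2 * s + s'\<close>. Since it is at least one, the coordinate directions
  are covered.\<close>

locale heavy_tailed_model =
  fixes p l :: nat and \<theta>s :: vec and P :: "obs measure" and lam \<delta> \<kappa>m \<kappa>p :: real
  assumes model: "linear_model p \<theta>s P"
    and p1: "1 \<le> p" and l1: "1 \<le> l"
    and lam: "0 < lam" "lam \<le> 1" and \<delta>: "0 < \<delta>" "\<delta> \<le> 1"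
    and Mx_fin: "moment_x p P (2 + 2 * lam) l < \<infinity>"
    and Me_fin: "moment_eps p \<theta>s P (1 + \<delta>) < \<infinity>"
    and \<kappa>: "0 < \<kappa>m" "\<kappa>m \<le> \<kappa>p"
    and eig: "sparse_eigenvalues p P l \<kappa>m \<kappa>p"
begin

sublocale prob_space P
  using model by (simp add: linear_model_def)

definition Mx :: real where "Mx = enn2real (moment_x p P (2 + 2 * lam) l)"
definition Meff :: real where "Meff = enn2real (moment_eff p \<theta>s P (1 + \<delta>) l)"

lemma sets_P: "sets P = sets (obs_space p)"
  using model by (simp add: linear_model_def)

lemma measurable_fst_P: "fst \<in> measurable P (Pi\<^sub>M {..<p} (\<lambda>_. borel))"
  unfolding measurable_cong_sets[OF sets_P refl] obs_space_def by measurable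

lemma measurable_snd_P [measurable]: "snd \<in> borel_measurable P"
  unfolding measurable_cong_sets[OF sets_P refl] obs_space_def by measurable

lemma measurable_coord [measurable (raw)]:
  assumes "j < p" "f \<in> measurable N P" shows "(\<lambda>w. fst (f w) j) \<in> borel_measurable N"
proof -
  have "(\<lambda>x. x j) \<in> measurable (Pi\<^sub>M {..<p} (\<lambda>_. borel :: real measure)) borel"
    using assms by (intro measurable_component_singleton) auto
  from measurable_compose[OF measurable_fst_P this] show ?thesis
    by (rule measurable_compose[OF assms(2)])
qed

lemma measurable_dot [measurable (raw)]:
  assumes "f \<in> measurable N P" "\<And>j. j < p \<Longrightarrow> (\<lambda>w. v w j) \<in> borel_measurable N"
  shows "(\<lambda>w. dot p (fst (f w)) (v w)) \<in> borel_measurable N"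
  unfolding dot_def using assms by measurable

lemma measurable_noise [measurable]: "noise p \<theta>s \<in> borel_measurable P"
  unfolding noise_def by measurable

lemma dot_moment:
  assumes "L2_set v {..<p} \<le> 1" "l0_norm p v \<le> l"
  shows "integrable P (\<lambda>z. \<bar>dot p (fst z) v\<bar> powr (2 + 2 * lam))"
    "(\<integral>z. \<bar>dot p (fst z) v\<bar> powr (2 + 2 * lam) \<partial>P) \<le> Mx"
  unfolding Mx_def using lam moment_x_ge[OF assms] Mx_fin
  by (intro integral_le_enn2real; force)+

lemma coord_moment:
  assumes "j < p"
  shows "integrable P (\<lambda>z. \<bar>fst z j\<bar> powr (2 + 2 * lam))"
    "(\<integral>z. \<bar>fst z j\<bar> powr (2 + 2 * lam) \<partial>P) \<le> Mx"
  using dot_moment[of "unit_vec j"] unit_vec[OF assms] l1 by auto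

lemma Mx_nonneg: "0 \<le> Mx" by (simp add: Mx_def)

lemma integrable_coord_square: "j < p \<Longrightarrow> integrable P (\<lambda>z. (fst z j)\<^sup>2)"
proof (rule Bochner_Integration.integrable_bound[of P "\<lambda>z. 1 + \<bar>fst z j\<bar> powr (2 + 2 * lam)"])
  assume j: "j < p"
  show "AE z in P. norm ((fst z j)\<^sup>2) \<le> norm (1 + \<bar>fst z j\<bar> powr (2 + 2 * lam))"
  proof (rule AE_I2)
    fix z :: obs
    have "\<bar>fst z j\<bar> powr 2 \<le> 1 + \<bar>fst z j\<bar> powr (2 + 2 * lam)"
      using lam by (intro powr_le_one_plus_powr) auto
    then show "norm ((fst z j)\<^sup>2) \<le> norm (1 + \<bar>fst z j\<bar> powr (2 + 2 * lam))"
      by (simp add: abs_of_nonneg add_nonneg_nonneg)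
  qed
qed (use coord_moment in auto)

lemma integrable_coord_mult:
  assumes "j < p" "k < p" shows "integrable P (\<lambda>z. fst z j * fst z k)"
proof (rule Bochner_Integration.integrable_bound[of P "\<lambda>z. (fst z j)\<^sup>2 + (fst z k)\<^sup>2"])
  show "AE z in P. norm (fst z j * fst z k) \<le> norm ((fst z j)\<^sup>2 + (fst z k)\<^sup>2)"
  proof (rule AE_I2)
    fix z :: obs
    have "0 \<le> (\<bar>fst z j\<bar> - \<bar>fst z k\<bar>)\<^sup>2" by simp
    then have "2 * (\<bar>fst z j\<bar> * \<bar>fst z k\<bar>) \<le> (fst z j)\<^sup>2 + (fst z k)\<^sup>2" by (simp add: power2_diff)
    moreover have "0 \<le> \<bar>fst z j\<bar> * \<bar>fst z k\<bar>" by simp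
    ultimately show "norm (fst z j * fst z k) \<le> norm ((fst z j)\<^sup>2 + (fst z k)\<^sup>2)"
      unfolding real_norm_def abs_mult by linarith
  qed
qed (use assms integrable_coord_square in auto)

lemma Sigma_x_commute: "Sigma_x P j k = Sigma_x P k j"
  by (simp add: Sigma_x_def mult.commute)

lemma sparse_spectrum_Sigma_x: "sparse_spectrum p (Sigma_x P) l \<kappa>m \<kappa>p"
  using eig by (simp add: sparse_spectrum_def sparse_eigenvalues_def L2_set_def sum_nonneg)

text \<open>The first coordinate has second moment at least \<open>\<kappa>m\<close>. Truncating its
  square at \<open>\<kappa>m / 2\<close> leaves the other half to be paid by the moment of order
  \<open>2 + 2 * lam\<close>. This keeps the required sample size away from zero, so that blocks
  cannot be empty.\<close>

lemma Mx_lower: "(\<kappa>m / 2) powr (1 + lam) \<le> Mx"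
proof -
  define x where "x z = fst z (0::nat)" for z :: obs
  define c where "c = \<kappa>m / 2"
  have c: "0 < c" using \<kappa> by (simp add: c_def)
  have 0: "0 < p" using p1 by simp
  have "\<kappa>m * (L2_set (unit_vec 0) {..<p})\<^sup>2 \<le> (\<Sum>j<p. \<Sum>k<p. unit_vec 0 j * Sigma_x P j k * unit_vec 0 k)"
    using eig unit_vec(2)[OF 0] l1 by (simp add: sparse_eigenvalues_def)
  also have "\<dots> = Sigma_x P 0 0"
  proof -
    have row: "(\<Sum>k<p. u k * unit_vec 0 k) = u 0" for u :: vec
      using unit_vec(1)[OF 0, of u] by (simp add: dot_def)
    have "(\<Sum>j<p. \<Sum>k<p. unit_vec 0 j * Sigma_x P j k * unit_vec 0 k) = (\<Sum>j<p. unit_vec 0 j * Sigma_x P j 0)"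
      by (simp only: row)
    also have "\<dots> = (\<Sum>j<p. Sigma_x P j 0 * unit_vec 0 j)" by (simp only: mult.commute)
    finally show ?thesis by (simp only: row)
  qed
  finally have "\<kappa>m \<le> expectation (\<lambda>z. (x z)\<^sup>2)"
    using unit_vec(3)[OF 0] by (simp add: Sigma_x_def x_def power2_eq_square)
  also have "\<dots> \<le> expectation (\<lambda>z. c + c powr (- lam) * \<bar>x z\<bar> powr (2 + 2 * lam))"
  proof (rule integral_mono)
    show "integrable P (\<lambda>z. (x z)\<^sup>2)" using integrable_coord_square[OF 0] by (simp add: x_def)
    show "integrable P (\<lambda>z. c + c powr (- lam) * \<bar>x z\<bar> powr (2 + 2 * lam))"
      using coord_moment[OF 0] by (simp add: x_def)
    fix z
    have "\<bar>(x z)\<^sup>2\<bar> \<le> c + c powr (1 - (1 + lam)) * \<bar>(x z)\<^sup>2\<bar> powr (1 + lam)"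
      using c lam by (intro abs_le_powr_split) auto
    moreover have "\<bar>(x z)\<^sup>2\<bar> powr (1 + lam) = \<bar>x z\<bar> powr (2 + 2 * lam)"
    proof -
      have "\<bar>(x z)\<^sup>2\<bar> powr (1 + lam) = (\<bar>x z\<bar> powr (1 + lam)) * (\<bar>x z\<bar> powr (1 + lam))"
        by (simp only: power2_eq_square abs_mult powr_mult)
      then show ?thesis by (simp flip: powr_add add: algebra_simps)
    qed
    ultimately show "(x z)\<^sup>2 \<le> c + c powr (- lam) * \<bar>x z\<bar> powr (2 + 2 * lam)" by simp
  qed
  also have "\<dots> = c + c powr (- lam) * expectation (\<lambda>z. \<bar>x z\<bar> powr (2 + 2 * lam))"
    using coord_moment[OF 0] by (simp add: x_def prob_space)
  also have "\<dots> \<le> c + c powr (- lam) * Mx"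
    using coord_moment[OF 0] by (intro add_left_mono mult_left_mono) (auto simp: x_def)
  finally have "c \<le> c powr (- lam) * Mx" by (simp add: c_def)
  then have "c powr lam * c \<le> c powr lam * (c powr (- lam) * Mx)" by (intro mult_left_mono) auto
  also have "\<dots> = Mx" using c by (simp flip: mult.assoc powr_add)
  finally show ?thesis using c by (simp add: powr_add c_def mult.commute)
qed

lemma Mx_pos: "0 < Mx"
proof -
  have "0 < (\<kappa>m / 2) powr (1 + lam)" using \<kappa> by simp
  then show ?thesis using Mx_lower by linarith
qed

lemma signal_moment:
  assumes j: "j < p" and v: "L2_set v {..<p} \<le> 1" "l0_norm p v \<le> l"
  shows "integrable P (\<lambda>z. fst z j * dot p (fst z) v)"
    "(\<integral>z. fst z j * dot p (fst z) v \<partial>P) = (\<Sum>k<p. Sigma_x P j k * v k)"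
    "integrable P (\<lambda>z. \<bar>fst z j * dot p (fst z) v - (\<Sum>k<p. Sigma_x P j k * v k)\<bar> powr (1 + lam))"
    "(\<integral>z. \<bar>fst z j * dot p (fst z) v - (\<Sum>k<p. Sigma_x P j k * v k)\<bar> powr (1 + lam) \<partial>P) \<le> 20 * Mx"
proof -
  define X where "X z = fst z j * dot p (fst z) v" for z :: obs
  have Xm [measurable]: "X \<in> borel_measurable P" unfolding X_def using j by measurable
  have le: "\<bar>X z\<bar> powr (1 + lam) \<le> (\<bar>fst z j\<bar> powr (2 + 2 * lam) + \<bar>dot p (fst z) v\<bar> powr (2 + 2 * lam)) / 2" for z
    using abs_mult_powr_le[of "fst z j" "dot p (fst z) v" "1 + lam"] by (simp add: X_def)
  have iU: "integrable P (\<lambda>z. (\<bar>fst z j\<bar> powr (2 + 2 * lam) + \<bar>dot p (fst z) v\<bar> powr (2 + 2 * lam)) / 2)"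
    using coord_moment[OF j] dot_moment[OF v] by simp
  have iX: "integrable P (\<lambda>z. \<bar>X z\<bar> powr (1 + lam))"
    using le by (intro Bochner_Integration.integrable_bound[OF iU]) (auto intro!: AE_I2)
  have "expectation (\<lambda>z. \<bar>X z\<bar> powr (1 + lam)) \<le> expectation (\<lambda>z. (\<bar>fst z j\<bar> powr (2 + 2 * lam) + \<bar>dot p (fst z) v\<bar> powr (2 + 2 * lam)) / 2)"
    using le by (intro integral_mono iX iU)
  also have "\<dots> \<le> Mx" using coord_moment[OF j] dot_moment[OF v] by simp
  finally have eX: "expectation (\<lambda>z. \<bar>X z\<bar> powr (1 + lam)) \<le> Mx" .
  have r: "1 \<le> 1 + lam" "1 + lam \<le> 2" using lam by auto
  note c = centered_moment_le[OF r Xm iX eX Mx_pos]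
  show mu: "(\<integral>z. fst z j * dot p (fst z) v \<partial>P) = (\<Sum>k<p. Sigma_x P j k * v k)"
  proof -
    have "(\<integral>z. fst z j * dot p (fst z) v \<partial>P) = (\<integral>z. (\<Sum>k<p. (fst z j * fst z k) * v k) \<partial>P)"
      by (simp add: dot_def sum_distrib_left mult.assoc)
    also have "\<dots> = (\<Sum>k<p. (\<integral>z. (fst z j * fst z k) * v k \<partial>P))"
      using integrable_coord_mult[OF j] by (intro Bochner_Integration.integral_sum) auto
    finally show ?thesis by (simp add: Sigma_x_def)
  qed
  show "integrable P (\<lambda>z. fst z j * dot p (fst z) v)"
    "integrable P (\<lambda>z. \<bar>fst z j * dot p (fst z) v - (\<Sum>k<p. Sigma_x P j k * v k)\<bar> powr (1 + lam))"
    "(\<integral>z. \<bar>fst z j * dot p (fst z) v - (\<Sum>k<p. Sigma_x P j k * v k)\<bar> powr (1 + lam) \<partial>P) \<le> 20 * Mx"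
    by (rule c[unfolded X_def mu])+
qed

section \<open>The noise, conditionally on the covariate\<close>

lemma subalgebra_covariate: "subalgebra P (covariate_algebra p P)"
proof -
  have f: "fst \<in> space P \<rightarrow> space (Pi\<^sub>M {..<p} (\<lambda>_. borel :: real measure))"
    using measurable_space[OF measurable_fst_P] by blast
  show ?thesis unfolding subalgebra_def covariate_algebra_def
    unfolding sets_vimage_algebra2[OF f] using measurable_sets[OF measurable_fst_P] by auto
qed

sublocale cov: finite_measure_subalgebra P "covariate_algebra p P"
  by unfold_locales (rule subalgebra_covariate)

lemma measurable_coord_covariate:
  assumes "j < p" shows "(\<lambda>z. fst z j) \<in> borel_measurable (covariate_algebra p P)"
proof -
  have f: "fst \<in> space P \<rightarrow> space (Pi\<^sub>M {..<p} (\<lambda>_. borel :: real measure))"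
    using measurable_space[OF measurable_fst_P] by blast
  have "fst \<in> measurable (covariate_algebra p P) (Pi\<^sub>M {..<p} (\<lambda>_. borel))"
    unfolding covariate_algebra_def by (rule measurable_vimage_algebra1[OF f])
  moreover have "(\<lambda>x. x j) \<in> measurable (Pi\<^sub>M {..<p} (\<lambda>_. borel :: real measure)) borel"
    using assms by (intro measurable_component_singleton) auto
  ultimately show ?thesis by (rule measurable_compose)
qed

text \<open>Since \<open>1 + \<delta> \<le> 2 \<le> 2 + 2 * lam\<close>, the lower power is at most
  one plus the higher. This makes the effective moment a finite number.\<close>

lemma moment_x_low_fin: "moment_x p P (1 + \<delta>) l < \<infinity>"
proof -
  have "moment_x p P (1 + \<delta>) l \<le> 1 + moment_x p P (2 + 2 * lam) l"
    unfolding moment_x_def[of p P "1 + \<delta>"]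
  proof (rule SUP_least)
    fix v assume v: "v \<in> {v. L2_set v {..<p} = 1 \<and> l0_norm p v \<le> l}"
    have "(\<integral>\<^sup>+ z. ennreal (\<bar>dot p (fst z) v\<bar> powr (1 + \<delta>)) \<partial>P)
        \<le> (\<integral>\<^sup>+ z. 1 + ennreal (\<bar>dot p (fst z) v\<bar> powr (2 + 2 * lam)) \<partial>P)"
    proof (rule nn_integral_mono)
      fix z
      have "\<bar>dot p (fst z) v\<bar> powr (1 + \<delta>) \<le> 1 + \<bar>dot p (fst z) v\<bar> powr (2 + 2 * lam)"
        using lam \<delta> by (intro powr_le_one_plus_powr) auto
      then show "ennreal (\<bar>dot p (fst z) v\<bar> powr (1 + \<delta>)) \<le> 1 + ennreal (\<bar>dot p (fst z) v\<bar> powr (2 + 2 * lam))"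
        by (metis ennreal_1 ennreal_leI ennreal_plus powr_ge_zero zero_le_one)
    qed
    also have "\<dots> = 1 + (\<integral>\<^sup>+ z. ennreal (\<bar>dot p (fst z) v\<bar> powr (2 + 2 * lam)) \<partial>P)"
      by (subst nn_integral_add) (auto simp: emeasure_space_1)
    also have "\<dots> \<le> 1 + moment_x p P (2 + 2 * lam) l"
      using v lam by (intro add_left_mono moment_x_ge) auto
    finally show "(\<integral>\<^sup>+ z. ennreal (\<bar>dot p (fst z) v\<bar> powr (1 + \<delta>)) \<partial>P) \<le> 1 + moment_x p P (2 + 2 * lam) l" .
  qed
  also have "\<dots> < \<infinity>" using Mx_fin by simp
  finally show ?thesis .
qed

lemma moment_eff_fin: "moment_eff p \<theta>s P (1 + \<delta>) l < \<infinity>"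
  unfolding moment_eff_def using moment_x_low_fin Me_fin by (simp add: ennreal_mult_less_top)

text \<open>The covariate factor is measurable with respect to the conditioning algebra. The
  conditional moment of the noise may therefore be inserted and replaced by its essential supremum,
  which factors the moment of the product; conditioning in the same way gives the zero mean.\<close>

lemma noise_moment:
  assumes j: "j < p"
  shows "integrable P (\<lambda>z. \<bar>noise p \<theta>s z * fst z j\<bar> powr (1 + \<delta>))"
    "(\<integral>z. \<bar>noise p \<theta>s z * fst z j\<bar> powr (1 + \<delta>) \<partial>P) \<le> Meff"
    "integrable P (\<lambda>z. noise p \<theta>s z * fst z j)"
    "(\<integral>z. noise p \<theta>s z * fst z j \<partial>P) = 0"
proof -
  let ?F = "covariate_algebra p P"
  define f where "f z = ennreal (\<bar>fst z j\<bar> powr (1 + \<delta>))" for z :: obs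
  define g where "g z = ennreal (\<bar>noise p \<theta>s z\<bar> powr (1 + \<delta>))" for z
  note [measurable] = measurable_coord_covariate[OF j]
  have fF [measurable]: "f \<in> borel_measurable ?F" unfolding f_def by measurable
  have fP [measurable]: "f \<in> borel_measurable P" unfolding f_def using j by measurable
  have gP [measurable]: "g \<in> borel_measurable P" unfolding g_def by measurable
  have "(\<integral>\<^sup>+ z. ennreal (\<bar>noise p \<theta>s z * fst z j\<bar> powr (1 + \<delta>)) \<partial>P) = (\<integral>\<^sup>+ z. f z * g z \<partial>P)"
    by (simp add: f_def g_def abs_mult powr_mult ennreal_mult mult.commute)
  also have "\<dots> = (\<integral>\<^sup>+ z. f z * nn_cond_exp P ?F g z \<partial>P)"
    by (rule cov.nn_cond_exp_intg[symmetric, OF fF gP])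
  also have "\<dots> \<le> (\<integral>\<^sup>+ z. f z * moment_eps p \<theta>s P (1 + \<delta>) \<partial>P)"
  proof (rule nn_integral_mono_AE)
    show "AE z in P. f z * nn_cond_exp P ?F g z \<le> f z * moment_eps p \<theta>s P (1 + \<delta>)"
      using esssup_AE[of "nn_cond_exp P ?F g" P]
      by eventually_elim (auto simp: moment_eps_def g_def[abs_def] intro!: mult_left_mono)
  qed
  also have "\<dots> = (\<integral>\<^sup>+ z. f z \<partial>P) * moment_eps p \<theta>s P (1 + \<delta>)"
    by (rule nn_integral_multc) measurable
  also have "\<dots> \<le> moment_x p P (1 + \<delta>) l * moment_eps p \<theta>s P (1 + \<delta>)"
  proof (intro mult_right_mono)
    show "(\<integral>\<^sup>+ z. f z \<partial>P) \<le> moment_x p P (1 + \<delta>) l"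
      using moment_x_ge[of "unit_vec j" p l "1 + \<delta>" P] unit_vec[OF j] l1 \<delta> by (simp add: f_def)
  qed simp
  finally have b: "(\<integral>\<^sup>+ z. ennreal (\<bar>noise p \<theta>s z * fst z j\<bar> powr (1 + \<delta>)) \<partial>P) \<le> moment_eff p \<theta>s P (1 + \<delta>) l"
    by (simp add: moment_eff_def mult.commute)
  have m: "(\<lambda>z. noise p \<theta>s z * fst z j) \<in> borel_measurable P" using j by measurable
  show i: "integrable P (\<lambda>z. \<bar>noise p \<theta>s z * fst z j\<bar> powr (1 + \<delta>))"
    and "(\<integral>z. \<bar>noise p \<theta>s z * fst z j\<bar> powr (1 + \<delta>) \<partial>P) \<le> Meff"
    unfolding Meff_def using m b moment_eff_fin by (intro integral_le_enn2real[OF _ _ b]; simp)+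
  show i1: "integrable P (\<lambda>z. noise p \<theta>s z * fst z j)"
  proof (rule Bochner_Integration.integrable_bound[of P "\<lambda>z. 1 + \<bar>noise p \<theta>s z * fst z j\<bar> powr (1 + \<delta>)"])
    show "AE z in P. norm (noise p \<theta>s z * fst z j) \<le> norm (1 + \<bar>noise p \<theta>s z * fst z j\<bar> powr (1 + \<delta>))"
      using powr_le_one_plus_powr[of 1 "1 + \<delta>"] \<delta>
      by (intro AE_I2) (simp add: abs_of_nonneg add_nonneg_nonneg)
  qed (use i m in auto)
  have "(\<integral>z. noise p \<theta>s z * fst z j \<partial>P) = (\<integral>z. fst z j * noise p \<theta>s z \<partial>P)" by (simp add: mult.commute)
  also have "\<dots> = (\<integral>z. fst z j * real_cond_exp P ?F (noise p \<theta>s) z \<partial>P)"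
    using i1 by (intro cov.real_cond_exp_intg(2)[symmetric]) (auto simp: mult.commute)
  also have "\<dots> = (\<integral>z. 0 \<partial>P)"
  proof (rule integral_cong_AE)
    have "AE z in P. real_cond_exp P ?F (noise p \<theta>s) z = 0" using model by (simp add: linear_model_def)
    then show "AE z in P. fst z j * real_cond_exp P ?F (noise p \<theta>s) z = 0" by eventually_elim simp
  qed (use j in measurable)
  finally show "(\<integral>z. noise p \<theta>s z * fst z j \<partial>P) = 0" by simp
qed

end

section \<open>Measurability and deviations of the gradient\<close>

text \<open>Median and thresholding are defined by ordering. Once order statistics and ranks are
  counts, and counts are sums of indicators, their measurability is immediate.\<close>

lemma card_eq_sum_indicator:
  fixes n :: nat
  shows "real (card {j. j < n \<and> Q j}) = (\<Sum>j<n. if Q j then 1 else 0)"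
  using sum.inter_filter[of "{..<n}" "\<lambda>_. 1 :: real" Q] by simp

lemma measurable_median:
  assumes f: "\<And>k. k < K \<Longrightarrow> f k \<in> borel_measurable N"
  shows "(\<lambda>w. median (map (\<lambda>k. f k w) [0..<K])) \<in> borel_measurable N"
proof (cases "K = 0")
  case False
  have "(\<lambda>w. sort (map (\<lambda>k. f k w) [0..<K]) ! i) \<in> borel_measurable N" if i: "i < K" for i
    unfolding borel_measurable_iff_le
  proof
    fix c
    have "sort (map (\<lambda>k. f k w) [0..<K]) ! i \<le> c \<longleftrightarrow> real i < (\<Sum>j<K. if f j w \<le> c then 1 else 0)" for w
    proof -
      have "{j. j < length (map (\<lambda>k. f k w) [0..<K]) \<and> map (\<lambda>k. f k w) [0..<K] ! j \<le> c} = {j. j < K \<and> f j w \<le> c}"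
        by auto
      then show ?thesis
        using sort_nth_le_iff[of i "map (\<lambda>k. f k w) [0..<K]" c] i
        by (simp flip: card_eq_sum_indicator)
    qed
    moreover have "{w \<in> space N. real i < (\<Sum>j<K. if f j w \<le> c then 1 else 0 :: real)} \<in> sets N"
      using f by measurable
    ultimately show "{w \<in> space N. sort (map (\<lambda>k. f k w) [0..<K]) ! i \<le> c} \<in> sets N" by simp
  qed
  moreover have "(K - 1) div 2 < K" "K div 2 < K" using False by auto
  ultimately show ?thesis unfolding median_def by simp
qed simp

lemma measurable_hard_threshold:
  assumes "\<And>j. j < p \<Longrightarrow> (\<lambda>w. v w j) \<in> borel_measurable N"
  shows "(\<lambda>w. hard_threshold p s (v w) j) \<in> borel_measurable N"
proof (cases "j < p")
  case True
  have "card {i. i < p \<and> (\<bar>v w i\<bar> > \<bar>v w j\<bar> \<or> \<bar>v w i\<bar> = \<bar>v w j\<bar> \<and> i < j)} < s \<longleftrightarrow>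
      (\<Sum>i<p. if \<bar>v w i\<bar> > \<bar>v w j\<bar> \<or> \<bar>v w i\<bar> = \<bar>v w j\<bar> \<and> i < j then 1 else 0) < real s" for w
    by (simp flip: card_eq_sum_indicator)
  then show ?thesis unfolding hard_threshold_def using assms True by simp
qed (simp add: hard_threshold_def)

lemma mom_grad_cong:
  assumes "\<And>k i. k < K \<Longrightarrow> i \<in> B k \<Longrightarrow> z i = z' i"
  shows "mom_grad p K B z \<theta> = mom_grad p K B z' \<theta>"
proof -
  have "(\<Sum>i\<in>B k. grad_loss p \<theta> (z i) j) = (\<Sum>i\<in>B k. grad_loss p \<theta> (z' i) j)" if "k < K" for k j
    using assms that by (intro sum.cong) auto
  then show ?thesis unfolding mom_grad_def
    by (intro ext arg_cong[where f = median] map_cong) auto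
qed

text \<open>Independence of an iterate from later batches is used in this form: an iterate is a
  function of the observations in the blocks already visited.\<close>

lemma mom_iht_cong:
  assumes "\<And>t' k i. t' < t \<Longrightarrow> k < K \<Longrightarrow> i \<in> Bs t' k \<Longrightarrow> z i = z' i"
  shows "mom_iht p s \<eta> K Bs z \<theta>0 t = mom_iht p s \<eta> K Bs z' \<theta>0 t"
  using assms
proof (induction t)
  case (Suc t)
  have "mom_iht p s \<eta> K Bs z \<theta>0 t = mom_iht p s \<eta> K Bs z' \<theta>0 t" by (rule Suc.IH) (blast intro: Suc.prems less_SucI)
  moreover have "mom_grad p K (Bs t) z \<theta> = mom_grad p K (Bs t) z' \<theta>" for \<theta>
    by (rule mom_grad_cong) (auto intro: Suc.prems)
  ultimately show ?case by simp
qed simp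

context heavy_tailed_model
begin

lemma measurable_mom_grad:
  assumes z: "\<And>k i. k < K \<Longrightarrow> i \<in> B k \<Longrightarrow> (\<lambda>w. z w i) \<in> measurable N P"
    and \<theta>: "\<And>j. j < p \<Longrightarrow> (\<lambda>w. \<theta> w j) \<in> borel_measurable N" and j: "j < p"
  shows "(\<lambda>w. mom_grad p K B (z w) (\<theta> w) j) \<in> borel_measurable N"
  unfolding mom_grad_def
proof (rule measurable_median)
  fix k assume k: "k < K"
  have "(\<lambda>w. grad_loss p (\<theta> w) (z w i) j) \<in> borel_measurable N" if "i \<in> B k" for i
    unfolding grad_loss_def using z[OF k that] \<theta> j by measurable
  then show "(\<lambda>w. (\<Sum>i\<in>B k. grad_loss p (\<theta> w) (z w i) j) / real (card (B k))) \<in> borel_measurable N"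
    by measurable
qed

lemma measurable_mom_iht:
  assumes "\<And>t' k i. t' < t \<Longrightarrow> k < K \<Longrightarrow> i \<in> Bs t' k \<Longrightarrow> (\<lambda>w. z w i) \<in> measurable N P"
    and \<theta>: "\<And>j. j < p \<Longrightarrow> (\<lambda>w. \<theta> w j) \<in> borel_measurable N" and j: "j < p"
  shows "(\<lambda>w. mom_iht p s \<eta> K Bs (z w) (\<theta> w) t j) \<in> borel_measurable N"
  using assms(1) j
proof (induction t arbitrary: j)
  case 0
  then show ?case using \<theta> by simp
next
  case (Suc t)
  have IH: "(\<lambda>w. mom_iht p s \<eta> K Bs (z w) (\<theta> w) t i) \<in> borel_measurable N" if "i < p" for i
    using that by (intro Suc.IH Suc.prems(1)) auto
  have "(\<lambda>w. mom_grad p K (Bs t) (z w) (mom_iht p s \<eta> K Bs (z w) (\<theta> w) t) i) \<in> borel_measurable N" if "i < p" for i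
    using that by (intro measurable_mom_grad IH Suc.prems(1)) auto
  then show ?case
    using IH by (simp only: mom_iht.simps Let_def) (intro measurable_hard_threshold; simp)
qed

text \<open>The subtracted sum is the expected gradient of the loss at \<open>\<theta>\<close>,
  because the noise is uncorrelated with each coordinate of the covariate.\<close>

abbreviation grad_dev :: "nat \<Rightarrow> (nat \<Rightarrow> nat set) \<Rightarrow> (nat \<Rightarrow> obs) \<Rightarrow> vec \<Rightarrow> nat \<Rightarrow> real" where
  "grad_dev K B z \<theta> j \<equiv> mom_grad p K B z \<theta> j - (\<Sum>k<p. Sigma_x P j k * (\<theta> k - \<theta>s k))"

definition sig_dev :: "nat set \<Rightarrow> (nat \<Rightarrow> obs) \<Rightarrow> nat \<Rightarrow> vec \<Rightarrow> real" where
  "sig_dev B z j v = (\<Sum>i\<in>B. fst (z i) j * dot p (fst (z i)) v) / real (card B) - (\<Sum>k<p. Sigma_x P j k * v k)"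

definition noise_mean :: "nat set \<Rightarrow> (nat \<Rightarrow> obs) \<Rightarrow> nat \<Rightarrow> real" where
  "noise_mean B z j = (\<Sum>i\<in>B. noise p \<theta>s (z i) * fst (z i) j) / real (card B)"

lemma sig_dev_restrict: "sig_dev B (restrict z B) j v = sig_dev B z j v"
  by (simp add: sig_dev_def)

lemma noise_mean_restrict: "noise_mean B (restrict z B) j = noise_mean B z j"
  by (simp add: noise_mean_def)

text \<open>Writing the response as signal plus noise separates a deviation linear in the error
  \<open>\<theta> - \<theta>s\<close>, which the contraction can absorb, from one that is free of
  \<open>\<theta>\<close> and sets the final accuracy.\<close>

lemma grad_mean_eq:
  "(\<Sum>i\<in>B. grad_loss p \<theta> (z i) j) / real (card B)
     = (\<Sum>k<p. Sigma_x P j k * (\<theta> k - \<theta>s k)) + sig_dev B z j (\<lambda>k. \<theta> k - \<theta>s k) - noise_mean B z j"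
proof -
  have "grad_loss p \<theta> x j = fst x j * dot p (fst x) (\<lambda>k. \<theta> k - \<theta>s k) - noise p \<theta>s x * fst x j" for x
    by (simp add: grad_loss_def noise_def dot_def right_diff_distrib sum_subtractf) (simp add: algebra_simps)
  then show ?thesis by (simp add: sig_dev_def noise_mean_def sum_subtractf diff_divide_distrib)
qed

text \<open>Linearity serves twice: scaling reduces every parameter to a direction in the unit ball,
  and expanding in coordinate directions bounds rounding errors by variables that do not involve the
  direction.\<close>

lemma sig_dev_linear:
  "sig_dev B z j v = (\<Sum>m<p. v m * sig_dev B z j (unit_vec m))"
proof -
  have "(\<Sum>i\<in>B. fst (z i) j * dot p (fst (z i)) v) = (\<Sum>i\<in>B. \<Sum>m<p. v m * (fst (z i) j * dot p (fst (z i)) (unit_vec m)))"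
    by (intro sum.cong refl) (simp add: dot_def[of _ _ v] sum_distrib_left unit_vec algebra_simps)
  also have "\<dots> = (\<Sum>m<p. v m * (\<Sum>i\<in>B. fst (z i) j * dot p (fst (z i)) (unit_vec m)))"
    by (subst sum.swap) (simp add: sum_distrib_left)
  finally have 1: "(\<Sum>i\<in>B. fst (z i) j * dot p (fst (z i)) v)
      = (\<Sum>m<p. v m * (\<Sum>i\<in>B. fst (z i) j * dot p (fst (z i)) (unit_vec m)))" .
  have 2: "(\<Sum>k<p. Sigma_x P j k * v k) = (\<Sum>m<p. v m * (\<Sum>k<p. Sigma_x P j k * unit_vec m k))"
    using unit_vec(1)[of _ p "Sigma_x P j"] by (intro sum.cong) (simp_all add: dot_def)
  show ?thesis unfolding sig_dev_def 1 2 right_diff_distrib sum_subtractf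
    by (subst sum_divide_distrib) simp
qed

lemma sig_dev_scale: "sig_dev B z j (\<lambda>k. c * v k) = c * sig_dev B z j v"
  by (subst (1 2) sig_dev_linear) (simp add: sum_distrib_left mult.assoc)

lemma measurable_sig_dev:
  assumes "j < p" shows "(\<lambda>z. sig_dev B z j v) \<in> borel_measurable (iid B P)"
  unfolding sig_dev_def using assms by measurable

lemma measurable_noise_mean:
  assumes "j < p" shows "(\<lambda>z. noise_mean B z j) \<in> borel_measurable (iid B P)"
  unfolding noise_mean_def using assms by measurable

lemma sig_dev_tail:
  assumes "j < p" "L2_set v {..<p} \<le> 1" "l0_norm p v \<le> l" "finite B" "B \<noteq> {}" "0 < t"
  shows "measure (iid B P) {z \<in> space (iid B P). \<bar>sig_dev B z j v\<bar> > t}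
           \<le> 120 * Mx / (real (card B) powr lam * t powr (1 + lam))"
proof -
  have r: "1 \<le> 1 + lam" "1 + lam \<le> 2" using lam by auto
  note s = signal_moment[OF assms(1-3)]
  show ?thesis
    using block_mean_tail[OF prob_space_axioms assms(4,5) r assms(6) s] by (simp add: sig_dev_def)
qed

lemma noise_mean_tail:
  assumes "j < p" "finite B" "B \<noteq> {}" "0 < \<tau>"
  shows "measure (iid B P) {z \<in> space (iid B P). \<bar>noise_mean B z j\<bar> > \<tau>}
           \<le> 6 * Meff / (real (card B) powr \<delta> * \<tau> powr (1 + \<delta>))"
proof -
  have r: "1 \<le> 1 + \<delta>" "1 + \<delta> \<le> 2" using \<delta> by auto
  note s = noise_moment[OF assms(1)]
  show ?thesis
    using block_mean_tail[OF prob_space_axioms assms(2,3) r assms(4) s(3,4)] s(1,2) by (simp add: noise_mean_def)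
qed

text \<open>A block can fail through the signal at a grid vector, through the rounding error or through the
  noise. If each of the three kinds of failure affects fewer than a sixth of the blocks, more than
  half of them are good; \<open>G\<close> collects the first two kinds.\<close>

lemma mom_grad_close:
  assumes G: "6 * card G < 2 * K" "\<And>k. k < K \<Longrightarrow> k \<notin> G \<Longrightarrow> \<bar>sig_dev (B k) z j (\<lambda>m. \<theta> m - \<theta>s m)\<bar> \<le> a"
      "finite G"
    and N: "6 * card {k. k < K \<and> \<bar>noise_mean (B k) z j\<bar> > \<tau>} < K"
  shows "\<bar>grad_dev K B z \<theta> j\<bar> \<le> a + \<tau>"
  unfolding mom_grad_def
proof (rule median_close)
  let ?N = "{k. k < K \<and> \<bar>noise_mean (B k) z j\<bar> > \<tau>}"
  let ?E = "{k. k < K \<and> \<bar>(\<Sum>i\<in>B k. grad_loss p \<theta> (z i) j) / real (card (B k)) - (\<Sum>k<p. Sigma_x P j k * (\<theta> k - \<theta>s k))\<bar> > a + \<tau>}"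
  have "?E \<subseteq> G \<union> ?N"
  proof
    fix k assume k: "k \<in> ?E"
    show "k \<in> G \<union> ?N"
    proof (rule ccontr)
      assume "k \<notin> G \<union> ?N"
      then have "\<bar>sig_dev (B k) z j (\<lambda>m. \<theta> m - \<theta>s m)\<bar> \<le> a" "\<bar>noise_mean (B k) z j\<bar> \<le> \<tau>"
        using k G(2) by auto
      then show False using k unfolding grad_mean_eq by auto
    qed
  qed
  then have "card ?E \<le> card (G \<union> ?N)" using G(3) by (intro card_mono) auto
  also have "\<dots> \<le> card G + card ?N" by (rule card_Un_le)
  finally show "2 * card ?E < K" using G(1) N by linarith
qed

end

section \<open>Uniform and pointwise gradient bounds\<close>

definition grid_values :: "nat \<Rightarrow> real set" where
  "grid_values l = (\<lambda>i. real_of_int i / (real l)\<^sup>2) ` {- int (l\<^sup>2)..int (l\<^sup>2)}"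

text \<open>Not the support of the decoded vector: rounding can turn an entry into zero, but the
  rounding error still lives on this set.\<close>

definition code_support :: "nat \<Rightarrow> (nat \<Rightarrow> nat \<times> real) \<Rightarrow> nat set" where
  "code_support l f = (\<lambda>i. fst (f i)) ` {..<l}"

text \<open>A repeated position could carry several values, and the choice operator settles on one.
  Codes built from a vector repeat positions with the same value, so every choice decodes them
  alike.\<close>

definition code_vec :: "nat \<Rightarrow> (nat \<Rightarrow> nat \<times> real) \<Rightarrow> vec" where
  "code_vec l f j = (if j \<in> code_support l f then snd (f (SOME i. i < l \<and> fst (f i) = j)) else 0)"

text \<open>A sparse vector with coordinates in a grid is coded by a list of at most \<open>l\<close> positions, with
  repetitions allowed, and their values; counting codes bounds the number of grid vectors.\<close>

definition codes :: "nat \<Rightarrow> nat \<Rightarrow> (nat \<Rightarrow> nat \<times> real) set" where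
  "codes p l = {f \<in> {..<l} \<rightarrow>\<^sub>E {..<p} \<times> grid_values l. L2_set (code_vec l f) {..<p} \<le> 1}"

lemma card_grid_values: "finite (grid_values l)" "card (grid_values l) \<le> 2 * l\<^sup>2 + 1"
proof -
  show "finite (grid_values l)" by (simp add: grid_values_def)
  have "card (grid_values l) \<le> card {- int (l\<^sup>2)..int (l\<^sup>2)}"
    unfolding grid_values_def by (rule card_image_le) simp
  moreover have "card {- int n..int n} = 2 * n + 1" for n
    unfolding card_atLeastAtMost_int by linarith
  ultimately show "card (grid_values l) \<le> 2 * l\<^sup>2 + 1" by metis
qed

lemma card_codes: "finite (codes p l)" "card (codes p l) \<le> (p * (2 * l\<^sup>2 + 1)) ^ l"
proof -
  let ?E = "{..<l} \<rightarrow>\<^sub>E {..<p} \<times> grid_values l"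
  have fin: "finite ?E" using card_grid_values by (intro finite_PiE) auto
  show "finite (codes p l)" by (rule finite_subset[OF _ fin]) (auto simp: codes_def)
  have "card (codes p l) \<le> card ?E" using fin by (intro card_mono) (auto simp: codes_def)
  also have "\<dots> = (p * card (grid_values l)) ^ l"
    by (subst card_PiE) (auto simp: card_cartesian_product)
  also have "\<dots> \<le> (p * (2 * l\<^sup>2 + 1)) ^ l"
    using card_grid_values by (intro power_mono mult_left_mono) auto
  finally show "card (codes p l) \<le> (p * (2 * l\<^sup>2 + 1)) ^ l" .
qed

lemma code_support:
  assumes "f \<in> codes p l"
  shows "code_support l f \<subseteq> {..<p}" "card (code_support l f) \<le> l" "finite (code_support l f)"
proof -
  show "code_support l f \<subseteq> {..<p}"
    using assms by (auto simp: codes_def code_support_def PiE_iff) (metis lessThan_iff mem_Times_iff)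
  show "card (code_support l f) \<le> l"
    unfolding code_support_def using card_image_le[of "{..<l}" "\<lambda>i. fst (f i)"] by simp
  show "finite (code_support l f)" by (simp add: code_support_def)
qed

lemma l0_code_vec:
  assumes "f \<in> codes p l"
  shows "l0_norm p (code_vec l f) \<le> l"
proof -
  have "{j. j < p \<and> code_vec l f j \<noteq> 0} \<subseteq> code_support l f" by (auto simp: code_vec_def)
  then have "card {j. j < p \<and> code_vec l f j \<noteq> 0} \<le> card (code_support l f)"
    using code_support[OF assms] by (intro card_mono)
  then show ?thesis using code_support(2)[OF assms] by (simp add: l0_norm_def)
qed

text \<open>Rounding toward zero rather than to the nearest point never increases an entry in
  absolute value, so the rounded vector stays in the unit ball where the moment bounds
  apply.\<close>

lemma round_toward_zero:
  fixes x :: real and N :: nat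
  assumes "\<bar>x\<bar> \<le> 1" "0 < N"
  obtains i where "i \<in> {- int N..int N}" "\<bar>x - of_int i / N\<bar> \<le> 1 / N" "\<bar>of_int i / N\<bar> \<le> \<bar>x\<bar>"
proof -
  define m where "m = \<lfloor>\<bar>x\<bar> * N\<rfloor>"
  define i where "i = (if x < 0 then - m else m)"
  have "\<bar>x\<bar> * real N \<le> 1 * real N" using assms by (intro mult_right_mono) auto
  then have m: "0 \<le> m" "m \<le> int N" "real_of_int m \<le> \<bar>x\<bar> * N" "\<bar>x\<bar> * N < real_of_int m + 1"
    unfolding m_def by (auto simp: floor_le_iff)
  have 1: "\<bar>of_int i / real N\<bar> = of_int m / N" using m by (auto simp: i_def)
  have 2: "of_int m / N \<le> \<bar>x\<bar>" using m assms by (simp add: field_simps)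
  have "\<bar>x\<bar> \<le> (of_int m + 1) / real N" using m assms by (simp add: pos_le_divide_eq)
  then have 3: "\<bar>x\<bar> - of_int m / N \<le> 1 / N" by (simp add: add_divide_distrib)
  have "\<bar>x - of_int i / N\<bar> = \<bar>x\<bar> - of_int m / N" using 2 m by (auto simp: i_def)
  moreover have "i \<in> {- int N..int N}" using m by (auto simp: i_def)
  ultimately show thesis using 1 2 3 by (intro that[of i]) linarith+
qed

lemma codes_dense:
  assumes v: "L2_set v {..<p} \<le> 1" "l0_norm p v \<le> l" and l: "0 < l" and nz: "\<exists>j<p. v j \<noteq> 0"
  obtains f where "f \<in> codes p l" "\<And>j. j < p \<Longrightarrow> \<bar>v j - code_vec l f j\<bar> \<le> 1 / (real l)\<^sup>2"
    "\<And>j. j < p \<Longrightarrow> j \<notin> code_support l f \<Longrightarrow> v j = 0"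
proof -
  define S where "S = {j. j < p \<and> v j \<noteq> 0}"
  have finS: "finite S" and S0: "S \<noteq> {}" using nz by (auto simp: S_def)
  have cS: "card S \<le> l" "0 < card S" using v S0 finS by (auto simp: S_def l0_norm_def card_gt_0_iff)
  have N: "0 < l\<^sup>2" using l by simp
  have v1: "\<bar>v j\<bar> \<le> 1" if "j < p" for j
  proof -
    have "\<bar>v j\<bar> \<le> L2_set (\<lambda>j. \<bar>v j\<bar>) {..<p}" using that by (intro member_le_L2_set) auto
    also have "\<dots> = L2_set v {..<p}" by (simp add: L2_set_def)
    finally show ?thesis using v(1) by linarith
  qed
  have "\<exists>i. i \<in> {- int (l\<^sup>2)..int (l\<^sup>2)} \<and> \<bar>v j - of_int i / real (l\<^sup>2)\<bar> \<le> 1 / real (l\<^sup>2) \<and> \<bar>of_int i / real (l\<^sup>2)\<bar> \<le> \<bar>v j\<bar>"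
    if j: "j < p" for j
    by (rule round_toward_zero[OF v1[OF j] N]) blast
  then obtain r where r: "\<And>j. j < p \<Longrightarrow> r j \<in> {- int (l\<^sup>2)..int (l\<^sup>2)}"
     "\<And>j. j < p \<Longrightarrow> \<bar>v j - of_int (r j) / real (l\<^sup>2)\<bar> \<le> 1 / real (l\<^sup>2)"
     "\<And>j. j < p \<Longrightarrow> \<bar>of_int (r j) / real (l\<^sup>2)\<bar> \<le> \<bar>v j\<bar>" by metis
  define u where "u j = real_of_int (r j) / real (l\<^sup>2)" for j
  obtain g where g: "bij_betw g {0..<card S} S" using ex_bij_betw_nat_finite[OF finS] by blast
  \<comment> \<open>Pads the enumeration of the support to length \<open>l\<close> by repeating its
    last element, which exists because \<open>v\<close> has a nonzero coordinate.\<close>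
  define g' where "g' i = g (min i (card S - 1))" for i
  have g'S: "g' i \<in> S" for i
    unfolding g'_def using cS by (intro bij_betwE[OF g, rule_format]) auto
  have g'img: "g' ` {..<l} = S"
  proof
    show "S \<subseteq> g' ` {..<l}"
    proof
      fix j assume "j \<in> S"
      then have "j \<in> g ` {0..<card S}" using g by (simp add: bij_betw_def)
      then obtain i where "i < card S" "j = g i" by auto
      then have "j = g' i" "i < l" using cS by (auto simp: g'_def min_def)
      then show "j \<in> g' ` {..<l}" by blast
    qed
  qed (use g'S in blast)
  define f where "f = (\<lambda>i\<in>{..<l}. (g' i, u (g' i)))"
  have supp: "code_support l f = S" using g'img by (auto simp: code_support_def f_def)
  have cv: "code_vec l f j = (if j \<in> S then u j else 0)" for j
  proof (cases "j \<in> S")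
    case True
    then have "\<exists>i. i < l \<and> fst (f i) = j" using g'img by (auto simp: f_def)
    from someI_ex[OF this] have i: "(SOME i. i < l \<and> fst (f i) = j) < l"
      "fst (f (SOME i. i < l \<and> fst (f i) = j)) = j" by blast+
    have "snd (f i) = u (fst (f i))" if "i < l" for i using that by (simp add: f_def)
    from this[OF i(1)] show ?thesis using True by (simp add: code_vec_def supp i(2))
  qed (simp add: code_vec_def supp)
  have u0: "\<bar>u j\<bar> \<le> \<bar>v j\<bar>" if "j < p" for j using r(3)[OF that] by (simp add: u_def)
  have "(\<Sum>j<p. (code_vec l f j)\<^sup>2) \<le> (\<Sum>j<p. (v j)\<^sup>2)"
    using u0 by (intro sum_mono) (auto simp: cv abs_le_square_iff)
  then have "L2_set (code_vec l f) {..<p} \<le> L2_set v {..<p}" by (simp add: L2_set_def)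
  then have "f \<in> codes p l" unfolding codes_def f_def
    using v(1) g'S r(1) by (auto simp: grid_values_def u_def S_def f_def)
  moreover have "\<bar>v j - code_vec l f j\<bar> \<le> 1 / (real l)\<^sup>2" if "j < p" for j
    using r(2)[OF that] that by (auto simp: cv S_def u_def)
  ultimately show thesis by (rule that) (auto simp: supp S_def)
qed

text \<open>One family of disjoint blocks, used for phase one as well as for each batch of phase
  two. \<open>t\<close> is the tolerated signal deviation per unit of error, \<open>\<tau>\<close>
  the tolerated noise, and \<open>y ^ 6\<close> the failure probability of a block demanded by
  \<open>block_vote\<close>.\<close>

locale mom_blocks = heavy_tailed_model +
  fixes J :: "nat set" and B :: "nat \<Rightarrow> nat set" and K :: nat and t \<tau> y :: real
  assumes J: "finite J" "J \<noteq> {}" and B: "\<And>k. k < K \<Longrightarrow> B k \<subseteq> J" "\<And>k. k < K \<Longrightarrow> B k \<noteq> {}"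
    and disj: "disjoint_family_on B {..<K}"
    and t: "0 < t" and \<tau>: "0 < \<tau>" and y: "0 \<le> y" "y \<le> 1"
    and sig_small: "\<And>k. k < K \<Longrightarrow> 120 * Mx / (real (card (B k)) powr lam * t powr (1 + lam)) \<le> y ^ 6"
    and noise_small: "\<And>k. k < K \<Longrightarrow> 6 * Meff / (real (card (B k)) powr \<delta> * \<tau> powr (1 + \<delta>)) \<le> y ^ 6"
begin

definition vote :: "(nat \<Rightarrow> (nat \<Rightarrow> obs) \<Rightarrow> real) \<Rightarrow> real \<Rightarrow> (nat \<Rightarrow> obs) set" where
  "vote D a = {z \<in> space (iid J P). K \<le> 6 * card {k. k < K \<and> D k z > a}}"

lemma finB: "k < K \<Longrightarrow> finite (B k)"
  by (rule finite_subset[OF B(1) J(1)])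

text \<open>Each statistic reads only its own block, so its exceedance is an event on the product
  space of that block, and the vote of independent blocks applies.\<close>

lemma vote:
  assumes m: "\<And>k. k < K \<Longrightarrow> D k \<in> borel_measurable (iid (B k) P)"
    and restr: "\<And>k z. k < K \<Longrightarrow> D k (restrict z (B k)) = D k z"
    and q: "\<And>k. k < K \<Longrightarrow> measure (iid (B k) P) {z \<in> space (iid (B k) P). D k z > a} \<le> y ^ 6"
  shows "vote D a \<in> sets (iid J P)" "measure (iid J P) (vote D a) \<le> (2 * y) ^ K"
proof -
  define A where "A k = {z \<in> space (iid (B k) P). D k z > a}" for k
  have A: "A k \<in> sets (iid (B k) P)" if "k < K" for k
    unfolding A_def using m[OF that] by measurable
  have in_A: "restrict z (B k) \<in> A k \<longleftrightarrow> D k z > a" if "z \<in> space (iid J P)" "k < K" for z k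
    using measurable_space[OF measurable_restrict_subset[OF B(1)[OF that(2)]] that(1)]
    by (simp add: A_def restr[OF that(2)])
  have eq: "vote D a = {z \<in> space (iid J P). K \<le> 6 * card {k. k < K \<and> restrict z (B k) \<in> A k}}"
    unfolding vote_def using in_A by (auto cong: conj_cong)
  have q': "measure (iid (B k) P) (A k) \<le> y ^ 6" if "k < K" for k
    using q[OF that] by (simp add: A_def)
  show "vote D a \<in> sets (iid J P)"
    unfolding eq by (rule block_vote(1)[OF prob_space_axioms J B(1) disj A q' y])
  show "measure (iid J P) (vote D a) \<le> (2 * y) ^ K"
    unfolding eq by (rule block_vote(2)[OF prob_space_axioms J B(1) disj A q' y])
qed

lemma vote_signal:
  assumes "j < p" "L2_set v {..<p} \<le> 1" "l0_norm p v \<le> l"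
  shows "vote (\<lambda>k z. \<bar>sig_dev (B k) z j v\<bar>) t \<in> sets (iid J P)"
    "measure (iid J P) (vote (\<lambda>k z. \<bar>sig_dev (B k) z j v\<bar>) t) \<le> (2 * y) ^ K"
proof -
  have m: "(\<lambda>z. \<bar>sig_dev (B k) z j v\<bar>) \<in> borel_measurable (iid (B k) P)" for k
    using measurable_sig_dev[OF assms(1)] by measurable
  have q: "measure (iid (B k) P) {z \<in> space (iid (B k) P). \<bar>sig_dev (B k) z j v\<bar> > t} \<le> y ^ 6"
    if k: "k < K" for k
    using sig_dev_tail[OF assms finB[OF k] B(2)[OF k] t] sig_small[OF k] by simp
  show "vote (\<lambda>k z. \<bar>sig_dev (B k) z j v\<bar>) t \<in> sets (iid J P)"
    "measure (iid J P) (vote (\<lambda>k z. \<bar>sig_dev (B k) z j v\<bar>) t) \<le> (2 * y) ^ K"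
    by (rule vote[OF m _ q]; simp add: sig_dev_restrict)+
qed

lemma vote_noise:
  assumes "j < p"
  shows "vote (\<lambda>k z. \<bar>noise_mean (B k) z j\<bar>) \<tau> \<in> sets (iid J P)"
    "measure (iid J P) (vote (\<lambda>k z. \<bar>noise_mean (B k) z j\<bar>) \<tau>) \<le> (2 * y) ^ K"
proof -
  have m: "(\<lambda>z. \<bar>noise_mean (B k) z j\<bar>) \<in> borel_measurable (iid (B k) P)" for k
    using measurable_noise_mean[OF assms(1)] by measurable
  have q: "measure (iid (B k) P) {z \<in> space (iid (B k) P). \<bar>noise_mean (B k) z j\<bar> > \<tau>} \<le> y ^ 6"
    if k: "k < K" for k
    using noise_mean_tail[OF assms finB[OF k] B(2)[OF k] \<tau>] noise_small[OF k] by simp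
  show "vote (\<lambda>k z. \<bar>noise_mean (B k) z j\<bar>) \<tau> \<in> sets (iid J P)"
    "measure (iid J P) (vote (\<lambda>k z. \<bar>noise_mean (B k) z j\<bar>) \<tau>) \<le> (2 * y) ^ K"
    by (rule vote[OF m _ q]; simp add: noise_mean_restrict)+
qed

text \<open>The mesh \<open>1 / l\<^sup>2\<close> of the grid is so fine that each of the at most \<open>l\<close> summands may be as
  large as \<open>l * t\<close>, which gains the factor \<open>l\<close> lost in the union bound over \<open>S\<close>.\<close>

lemma vote_residual:
  assumes j: "j < p" and S: "S \<subseteq> {..<p}" "card S \<le> l"
  shows "vote (\<lambda>k z. \<Sum>m\<in>S. \<bar>sig_dev (B k) z j (unit_vec m)\<bar>) ((real l)\<^sup>2 * t) \<in> sets (iid J P)"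
    "measure (iid J P) (vote (\<lambda>k z. \<Sum>m\<in>S. \<bar>sig_dev (B k) z j (unit_vec m)\<bar>) ((real l)\<^sup>2 * t)) \<le> (2 * y) ^ K"
proof -
  have finS: "finite S" by (rule finite_subset[OF S(1)]) simp
  have l0: "0 < real l" using l1 by simp
  have m: "(\<lambda>z. \<Sum>m\<in>S. \<bar>sig_dev (B k) z j (unit_vec m)\<bar>) \<in> borel_measurable (iid (B k) P)" for k
    using measurable_sig_dev[OF j] by measurable
  have q: "measure (iid (B k) P) {z \<in> space (iid (B k) P).
        (\<Sum>m\<in>S. \<bar>sig_dev (B k) z j (unit_vec m)\<bar>) > (real l)\<^sup>2 * t} \<le> y ^ 6" (is "measure ?M ?E \<le> _")
    if k: "k < K" for k
  proof -
    interpret M: prob_space ?M by (intro prob_space_PiM prob_space_axioms)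
    define F where "F m = {z \<in> space ?M. \<bar>sig_dev (B k) z j (unit_vec m)\<bar> > real l * t}" for m
    define Q where "Q = real (card (B k)) powr lam * t powr (1 + lam)"
    have Q0: "0 < Q" unfolding Q_def using t B(2)[OF k] finB[OF k] by (simp add: card_gt_0_iff)
    have Fm: "F m \<in> sets ?M" for m unfolding F_def using measurable_sig_dev[OF j] by measurable
    have sub: "?E \<subseteq> (\<Union>m\<in>S. F m)"
    proof
      fix z assume z: "z \<in> ?E"
      show "z \<in> (\<Union>m\<in>S. F m)"
      proof (rule ccontr)
        assume "z \<notin> (\<Union>m\<in>S. F m)"
        then have "(\<Sum>m\<in>S. \<bar>sig_dev (B k) z j (unit_vec m)\<bar>) \<le> (\<Sum>m\<in>S. real l * t)"
          using z by (intro sum_mono) (auto simp: F_def not_less)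
        also have "\<dots> = real (card S) * (real l * t)" by simp
        also have "\<dots> \<le> real l * (real l * t)" using S t l0 by (intro mult_right_mono) auto
        finally show False using z by (simp add: power2_eq_square mult.assoc)
      qed
    qed
    have "M.prob ?E \<le> M.prob (\<Union>m\<in>S. F m)" using sub Fm finS by (intro M.finite_measure_mono) auto
    also have "\<dots> \<le> (\<Sum>m\<in>S. M.prob (F m))"
      using Fm finS by (intro M.finite_measure_subadditive_finite) auto
    also have "\<dots> \<le> (\<Sum>m\<in>S. 120 * Mx / (Q * real l))"
    proof (rule sum_mono)
      fix m assume "m \<in> S"
      then have m: "m < p" using S by auto
      have "M.prob (F m) \<le> 120 * Mx / (real (card (B k)) powr lam * (real l * t) powr (1 + lam))"
        unfolding F_def using unit_vec[OF m] l1 t l0 finB[OF k] B(2)[OF k] by (intro sig_dev_tail j) auto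
      also have "\<dots> \<le> 120 * Mx / (Q * real l)"
      proof (intro divide_left_mono)
        have "real l powr 1 \<le> real l powr (1 + lam)" using l1 lam by (intro powr_mono) auto
        then have "Q * real l \<le> Q * real l powr (1 + lam)" using Q0 by simp
        then show "Q * real l \<le> real (card (B k)) powr lam * (real l * t) powr (1 + lam)"
          by (simp add: Q_def powr_mult mult_ac)
        then show "0 < real (card (B k)) powr lam * (real l * t) powr (1 + lam) * (Q * real l)"
          using Q0 l0 by (smt (verit) mult_pos_pos)
      qed (use Mx_nonneg in auto)
      finally show "M.prob (F m) \<le> 120 * Mx / (Q * real l)" .
    qed
    also have "\<dots> = real (card S) * (120 * Mx / (Q * real l))" by simp
    also have "\<dots> \<le> real l * (120 * Mx / (Q * real l))"
      using S Q0 Mx_nonneg by (intro mult_right_mono) auto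
    also have "\<dots> = 120 * Mx / Q" using l0 by simp
    also have "\<dots> \<le> y ^ 6" using sig_small[OF k] by (simp add: Q_def)
    finally show ?thesis .
  qed
  show "vote (\<lambda>k z. \<Sum>m\<in>S. \<bar>sig_dev (B k) z j (unit_vec m)\<bar>) ((real l)\<^sup>2 * t) \<in> sets (iid J P)"
    "measure (iid J P) (vote (\<lambda>k z. \<Sum>m\<in>S. \<bar>sig_dev (B k) z j (unit_vec m)\<bar>) ((real l)\<^sup>2 * t)) \<le> (2 * y) ^ K"
    by (rule vote[OF m _ q]; simp add: sig_dev_restrict)+
qed

lemma not_vote:
  assumes "z \<in> space (iid J P)" "z \<notin> vote D a"
  shows "6 * card {k. k < K \<and> D k z > a} < K"
  using assms by (auto simp: vote_def)

lemma normalized_direction: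
  assumes "0 < l2_dist p \<theta> \<theta>s" "l0_norm p (\<lambda>k. \<theta> k - \<theta>s k) \<le> l"
  defines "v \<equiv> \<lambda>k. (\<theta> k - \<theta>s k) / l2_dist p \<theta> \<theta>s"
  shows "L2_set v {..<p} \<le> 1" "l0_norm p v \<le> l" "\<exists>j<p. v j \<noteq> 0"
    "sig_dev A z j (\<lambda>k. \<theta> k - \<theta>s k) = l2_dist p \<theta> \<theta>s * sig_dev A z j v"
proof -
  define R where "R = l2_dist p \<theta> \<theta>s"
  have R: "0 < R" using assms by (simp add: R_def)
  have "L2_set v {..<p} = L2_set (\<lambda>k. \<theta> k - \<theta>s k) {..<p} * (1 / R)"
    using L2_set_left_distrib[of "1 / R" "\<lambda>k. \<theta> k - \<theta>s k" "{..<p}"] R by (simp add: v_def R_def)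
  then have n1: "L2_set v {..<p} = 1" using R by (simp add: R_def l2_dist_def)
  then show "L2_set v {..<p} \<le> 1" by simp
  show "l0_norm p v \<le> l" using assms(2) R by (simp add: l0_norm_def v_def R_def)
  show "\<exists>j<p. v j \<noteq> 0"
  proof (rule ccontr)
    assume "\<not> ?thesis"
    then have "L2_set v {..<p} = 0" by (simp add: L2_set_eq_0_iff)
    then show False using n1 by simp
  qed
  have "(\<lambda>k. \<theta> k - \<theta>s k) = (\<lambda>k. R * v k)" using R by (auto simp: v_def R_def)
  then show "sig_dev A z j (\<lambda>k. \<theta> k - \<theta>s k) = l2_dist p \<theta> \<theta>s * sig_dev A z j v"
    by (simp add: sig_dev_scale R_def)
qed

text \<open>A vanishing error has no direction to normalize and is treated apart.\<close>

lemma sig_dev_zero: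
  assumes "\<not> 0 < l2_dist p \<theta> \<theta>s"
  shows "sig_dev A z j (\<lambda>k. \<theta> k - \<theta>s k) = 0"
proof -
  have "l2_dist p \<theta> \<theta>s = 0" using assms L2_set_nonneg[of "\<lambda>k. \<theta> k - \<theta>s k" "{..<p}"] unfolding l2_dist_def by linarith
  then have "\<theta> k - \<theta>s k = 0" if "k < p" for k using that by (simp add: l2_dist_def L2_set_eq_0_iff)
  then show ?thesis by (subst sig_dev_linear) simp
qed

text \<open>For one parameter there is a single direction, so each coordinate has two ways to fail,
  by signal or by noise. The tolerance \<open>2 * t\<close> is that of the uniform bound, so that
  both phases feed the same contraction lemma.\<close>

lemma pointwise_gradient_bound:
  assumes \<theta>: "l0_norm p (\<lambda>k. \<theta> k - \<theta>s k) \<le> l"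
  shows "measure (iid J P) {z \<in> space (iid J P).
      \<exists>j<p. \<bar>grad_dev K B z \<theta> j\<bar> > 2 * t * l2_dist p \<theta> \<theta>s + \<tau>}
    \<le> real p * (2 * (2 * y) ^ K)"
proof -
  let ?M = "iid J P"
  interpret M: prob_space ?M by (intro prob_space_PiM prob_space_axioms)
  define R where "R = l2_dist p \<theta> \<theta>s"
  define v where "v = (if 0 < R then \<lambda>k. (\<theta> k - \<theta>s k) / R else (\<lambda>k. 0))"
  have v: "L2_set v {..<p} \<le> 1" "l0_norm p v \<le> l"
    using normalized_direction[OF _ \<theta>] by (auto simp: v_def R_def L2_set_def l0_norm_def)
  have R0: "0 \<le> R" by (simp add: R_def l2_dist_def)
  have sv: "sig_dev A z j (\<lambda>k. \<theta> k - \<theta>s k) = R * sig_dev A z j v" for A z j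
  proof (cases "0 < R")
    case True
    then show ?thesis using normalized_direction(4)[OF _ \<theta>] by (simp add: v_def R_def)
  next
    case False
    then show ?thesis using sig_dev_zero[of \<theta>] R0 by (simp add: R_def)
  qed
  define X where "X j = vote (\<lambda>k z. \<bar>sig_dev (B k) z j v\<bar>) t" for j
  define N where "N j = vote (\<lambda>k z. \<bar>noise_mean (B k) z j\<bar>) \<tau>" for j
  have Xm: "X j \<in> sets ?M" "M.prob (X j) \<le> (2 * y) ^ K" if "j < p" for j
    unfolding X_def using vote_signal[OF that v] by auto
  have Nm: "N j \<in> sets ?M" "M.prob (N j) \<le> (2 * y) ^ K" if "j < p" for j
    unfolding N_def using vote_noise[OF that] by auto
  have sub: "{z \<in> space ?M. \<exists>j<p. \<bar>grad_dev K B z \<theta> j\<bar> > 2 * t * R + \<tau>}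
      \<subseteq> (\<Union>j<p. X j \<union> N j)"
  proof
    fix z assume "z \<in> {z \<in> space ?M. \<exists>j<p. \<bar>grad_dev K B z \<theta> j\<bar> > 2 * t * R + \<tau>}"
    then obtain j where z: "z \<in> space ?M" and j: "j < p"
      and big: "\<bar>grad_dev K B z \<theta> j\<bar> > 2 * t * R + \<tau>" by auto
    have "z \<in> X j \<union> N j"
    proof (rule ccontr)
      assume n: "z \<notin> X j \<union> N j"
      let ?G = "{k. k < K \<and> \<bar>sig_dev (B k) z j v\<bar> > t}"
      have 1: "6 * card ?G < K" using n not_vote[OF z, of "\<lambda>k z. \<bar>sig_dev (B k) z j v\<bar>" t] by (simp add: X_def)
      have "\<bar>grad_dev K B z \<theta> j\<bar> \<le> R * t + \<tau>"
      proof (rule mom_grad_close[of ?G])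
        show "6 * card ?G < 2 * K" using 1 by simp
        show "6 * card {k. k < K \<and> \<bar>noise_mean (B k) z j\<bar> > \<tau>} < K"
          using n not_vote[OF z, of "\<lambda>k z. \<bar>noise_mean (B k) z j\<bar>" \<tau>] by (simp add: N_def)
        fix k assume "k < K" "k \<notin> ?G"
        then have "R * \<bar>sig_dev (B k) z j v\<bar> \<le> R * t" using R0 by (intro mult_left_mono) auto
        then show "\<bar>sig_dev (B k) z j (\<lambda>m. \<theta> m - \<theta>s m)\<bar> \<le> R * t"
          using R0 by (simp add: sv abs_mult)
      qed simp
      moreover have "0 \<le> R * t" using R0 t by simp
      ultimately show False using big by (simp add: mult.commute)
    qed
    with j show "z \<in> (\<Union>j<p. X j \<union> N j)" by (intro UN_I[of j]) simp_all
  qed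
  have "M.prob {z \<in> space ?M. \<exists>j<p. \<bar>grad_dev K B z \<theta> j\<bar> > 2 * t * R + \<tau>}
      \<le> M.prob (\<Union>j<p. X j \<union> N j)"
    using sub Xm Nm by (intro M.finite_measure_mono) auto
  also have "\<dots> \<le> (\<Sum>j<p. M.prob (X j \<union> N j))"
    using Xm Nm by (intro M.finite_measure_subadditive_finite) auto
  also have "\<dots> \<le> (\<Sum>j<p. 2 * (2 * y) ^ K)"
  proof (rule sum_mono)
    fix j assume "j \<in> {..<p}"
    then have j: "j < p" by simp
    show "M.prob (X j \<union> N j) \<le> 2 * (2 * y) ^ K"
      using measure_Un_le[OF Xm(1)[OF j] Nm(1)[OF j]] Xm(2)[OF j] Nm(2)[OF j] by simp
  qed
  finally show ?thesis by (simp add: R_def)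
qed

text \<open>The exceptional set is a union over coordinates and codes and does not depend on the
  parameter. A direction is a grid vector plus a rounding error; off the exceptional set each
  contributes at most \<open>t\<close> in all but fewer than a sixth of the blocks.\<close>

lemma uniform_gradient_bound:
  obtains E where "E \<in> sets (iid J P)"
    "measure (iid J P) E \<le> real p * real ((p * (2 * l\<^sup>2 + 1)) ^ l) * (3 * (2 * y) ^ K)"
    "\<And>z \<theta> j. z \<in> space (iid J P) \<Longrightarrow> z \<notin> E \<Longrightarrow> l0_norm p (\<lambda>k. \<theta> k - \<theta>s k) \<le> l \<Longrightarrow> j < p \<Longrightarrow>
       \<bar>grad_dev K B z \<theta> j\<bar> \<le> 2 * t * l2_dist p \<theta> \<theta>s + \<tau>"
proof -
  let ?M = "iid J P"
  interpret M: prob_space ?M by (intro prob_space_PiM prob_space_axioms)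
  define X where "X j f = vote (\<lambda>k z. \<bar>sig_dev (B k) z j (code_vec l f)\<bar>) t" for j f
  define N where "N j = vote (\<lambda>k z. \<bar>noise_mean (B k) z j\<bar>) \<tau>" for j
  define W where "W j f = vote (\<lambda>k z. \<Sum>m\<in>code_support l f. \<bar>sig_dev (B k) z j (unit_vec m)\<bar>) ((real l)\<^sup>2 * t)" for j f
  define I where "I = {..<p} \<times> codes p l"
  define E where "E = (\<Union>i\<in>I. X (fst i) (snd i) \<union> W (fst i) (snd i) \<union> N (fst i))"
  have ms: "X (fst i) (snd i) \<in> sets ?M" "W (fst i) (snd i) \<in> sets ?M" "N (fst i) \<in> sets ?M"
    "M.prob (X (fst i) (snd i)) \<le> (2 * y) ^ K" "M.prob (W (fst i) (snd i)) \<le> (2 * y) ^ K" "M.prob (N (fst i)) \<le> (2 * y) ^ K"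
    if "i \<in> I" for i
  proof -
    have j: "fst i < p" and f: "snd i \<in> codes p l" using that by (auto simp: I_def)
    have f1: "L2_set (code_vec l (snd i)) {..<p} \<le> 1" using f by (simp add: codes_def)
    show "X (fst i) (snd i) \<in> sets ?M" "M.prob (X (fst i) (snd i)) \<le> (2 * y) ^ K"
      unfolding X_def by (rule vote_signal[OF j f1 l0_code_vec[OF f]])+
    show "W (fst i) (snd i) \<in> sets ?M" "M.prob (W (fst i) (snd i)) \<le> (2 * y) ^ K"
      unfolding W_def by (rule vote_residual[OF j code_support(1,2)[OF f]])+
    show "N (fst i) \<in> sets ?M" "M.prob (N (fst i)) \<le> (2 * y) ^ K"
      unfolding N_def by (rule vote_noise[OF j])+
  qed
  have finI: "finite I" using card_codes by (simp add: I_def)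
  have cI: "real (card I) \<le> real p * real ((p * (2 * l\<^sup>2 + 1)) ^ l)"
    unfolding I_def card_cartesian_product using card_codes(2)[of p l]
    by (simp only: card_lessThan of_nat_mult[symmetric] of_nat_le_iff) (intro mult_left_mono; simp)
  have Em: "E \<in> sets ?M" unfolding E_def using finI ms by (intro sets.finite_UN sets.Un) auto
  have "M.prob E \<le> (\<Sum>i\<in>I. M.prob (X (fst i) (snd i) \<union> W (fst i) (snd i) \<union> N (fst i)))"
    unfolding E_def using finI ms by (intro M.finite_measure_subadditive_finite) auto
  also have "\<dots> \<le> (\<Sum>i\<in>I. 3 * (2 * y) ^ K)"
  proof (rule sum_mono)
    fix i assume i: "i \<in> I"
    have "M.prob (X (fst i) (snd i) \<union> W (fst i) (snd i) \<union> N (fst i)) \<le> M.prob (X (fst i) (snd i) \<union> W (fst i) (snd i)) + M.prob (N (fst i))"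
      using ms[OF i] by (intro measure_Un_le) auto
    moreover have "M.prob (X (fst i) (snd i) \<union> W (fst i) (snd i)) \<le> M.prob (X (fst i) (snd i)) + M.prob (W (fst i) (snd i))"
      using ms[OF i] by (intro measure_Un_le) auto
    ultimately show "M.prob (X (fst i) (snd i) \<union> W (fst i) (snd i) \<union> N (fst i)) \<le> 3 * (2 * y) ^ K"
      using ms[OF i] by linarith
  qed
  also have "\<dots> = real (card I) * (3 * (2 * y) ^ K)" by simp
  also have "\<dots> \<le> real p * real ((p * (2 * l\<^sup>2 + 1)) ^ l) * (3 * (2 * y) ^ K)"
    using cI y by (intro mult_right_mono) auto
  finally have Ep: "M.prob E \<le> real p * real ((p * (2 * l\<^sup>2 + 1)) ^ l) * (3 * (2 * y) ^ K)" .
  have "\<bar>grad_dev K B z \<theta> j\<bar> \<le> 2 * t * l2_dist p \<theta> \<theta>s + \<tau>"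
    if z: "z \<in> space ?M" "z \<notin> E" and \<theta>: "l0_norm p (\<lambda>k. \<theta> k - \<theta>s k) \<le> l" and j: "j < p" for z \<theta> j
  proof -
    define R where "R = l2_dist p \<theta> \<theta>s"
    have R0: "0 \<le> R" by (simp add: R_def l2_dist_def)
    have "\<exists>f G. f \<in> codes p l \<and> finite G \<and> (z \<notin> X j f \<longrightarrow> z \<notin> W j f \<longrightarrow> 6 * card G < 2 * K) \<and>
        (\<forall>k<K. k \<notin> G \<longrightarrow> \<bar>sig_dev (B k) z j (\<lambda>m. \<theta> m - \<theta>s m)\<bar> \<le> 2 * t * R)"
    proof (cases "0 < R")
      case True
      define v where "v = (\<lambda>k. (\<theta> k - \<theta>s k) / R)"
      have v: "L2_set v {..<p} \<le> 1" "l0_norm p v \<le> l" "\<exists>j<p. v j \<noteq> 0"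
        "\<And>A. sig_dev A z j (\<lambda>k. \<theta> k - \<theta>s k) = R * sig_dev A z j v"
        using normalized_direction[OF _ \<theta>] True by (auto simp: v_def R_def)
      have l0: "0 < l" using l1 by simp
      obtain f where f: "f \<in> codes p l" "\<And>j. j < p \<Longrightarrow> \<bar>v j - code_vec l f j\<bar> \<le> 1 / (real l)\<^sup>2"
        "\<And>j. j < p \<Longrightarrow> j \<notin> code_support l f \<Longrightarrow> v j = 0"
        by (rule codes_dense[OF v(1,2) l0 v(3)], rule that)
      let ?S = "code_support l f" and ?u = "code_vec l f"
      let ?G1 = "{k. k < K \<and> \<bar>sig_dev (B k) z j ?u\<bar> > t}"
      let ?G2 = "{k. k < K \<and> (\<Sum>m\<in>?S. \<bar>sig_dev (B k) z j (unit_vec m)\<bar>) > (real l)\<^sup>2 * t}"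
      have "\<bar>sig_dev (B k) z j (\<lambda>m. \<theta> m - \<theta>s m)\<bar> \<le> 2 * t * R" if k: "k < K" "k \<notin> ?G1 \<union> ?G2" for k
      proof -
        have "sig_dev (B k) z j v - sig_dev (B k) z j ?u = (\<Sum>m<p. (v m - ?u m) * sig_dev (B k) z j (unit_vec m))"
          by (subst (1 2) sig_dev_linear) (simp add: left_diff_distrib sum_subtractf)
        \<comment> \<open>Both vectors vanish off the code support, so at most \<open>l\<close>
          coordinates contribute, each with weight at most the mesh of the grid.\<close>
        also have "\<dots> = (\<Sum>m\<in>?S. (v m - ?u m) * sig_dev (B k) z j (unit_vec m))"
          using code_support[OF f(1)] f(3) by (intro sum.mono_neutral_right) (auto simp: code_vec_def)
        finally have "\<bar>sig_dev (B k) z j v - sig_dev (B k) z j ?u\<bar> \<le> (\<Sum>m\<in>?S. \<bar>(v m - ?u m) * sig_dev (B k) z j (unit_vec m)\<bar>)"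
          by (simp add: sum_abs)
        also have "\<dots> \<le> (\<Sum>m\<in>?S. 1 / (real l)\<^sup>2 * \<bar>sig_dev (B k) z j (unit_vec m)\<bar>)"
          unfolding abs_mult using code_support[OF f(1)] f(2) by (intro sum_mono mult_right_mono) auto
        also have "\<dots> = 1 / (real l)\<^sup>2 * (\<Sum>m\<in>?S. \<bar>sig_dev (B k) z j (unit_vec m)\<bar>)" by (simp only: sum_distrib_left)
        also have "\<dots> \<le> 1 / (real l)\<^sup>2 * ((real l)\<^sup>2 * t)"
          using k by (intro mult_left_mono) auto
        also have "\<dots> = t" using l0 by simp
        finally have "\<bar>sig_dev (B k) z j v - sig_dev (B k) z j ?u\<bar> \<le> t" .
        moreover have "\<bar>sig_dev (B k) z j ?u\<bar> \<le> t" using k by auto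
        ultimately have "\<bar>sig_dev (B k) z j v\<bar> \<le> 2 * t" by linarith
        then have "R * \<bar>sig_dev (B k) z j v\<bar> \<le> R * (2 * t)" using R0 by (rule mult_left_mono)
        then show ?thesis using R0 by (simp add: v(4) abs_mult mult_ac)
      qed
      moreover have "6 * card (?G1 \<union> ?G2) < 2 * K" if "z \<notin> X j f" "z \<notin> W j f"
        using not_vote[OF z(1) that(1)[unfolded X_def]] not_vote[OF z(1) that(2)[unfolded W_def]]
          card_Un_le[of ?G1 ?G2] by linarith
      ultimately show ?thesis using f(1) by (intro exI[of _ f] exI[of _ "?G1 \<union> ?G2"]) auto
    next
      \<comment> \<open>Even without a direction some code is needed: avoiding its events yields
        \<open>0 < K\<close> and gives access to the noise event of the coordinate.\<close>
      case False
      have l0: "0 < l" using l1 by simp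
      have u: "L2_set (unit_vec 0) {..<p} \<le> 1" "l0_norm p (unit_vec 0) \<le> l" "\<exists>j<p. unit_vec 0 j \<noteq> 0"
        using p1 l1 unit_vec[of 0 p] by (auto simp: unit_vec_def)
      obtain f where "f \<in> codes p l"
        by (rule codes_dense[OF u(1,2) l0 u(3)], rule that)
      moreover have "0 < K" if "z \<notin> X j f" for f
        using not_vote[OF z(1) that[unfolded X_def]] by simp
      moreover have "sig_dev A z j (\<lambda>k. \<theta> k - \<theta>s k) = 0" for A
        using sig_dev_zero False by (simp add: R_def)
      ultimately show ?thesis using R0 t by (intro exI[of _ f] exI[of _ "{}"]) auto
    qed
    then obtain f G where fG: "f \<in> codes p l" "finite G" "z \<notin> X j f \<Longrightarrow> z \<notin> W j f \<Longrightarrow> 6 * card G < 2 * K"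
      "\<And>k. k < K \<Longrightarrow> k \<notin> G \<Longrightarrow> \<bar>sig_dev (B k) z j (\<lambda>m. \<theta> m - \<theta>s m)\<bar> \<le> 2 * t * R" by blast
    have n: "z \<notin> X j f" "z \<notin> W j f" "z \<notin> N j" using z(2) fG(1) j by (auto simp: E_def I_def)
    show ?thesis unfolding R_def[symmetric]
      using fG not_vote[OF z(1) n(3)[unfolded N_def]] n by (intro mom_grad_close[of G]) auto
  qed
  then show thesis by (rule that[OF Em Ep])
qed

end

section \<open>The two phases\<close>

lemma measurable_l2_dist:
  assumes "\<And>j. j < p \<Longrightarrow> (\<lambda>w. u w j) \<in> borel_measurable N"
  shows "(\<lambda>w. l2_dist p (u w) v) \<in> borel_measurable N"
  unfolding l2_dist_def L2_set_def using assms by measurable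

text \<open>On a fresh batch \<open>J\<close> the current iterate is independent of the data, so that Fubini reduces the
  bound to a fixed parameter.\<close>

lemma (in mom_blocks) fresh_batch_gradient_bound:
  assumes I: "finite I" "I \<inter> J = {}"
    and meas: "\<And>j. j < p \<Longrightarrow> (\<lambda>z. \<theta> z j) \<in> borel_measurable (iid (I \<union> J) P)"
    and dep: "\<And>z z'. (\<And>i. i \<in> I \<Longrightarrow> z i = z' i) \<Longrightarrow> \<theta> z = \<theta> z'"
    and sparse: "\<And>z. l0_norm p (\<lambda>k. \<theta> z k - \<theta>s k) \<le> l"
  defines "E \<equiv> {z \<in> space (iid (I \<union> J) P).
      \<exists>j<p. \<bar>grad_dev K B z (\<theta> z) j\<bar> > 2 * t * l2_dist p (\<theta> z) \<theta>s + \<tau>}"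
  shows "E \<in> sets (iid (I \<union> J) P)"
    "measure (iid (I \<union> J) P) E \<le> real p * (2 * (2 * y) ^ K)"
proof -
  let ?M = "\<lambda>A. iid A P"
  let ?c = "real p * (2 * (2 * y) ^ K)"
  interpret PS: product_sigma_finite "\<lambda>_::nat. P"
    by (simp add: product_sigma_finite_def sigma_finite_measure_axioms)
  interpret MI: prob_space "?M I" by (intro prob_space_PiM prob_space_axioms)
  interpret MJ: prob_space "?M J" by (intro prob_space_PiM prob_space_axioms)
  interpret MU: prob_space "?M (I \<union> J)" by (intro prob_space_PiM prob_space_axioms)
  have BJ: "i \<in> J" if "k < K" "i \<in> B k" for k i using B(1)[OF that(1)] that(2) by blast
  have mg: "(\<lambda>z. mom_grad p K B z (\<theta> z) j) \<in> borel_measurable (?M (I \<union> J))" if "j < p" for j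
    using BJ by (intro measurable_mom_grad meas that measurable_component_singleton) auto
  have Em: "E \<in> sets (?M (I \<union> J))"
    unfolding E_def using mg meas measurable_l2_dist[of p "\<lambda>z. \<theta> z" "?M (I \<union> J)" \<theta>s] by measurable
  show "E \<in> sets (?M (I \<union> J))" by (rule Em)
  have sect: "emeasure (?M J) ((\<lambda>y. merge I J (x, y)) -` E \<inter> space (?M J)) \<le> ennreal ?c"
    if x: "x \<in> space (?M I)" for x
  proof -
    \<comment> \<open>On the section over \<open>x\<close> the iterate is constant, while the
      gradient reads only the fresh batch.\<close>
    have \<theta>x: "\<theta> (merge I J (x, w)) = \<theta> x" for w by (rule dep) (simp add: merge_def)
    have gx: "mom_grad p K B (merge I J (x, w)) u = mom_grad p K B w u" for w u
      using BJ I by (intro mom_grad_cong) (auto simp: merge_def)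
    have sub: "(\<lambda>y. merge I J (x, y)) -` E \<inter> space (?M J) \<subseteq> {z \<in> space (?M J).
      \<exists>j<p. \<bar>mom_grad p K B z (\<theta> x) j - (\<Sum>k<p. Sigma_x P j k * (\<theta> x k - \<theta>s k))\<bar> > 2 * t * l2_dist p (\<theta> x) \<theta>s + \<tau>}"
      (is "_ \<subseteq> ?F") by (auto simp: E_def \<theta>x gx)
    have "(\<lambda>z. mom_grad p K B z (\<theta> x) j) \<in> borel_measurable (?M J)" if "j < p" for j
      using BJ by (intro measurable_mom_grad that measurable_component_singleton) auto
    then have "?F \<in> sets (?M J)" by measurable
    then have "emeasure (?M J) ((\<lambda>y. merge I J (x, y)) -` E \<inter> space (?M J)) \<le> emeasure (?M J) ?F"
      using sub by (intro emeasure_mono)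
    also have "\<dots> = ennreal (measure (?M J) ?F)" by (rule MJ.emeasure_eq_measure)
    also have "\<dots> \<le> ennreal ?c" by (intro ennreal_leI pointwise_gradient_bound sparse)
    finally show ?thesis .
  qed
  have "emeasure (?M (I \<union> J)) E
      = (\<integral>\<^sup>+ x. emeasure (?M J) ((\<lambda>y. merge I J (x, y)) -` E \<inter> space (?M J)) \<partial>?M I)"
    by (rule PS.emeasure_fold_integral[OF I(2,1) J(1) Em])
  also have "\<dots> \<le> (\<integral>\<^sup>+ x. ennreal ?c \<partial>?M I)" using sect by (intro nn_integral_mono)
  also have "\<dots> = ennreal ?c" by (simp add: MI.emeasure_space_1)
  finally show "MU.prob E \<le> ?c"
    using y by (simp add: MU.emeasure_eq_measure)
qed

text \<open>Probability is spent once on the uniform event of phase one and once on each batch.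
  Outside these events both phases are deterministic contractions, the second starting from the
  error \<open>a1\<close> left by the first.\<close>

lemma (in heavy_tailed_model) two_phase_error:
  assumes split: "ts_right_split n D1 D2 K1 B1 T2 D2b K2 B2" and K: "0 < K1" "0 < K2"
    and s: "s \<le> p" "s' < s" "2 * s + s' \<le> l" and w: "l0_norm p \<theta>s \<le> s'" and \<theta>0: "l0_norm p \<theta>0 \<le> s"
    and \<eta>0: "0 < \<eta>0" "\<eta>0 \<le> 1" and \<eta>: "\<eta> = \<kappa>m * \<eta>0 / \<kappa>p\<^sup>2" and x: "x = \<eta>0 * (\<kappa>m / \<kappa>p)\<^sup>2"
    and ratio: "(1 + 1 / (x / 2)) * real s' \<le> x / 2 * (real s - real s')"
    and t: "t = \<kappa>m / (24 * sqrt l)" and \<tau>: "0 < \<tau>1" "0 < \<tau>2" and y: "0 \<le> y" "y \<le> 1"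
    and ne1: "\<And>k. k < K1 \<Longrightarrow> B1 k \<noteq> {}"
    and sig1: "\<And>k. k < K1 \<Longrightarrow> 120 * Mx / (real (card (B1 k)) powr lam * t powr (1 + lam)) \<le> y ^ 6"
    and noi1: "\<And>k. k < K1 \<Longrightarrow> 6 * Meff / (real (card (B1 k)) powr \<delta> * \<tau>1 powr (1 + \<delta>)) \<le> y ^ 6"
    and ne2: "\<And>b k. b < T2 \<Longrightarrow> k < K2 \<Longrightarrow> B2 b k \<noteq> {}"
    and sig2: "\<And>b k. b < T2 \<Longrightarrow> k < K2 \<Longrightarrow> 120 * Mx / (real (card (B2 b k)) powr lam * t powr (1 + lam)) \<le> y ^ 6"
    and noi2: "\<And>b k. b < T2 \<Longrightarrow> k < K2 \<Longrightarrow> 6 * Meff / (real (card (B2 b k)) powr \<delta> * \<tau>2 powr (1 + \<delta>)) \<le> y ^ 6"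
    and a1: "(1 - x / 8) ^ T1 * l2_dist p \<theta>0 \<theta>s + 16 * sqrt l * \<tau>1 / \<kappa>m \<le> a1"
    and a2: "(1 - x / 8) ^ T2 * a1 + 16 * sqrt l * \<tau>2 / \<kappa>m \<le> a2"
  shows "1 - real p * real ((p * (2 * l\<^sup>2 + 1)) ^ l) * (3 * (2 * y) ^ K1) - real T2 * (real p * (2 * (2 * y) ^ K2))
    \<le> measure (sample n P) {z \<in> space (sample n P).
        l2_dist p (phase_one p s \<eta> K1 B1 T1 \<theta>0 z) \<theta>s \<le> a1 \<and>
        l2_dist p (ts_right p s \<eta> K1 B1 T1 K2 B2 T2 \<theta>0 z) \<theta>s \<le> a2}"
proof -
  let ?M = "iid {..<n} P"
  interpret M: prob_space ?M by (intro prob_space_PiM prob_space_axioms)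
  have sp: "D1 \<union> D2 = {..<n}" "D1 \<inter> D2 = {}" "disjoint_family_on B1 {..<K1}" "(\<Union>k<K1. B1 k) = D1"
    "disjoint_family_on D2b {..<T2}" "(\<Union>b<T2. D2b b) = D2"
    using split by (auto simp: ts_right_split_def near_equal_partition_def)
  have sp2: "disjoint_family_on (B2 b) {..<K2}" "(\<Union>k<K2. B2 b k) = D2b b" if "b < T2" for b
    using split that by (auto simp: ts_right_split_def near_equal_partition_def)
  have B1n: "B1 k \<subseteq> {..<n}" if "k < K1" for k using sp(1,4) that by blast
  have D2n: "D2b b \<subseteq> {..<n}" if "b < T2" for b using sp(1,6) that by blast
  have B2D: "B2 b k \<subseteq> D2b b" if "b < T2" "k < K2" for b k using sp2(2)[OF that(1)] that(2) by blast
  have t0: "0 < t" unfolding t using \<kappa> l1 by simp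
  have ne: "{..<n} \<noteq> {}" using B1n[OF K(1)] ne1[OF K(1)] by auto
  \<comment> \<open>The index set is the whole sample rather than \<open>D1\<close>, so that the
    exceptional set already lives on the space shared with phase two.\<close>
  have mb1: "mom_blocks p l \<theta>s P lam \<delta> \<kappa>m \<kappa>p {..<n} B1 K1 t \<tau>1 y"
    by (intro mom_blocks.intro heavy_tailed_model_axioms mom_blocks_axioms.intro)
      (use ne B1n ne1 sp t0 \<tau> y sig1 noi1 in auto)
  obtain E1 where E1: "E1 \<in> sets ?M"
    "measure ?M E1 \<le> real p * real ((p * (2 * l\<^sup>2 + 1)) ^ l) * (3 * (2 * y) ^ K1)"
    "\<And>z \<theta> j. z \<in> space ?M \<Longrightarrow> z \<notin> E1 \<Longrightarrow> l0_norm p (\<lambda>k. \<theta> k - \<theta>s k) \<le> l \<Longrightarrow> j < p \<Longrightarrow>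
       \<bar>grad_dev K1 B1 z \<theta> j\<bar> \<le> 2 * t * l2_dist p \<theta> \<theta>s + \<tau>1"
    by (rule mom_blocks.uniform_gradient_bound[OF mb1], rule that)
  define \<theta> where "\<theta> b z = mom_iht p s \<eta> K2 B2 z (phase_one p s \<eta> K1 B1 T1 \<theta>0 z) b" for b z
  have l0p: "l0_norm p (phase_one p s \<eta> K1 B1 T1 \<theta>0 z) \<le> s" for z
    unfolding phase_one_def by (rule l0_mom_iht[OF s(1) \<theta>0])
  have l0\<theta>: "l0_norm p (\<theta> b z) \<le> s" for b z
    unfolding \<theta>_def by (rule l0_mom_iht[OF s(1) l0p])
  have l0d: "l0_norm p (\<lambda>k. u k - \<theta>s k) \<le> l" if "l0_norm p u \<le> s" for u
    using l0_norm_diff[of p u \<theta>s] that w s by linarith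
  have co: "(\<lambda>z. z i) \<in> measurable ?M P" if "i < n" for i
    using that by (intro measurable_component_singleton) auto
  have m1: "(\<lambda>z. phase_one p s \<eta> K1 B1 T1 \<theta>0 z j) \<in> borel_measurable ?M" if "j < p" for j
    unfolding phase_one_def using B1n that by (intro measurable_mom_iht co) auto
  have m2: "(\<lambda>z. \<theta> b z j) \<in> borel_measurable ?M" if "j < p" "b \<le> T2" for j b
    unfolding \<theta>_def
  proof (intro measurable_mom_iht m1 that(1) co)
    fix b' k i assume "b' < b" "k < K2" "i \<in> B2 b' k"
    then have "i \<in> D2b b'" "b' < T2" using B2D[of b' k] that by auto
    then show "i < n" using D2n by blast
  qed
  define E where "E b = {z \<in> space ?M. \<exists>j<p. \<bar>grad_dev K2 (B2 b) z (\<theta> b z) j\<bar> > 2 * t * l2_dist p (\<theta> b z) \<theta>s + \<tau>2}" for b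
  have E: "E b \<in> sets ?M" "measure ?M (E b) \<le> real p * (2 * (2 * y) ^ K2)" if b: "b < T2" for b
  proof -
    \<comment> \<open>Everything outside the batch counts as the past, later batches included, so
      that past and batch together form the whole sample.\<close>
    define I where "I = {..<n} - D2b b"
    have un: "{..<n} = I \<union> D2b b" using D2n[OF b] by (auto simp: I_def)
    have fin: "finite (D2b b)" by (rule finite_subset[OF D2n[OF b]]) simp
    have neb: "D2b b \<noteq> {}" using B2D[OF b K(2)] ne2[OF b K(2)] by auto
    have mb2: "mom_blocks p l \<theta>s P lam \<delta> \<kappa>m \<kappa>p (D2b b) (B2 b) K2 t \<tau>2 y"
      by (intro mom_blocks.intro heavy_tailed_model_axioms mom_blocks_axioms.intro)
        (use neb fin B2D b ne2 sp2 t0 \<tau> y sig2 noi2 in auto)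
    have dep: "\<theta> b z = \<theta> b z'" if eq: "\<And>i. i \<in> I \<Longrightarrow> z i = z' i" for z z'
    proof -
      have 1: "z i = z' i" if "k < K1" "i \<in> B1 k" for k i
      proof (rule eq)
        have "i \<in> D1" using sp(4) that by blast
        moreover have "D2b b \<subseteq> D2" using sp(6) b by blast
        ultimately show "i \<in> I" using sp(1,2) by (auto simp: I_def)
      qed
      have 2: "z i = z' i" if "b' < b" "k < K2" "i \<in> B2 b' k" for b' k i
      proof (rule eq)
        have b': "b' < T2" using that b by simp
        have "i \<in> D2b b'" using B2D[OF b' that(2)] that(3) by blast
        moreover have "D2b b' \<inter> D2b b = {}" using sp(5) that(1) b b' by (auto simp: disjoint_family_on_def)
        ultimately show "i \<in> I" using D2n[OF b'] by (auto simp: I_def)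
      qed
      have "phase_one p s \<eta> K1 B1 T1 \<theta>0 z = phase_one p s \<eta> K1 B1 T1 \<theta>0 z'"
        unfolding phase_one_def using 1 by (intro mom_iht_cong) auto
      then show ?thesis unfolding \<theta>_def using mom_iht_cong[of b K2 B2 z z'] 2 by auto
    qed
    have me: "(\<lambda>z. \<theta> b z j) \<in> borel_measurable (iid (I \<union> D2b b) P)" if "j < p" for j
      using m2[of j b] that b un by simp
    have finI: "finite I" and disj: "I \<inter> D2b b = {}" by (auto simp: I_def)
    note fb = mom_blocks.fresh_batch_gradient_bound[where \<theta> = "\<theta> b", OF mb2 finI disj me dep l0d[OF l0\<theta>]]
    show "E b \<in> sets ?M" unfolding E_def un by (rule fb(1))
    show "measure ?M (E b) \<le> real p * (2 * (2 * y) ^ K2)" unfolding E_def un by (rule fb(2))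
  qed
  define Bad where "Bad = E1 \<union> (\<Union>b<T2. E b)"
  have Badm: "Bad \<in> sets ?M" unfolding Bad_def using E1(1) E(1) by auto
  have "measure ?M Bad \<le> measure ?M E1 + measure ?M (\<Union>b<T2. E b)"
    unfolding Bad_def using E1(1) E(1) by (intro measure_Un_le) auto
  also have "measure ?M (\<Union>b<T2. E b) \<le> (\<Sum>b<T2. measure ?M (E b))"
    using E(1) by (intro M.finite_measure_subadditive_finite) auto
  also have "\<dots> \<le> (\<Sum>b<T2. real p * (2 * (2 * y) ^ K2))" using E(2) by (intro sum_mono) auto
  finally have Badp: "measure ?M Bad \<le> real p * real ((p * (2 * l\<^sup>2 + 1)) ^ l) * (3 * (2 * y) ^ K1)
      + real T2 * (real p * (2 * (2 * y) ^ K2))" using E1(2) by simp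
  define Good where "Good = {z \<in> space ?M. l2_dist p (phase_one p s \<eta> K1 B1 T1 \<theta>0 z) \<theta>s \<le> a1 \<and>
        l2_dist p (ts_right p s \<eta> K1 B1 T1 K2 B2 T2 \<theta>0 z) \<theta>s \<le> a2}"
  have ts: "ts_right p s \<eta> K1 B1 T1 K2 B2 T2 \<theta>0 z = \<theta> T2 z" for z
    by (simp add: ts_right_def \<theta>_def)
  have "(\<lambda>z. l2_dist p (phase_one p s \<eta> K1 B1 T1 \<theta>0 z) \<theta>s) \<in> borel_measurable ?M"
    "(\<lambda>z. l2_dist p (\<theta> T2 z) \<theta>s) \<in> borel_measurable ?M"
    using m1 m2 by (intro measurable_l2_dist; simp)+
  then have Goodm: "Good \<in> sets ?M" unfolding Good_def ts by measurable
  have t2: "2 * t = \<kappa>m / (12 * sqrt l)" by (simp add: t)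
  have r: "0 < \<kappa>m / \<kappa>p" "\<kappa>m / \<kappa>p \<le> 1" using \<kappa> by auto
  have "(\<kappa>m / \<kappa>p)\<^sup>2 \<le> 1" using r by (intro power_le_one; linarith)
  then have "x \<le> 1" unfolding x using \<eta>0 by (intro mult_le_one) auto
  then have xT: "0 \<le> (1 - x / 8) ^ T2" by simp
  have "space ?M - Bad \<subseteq> Good"
  proof
    fix z assume z: "z \<in> space ?M - Bad"
    have g1: "\<bar>grad_dev K1 B1 z u j\<bar>
        \<le> \<kappa>m / (12 * sqrt l) * l2_dist p u \<theta>s + \<tau>1" if "l0_norm p u \<le> s" "j < p" for u j
      using E1(3)[of z u j] l0d[OF that(1)] that(2) z unfolding t2 by (simp add: Bad_def)
    have "l2_dist p (phase_one p s \<eta> K1 B1 T1 \<theta>0 z) \<theta>s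
        \<le> (1 - x / 8) ^ T1 * l2_dist p \<theta>0 \<theta>s + 16 * sqrt l * \<tau>1 / \<kappa>m"
      unfolding phase_one_def
      by (rule mom_iht_error[OF Sigma_x_commute sparse_spectrum_Sigma_x s w \<theta>0 \<kappa> \<eta>0 \<eta> x ratio])
        (use g1 l0_mom_iht[OF s(1) \<theta>0] \<tau> in auto)
    then have p1: "l2_dist p (phase_one p s \<eta> K1 B1 T1 \<theta>0 z) \<theta>s \<le> a1" using a1 by linarith
    have g2: "\<bar>grad_dev K2 (B2 b) z (\<theta> b z) j\<bar>
        \<le> \<kappa>m / (12 * sqrt l) * l2_dist p (\<theta> b z) \<theta>s + \<tau>2" if "b < T2" "j < p" for b j
    proof -
      have "z \<notin> E b" using z that by (auto simp: Bad_def)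
      then have "\<not> (\<bar>grad_dev K2 (B2 b) z (\<theta> b z) j\<bar>
          > 2 * t * l2_dist p (\<theta> b z) \<theta>s + \<tau>2)"
        using z that(2) unfolding E_def by blast
      then show ?thesis unfolding t2 by (simp only: not_less)
    qed
    have "l2_dist p (\<theta> T2 z) \<theta>s
        \<le> (1 - x / 8) ^ T2 * l2_dist p (phase_one p s \<eta> K1 B1 T1 \<theta>0 z) \<theta>s + 16 * sqrt l * \<tau>2 / \<kappa>m"
      unfolding \<theta>_def
      by (rule mom_iht_error[OF Sigma_x_commute sparse_spectrum_Sigma_x s w l0p \<kappa> \<eta>0 \<eta> x ratio])
        (use g2 \<tau> in \<open>auto simp: \<theta>_def\<close>)
    also have "(1 - x / 8) ^ T2 * l2_dist p (phase_one p s \<eta> K1 B1 T1 \<theta>0 z) \<theta>s \<le> (1 - x / 8) ^ T2 * a1"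
      by (rule mult_left_mono[OF p1 xT])
    finally have "l2_dist p (\<theta> T2 z) \<theta>s \<le> a2" using a2 by linarith
    then show "z \<in> Good" using p1 z by (simp add: Good_def ts)
  qed
  then have "measure ?M (space ?M - Bad) \<le> measure ?M Good" by (intro M.finite_measure_mono Goodm)
  moreover have "measure ?M (space ?M - Bad) = 1 - measure ?M Bad" by (rule M.prob_compl[OF Badm])
  ultimately show ?thesis using Badp by (simp add: sample_def Good_def)
qed

section \<open>Choice of the constants\<close>

lemma ln_ge_half: "2 \<le> x \<Longrightarrow> 1 / 2 \<le> ln (x :: real)"
proof -
  assume "2 \<le> x"
  then have "ln 2 \<le> ln x" by simp
  then show ?thesis using ln2_ge_two_thirds by linarith
qed

lemma near_equal_block_card:
  assumes "near_equal_partition K A B" "k < K"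
  shows "card A \<le> K * (card (B k) + 1)"
proof -
  have "card A = card (\<Union>i<K. B i)" using assms by (simp add: near_equal_partition_def)
  also have "\<dots> \<le> (\<Sum>i<K. card (B i))" by (rule card_UN_le) simp
  also have "\<dots> \<le> (\<Sum>i<K. card (B k) + 1)"
    using assms by (intro sum_mono) (auto simp: near_equal_partition_def)
  finally show ?thesis by simp
qed

text \<open>Near-equal sizes lose at most one observation against the average; when the average is
  at least two, this costs a factor two.\<close>

lemma block_card_lower:
  assumes part: "near_equal_partition K A B" "k < K" and K: "0 < Y" "real K \<le> Y"
    and A: "N \<le> real (card A)" and big: "2 \<le> N / Y"
  shows "N / (2 * Y) \<le> real (card (B k))"
proof -
  have "N \<le> real K * (real (card (B k)) + 1)"
    using near_equal_block_card[OF part] A by (metis (mono_tags) of_nat_1 of_nat_add of_nat_le_iff of_nat_mult order_trans)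
  also have "\<dots> \<le> Y * (real (card (B k)) + 1)" using K by (intro mult_right_mono) auto
  finally have "N / Y \<le> real (card (B k)) + 1" using K by (simp add: field_simps)
  then show ?thesis using big by (simp add: field_simps)
qed

text \<open>The one half in the failure level cancels the base two that comes from counting sets of
  blocks.\<close>

lemma power_exp_neg_le:
  assumes "0 \<le> L" "w \<le> real K"
  shows "(2 * (exp (- L) / 2)) ^ K \<le> exp (- (L * w))"
proof -
  have "(2 * (exp (- L) / 2)) ^ K = exp (- (L * real K))"
    by (simp add: exp_of_nat_mult[symmetric] mult.commute)
  also have "\<dots> \<le> exp (- (L * w))" using assms by (simp add: mult_left_mono)
  finally show ?thesis .
qed

text \<open>Since \<open>l \<le> 3 * p\<close>, a position with its value has at most
  \<open>p ^ 8\<close> possibilities. Grid vectors and coordinates together number at most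
  \<open>p ^ (9 * l)\<close>, and the level ten leaves one factor \<open>p ^ l\<close> to
  spare.\<close>

lemma phase_one_failure:
  assumes p: "2 \<le> p" and l: "1 \<le> l" "l \<le> 3 * p" and K: "real l * ln (real p) \<le> real K" and L: "10 \<le> L"
  shows "real p * real ((p * (2 * l\<^sup>2 + 1)) ^ l) * (3 * (2 * (exp (- L) / 2)) ^ K) \<le> 3 * exp (- (real l * ln (real p)))"
proof -
  have lnp: "0 \<le> ln (real p)" using p by simp
  have "2 * l\<^sup>2 + 1 \<le> 3 * l\<^sup>2" using l by (simp add: Suc_le_eq)
  also have "\<dots> \<le> 3 * (3 * p)\<^sup>2" using l by (intro mult_left_mono power_mono) auto
  also have "\<dots> \<le> 2 ^ 5 * p\<^sup>2" by (simp add: power_mult_distrib)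
  also have "\<dots> \<le> p ^ 5 * p\<^sup>2" using p by (intro mult_right_mono power_mono) auto
  also have "\<dots> = p ^ 7" by (simp flip: power_add)
  finally have "p * (2 * l\<^sup>2 + 1) \<le> p * p ^ 7" by (intro mult_left_mono) auto
  also have "\<dots> = p ^ 8" by (simp flip: power_Suc)
  finally have "(p * (2 * l\<^sup>2 + 1)) ^ l \<le> (p ^ 8) ^ l" by (intro power_mono) auto
  then have "p * (p * (2 * l\<^sup>2 + 1)) ^ l \<le> p ^ l * (p ^ 8) ^ l"
    using p l by (intro mult_mono self_le_power) auto
  also have "\<dots> = p ^ (9 * l)" by (simp flip: power_mult power_add)
  finally have "real (p * (p * (2 * l\<^sup>2 + 1)) ^ l) \<le> real (p ^ (9 * l))" by (simp only: of_nat_le_iff)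
  also have "\<dots> = exp (real (9 * l) * ln (real p))" using p by (simp add: exp_of_nat_mult exp_ln del: of_nat_mult)
  finally have c: "real p * real ((p * (2 * l\<^sup>2 + 1)) ^ l) \<le> exp (9 * (real l * ln (real p)))"
    by (simp add: mult.assoc)
  have "(2 * (exp (- L) / 2)) ^ K \<le> exp (- (L * (real l * ln (real p))))"
    using L K by (intro power_exp_neg_le) auto
  also have "\<dots> \<le> exp (- (10 * (real l * ln (real p))))"
    using L lnp by (simp add: mult_right_mono)
  finally have "real p * real ((p * (2 * l\<^sup>2 + 1)) ^ l) * (3 * (2 * (exp (- L) / 2)) ^ K)
      \<le> exp (9 * (real l * ln (real p))) * (3 * exp (- (10 * (real l * ln (real p)))))"
    using c by (intro mult_mono) auto
  also have "\<dots> = 3 * exp (- (real l * ln (real p)))"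
    by (simp flip: exp_add)
  finally show ?thesis .
qed

text \<open>Here \<open>\<tau>\<close> is the constant bounding the number of steps. The summand
  \<open>\<bar>\<tau>\<bar>\<close> in the level removes it from the result, because
  \<open>\<bar>\<tau>\<bar> * exp (- (\<bar>\<tau>\<bar> * ln p))\<close> is at most two. Steps and
  coordinates cost \<open>p ^ 2\<close>, far less than the ten powers gained.\<close>

lemma phase_two_failure:
  assumes s: "2 \<le> s" "s \<le> p" and T: "real T \<le> \<tau> * ln (real s)" and K: "ln (real p) \<le> real K"
  shows "real T * (real p * (2 * (2 * (exp (- (10 + \<bar>\<tau>\<bar>)) / 2)) ^ K)) \<le> 3 * real p powr - 1"
proof -
  have p: "2 \<le> real p" using s by simp
  have lnp: "0 \<le> ln (real p)" using p by simp
  have "\<tau> * ln (real s) \<le> \<bar>\<tau>\<bar> * ln (real s)"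
    using s by (intro mult_right_mono) auto
  then have "real T \<le> \<bar>\<tau>\<bar> * ln (real s)" using T by linarith
  also have "\<dots> \<le> \<bar>\<tau>\<bar> * real p"
    using s ln_le_minus_one[of "real s"] by (intro mult_left_mono) auto
  finally have 1: "real T \<le> \<bar>\<tau>\<bar> * real p" .
  have ep: "exp (ln (real p)) = real p" using p by simp
  have half: "1 / 2 \<le> ln (real p)"
    by (rule ln_ge_half[OF p])
  have "(2 * (exp (- (10 + \<bar>\<tau>\<bar>)) / 2)) ^ K \<le> exp (- ((10 + \<bar>\<tau>\<bar>) * ln (real p)))"
    using K by (intro power_exp_neg_le) auto
  also have "\<dots> = exp (- (10 * ln (real p))) * exp (- (\<bar>\<tau>\<bar> * ln (real p)))"
    by (simp add: algebra_simps flip: exp_add)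
  finally have 2: "(2 * (exp (- (10 + \<bar>\<tau>\<bar>)) / 2)) ^ K \<le> exp (- (10 * ln (real p))) * exp (- (\<bar>\<tau>\<bar> * ln (real p)))" .
  have 3: "\<bar>\<tau>\<bar> * exp (- (\<bar>\<tau>\<bar> * ln (real p))) \<le> 2"
  proof -
    have "\<bar>\<tau>\<bar> * (1 / 2) \<le> \<bar>\<tau>\<bar> * ln (real p)" using half by (intro mult_left_mono) auto
    also have "\<dots> \<le> exp (\<bar>\<tau>\<bar> * ln (real p))" using exp_ge_add_one_self[of "\<bar>\<tau>\<bar> * ln (real p)"] by linarith
    finally show ?thesis by (simp add: exp_minus field_simps)
  qed
  have "real T * (real p * (2 * (2 * (exp (- (10 + \<bar>\<tau>\<bar>)) / 2)) ^ K))
      \<le> (\<bar>\<tau>\<bar> * real p) * (real p * (2 * (exp (- (10 * ln (real p))) * exp (- (\<bar>\<tau>\<bar> * ln (real p))))))"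
    using 1 2 p by (intro mult_mono) auto
  also have "\<dots> = (\<bar>\<tau>\<bar> * exp (- (\<bar>\<tau>\<bar> * ln (real p)))) * (2 * (real p * real p * exp (- (10 * ln (real p)))))"
    by simp
  also have "\<dots> \<le> 2 * (2 * (real p * real p * exp (- (10 * ln (real p)))))"
    using 3 by (intro mult_right_mono) auto
  also have "real p * real p * exp (- (10 * ln (real p))) = exp (- (8 * ln (real p)))"
  proof -
    have "exp (ln (real p)) * exp (ln (real p)) * exp (- (10 * ln (real p))) = exp (- (8 * ln (real p)))"
      by (simp add: mult_exp_exp)
    then show ?thesis by (simp only: ep)
  qed
  finally have 4: "real T * (real p * (2 * (2 * (exp (- (10 + \<bar>\<tau>\<bar>)) / 2)) ^ K)) \<le> 2 * (2 * exp (- (8 * ln (real p))))" .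
  have "exp (- (8 * ln (real p))) \<le> exp (- (2 * ln (real p)))" using lnp by simp
  also have "\<dots> = real p powr - 1 * exp (- ln (real p))"
    using p by (simp add: powr_def flip: exp_add)
  also have "\<dots> \<le> real p powr - 1 * (1 / 2)"
  proof (rule mult_left_mono)
    have "exp (- ln (real p)) = 1 / real p" using p by (simp add: exp_minus inverse_eq_divide)
    also have "\<dots> \<le> 1 / 2" using p by (intro divide_left_mono) auto
    finally show "exp (- ln (real p)) \<le> 1 / 2" .
  qed simp
  finally have "2 * (2 * exp (- (8 * ln (real p)))) \<le> 2 * real p powr - 1" by linarith
  moreover have "0 \<le> real p powr - 1" by (rule powr_ge_zero)
  ultimately show ?thesis using 4 by linarith
qed

text \<open>The powers of \<open>l\<close> and of the moments in the sample size and in the error are exactly those that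
  make the failure probabilities of a block constant.\<close>

lemma signal_failure_le:
  fixes M m U :: real
  assumes lam: "0 < lam" and M: "0 < M" and l: "0 < l" and q: "0 < q" and \<kappa>: "0 < \<kappa>0" "\<kappa>0 \<le> \<kappa>m"
    and U: "0 < U" "120 / (q * (\<kappa>0 / 24) powr (1 + lam)) \<le> U powr lam"
    and m: "U * M powr (1 / lam) * l powr ((1 + lam) / (2 * lam)) \<le> m"
  shows "120 * M / (m powr lam * (\<kappa>m / (24 * sqrt l)) powr (1 + lam)) \<le> q"
proof -
  let ?e = "1 + lam"
  have "(U * M powr (1 / lam) * l powr (?e / (2 * lam))) powr lam \<le> m powr lam"
    using m lam U M l by (intro powr_mono2) auto
  then have 1: "U powr lam * M * l powr (?e / 2) \<le> m powr lam"
    using lam M by (simp add: powr_mult powr_powr)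
  have "(\<kappa>0 / (24 * sqrt l)) powr ?e \<le> (\<kappa>m / (24 * sqrt l)) powr ?e"
    using \<kappa> l lam by (intro powr_mono2 divide_right_mono) auto
  moreover have "\<kappa>0 / (24 * sqrt l) = (\<kappa>0 / 24) * l powr (- 1 / 2)"
    using l by (simp add: powr_minus powr_half_sqrt field_simps)
  moreover have "((\<kappa>0 / 24) * l powr (- 1 / 2)) powr ?e = (\<kappa>0 / 24) powr ?e * l powr (- ?e / 2)"
  proof -
    have "- 1 / 2 * ?e = - ?e / 2" by linarith
    then show ?thesis by (simp only: powr_mult powr_powr)
  qed
  ultimately have 2: "(\<kappa>0 / 24) powr ?e * l powr (- ?e / 2) \<le> (\<kappa>m / (24 * sqrt l)) powr ?e"
    by (simp only:)
  have "?e / 2 + - ?e / 2 = 0" by linarith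
  \<comment> \<open>The power of \<open>l\<close> in the block size exactly offsets the one in the
    tolerance.\<close>
  then have ll: "l powr (?e / 2) * l powr (- ?e / 2) = 1" using l by (simp only: powr_add[symmetric]) simp
  have pos: "0 < U powr lam * M * (\<kappa>0 / 24) powr ?e" using U M \<kappa> by simp
  have "U powr lam * M * (\<kappa>0 / 24) powr ?e
      = (U powr lam * M * l powr (?e / 2)) * ((\<kappa>0 / 24) powr ?e * l powr (- ?e / 2))"
    using ll by (simp add: mult_ac)
  also have "\<dots> \<le> m powr lam * (\<kappa>m / (24 * sqrt l)) powr ?e"
    using 1 2 by (intro mult_mono) auto
  finally have D: "U powr lam * M * (\<kappa>0 / 24) powr ?e \<le> m powr lam * (\<kappa>m / (24 * sqrt l)) powr ?e" .
  have "120 * M / (m powr lam * (\<kappa>m / (24 * sqrt l)) powr ?e) \<le> 120 * M / (U powr lam * M * (\<kappa>0 / 24) powr ?e)"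
    using D pos M by (intro divide_left_mono) (auto intro: mult_pos_pos order.strict_trans2)
  also have "\<dots> \<le> q" using U(2) U(1) M \<kappa> q by (simp add: field_simps)
  finally show ?thesis .
qed

text \<open>The error rate is found by solving for the noise tolerance at which a block of size
  \<open>c * n / X\<close> fails with probability \<open>q\<close>; the equation for
  \<open>C1\<close> is what remains once moment and sample size are taken out.\<close>

lemma noise_failure_le:
  fixes M m c X n :: real
  assumes \<delta>: "0 < \<delta>" and M: "0 < M" and q: "0 < q" and c: "0 < c" and X: "0 < X" "0 < n"
    and C1: "0 < C1" "C1 powr (1 + \<delta>) = 6 / (c powr \<delta> * q)" and m: "c * n / X \<le> m"
  shows "6 * M / (m powr \<delta> * (C1 * (M powr (1 / (1 + \<delta>)) * (X / n) powr (\<delta> / (1 + \<delta>)))) powr (1 + \<delta>)) \<le> q"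
proof -
  have e: "1 + \<delta> \<noteq> 0" using \<delta> by simp
  have t: "(C1 * (M powr (1 / (1 + \<delta>)) * (X / n) powr (\<delta> / (1 + \<delta>)))) powr (1 + \<delta>)
      = 6 / (c powr \<delta> * q) * (M * (X / n) powr \<delta>)"
    using M X C1 e by (simp add: powr_mult powr_powr)
  have pos: "0 < 6 / (c powr \<delta> * q) * (M * (X / n) powr \<delta>)" using M X c q by simp
  have cX: "0 < c * n / X" using c X by simp
  have "(c * n / X) powr \<delta> \<le> m powr \<delta>" using m cX \<delta> by (intro powr_mono2) auto
  then have "(c * n / X) powr \<delta> * (6 / (c powr \<delta> * q) * (M * (X / n) powr \<delta>))
      \<le> m powr \<delta> * (6 / (c powr \<delta> * q) * (M * (X / n) powr \<delta>))"
    using pos by (intro mult_right_mono) auto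
  moreover have "(c * n / X) powr \<delta> * (X / n) powr \<delta> = c powr \<delta>"
    using c X by (simp flip: powr_mult)
  then have "(c * n / X) powr \<delta> * (6 / (c powr \<delta> * q) * (M * (X / n) powr \<delta>)) = 6 / q * M"
    using c q by (simp add: field_simps)
  ultimately have D: "6 / q * M \<le> m powr \<delta> * (6 / (c powr \<delta> * q) * (M * (X / n) powr \<delta>))" by simp
  have D0: "0 < 6 / q * M" using M q by simp
  have "6 * M / (m powr \<delta> * (6 / (c powr \<delta> * q) * (M * (X / n) powr \<delta>))) \<le> 6 * M / (6 / q * M)"
    using M by (intro divide_left_mono[OF D _ mult_pos_pos[OF order.strict_trans2[OF D0 D] D0]]) simp
  also have "\<dots> = q" using M q by simp
  finally show ?thesis unfolding t .
qed

section \<open>Numbers of iterations\<close>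

lemma one_minus_power_le_exp:
  assumes "0 < x" "x \<le> 1" "w \<le> real T"
  shows "(1 - x / 8) ^ T \<le> exp (- (x / 8 * w))"
proof -
  have "(1 - x / 8) ^ T \<le> exp (- (x / 8)) ^ T"
    using assms exp_ge_add_one_self[of "- (x / 8)"] by (intro power_mono) auto
  also have "\<dots> = exp (- (x / 8 * real T))" by (simp add: exp_of_nat_mult[symmetric] mult.commute)
  also have "\<dots> \<le> exp (- (x / 8 * w))" using assms by (simp add: mult_left_mono)
  finally show ?thesis .
qed

text \<open>In the exponent of \<open>n\<close>, \<open>\<bar>A\<bar>\<close> cancels the growth of
  the initial error, one produces \<open>1 / n\<close>, and \<open>2 * h\<close> absorbs the
  constant \<open>h = \<bar>H\<bar> / m\<close>: as \<open>ln n \<ge> 1 / 2\<close>,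
  \<open>h * n powr (- 2 * h)\<close> is at most one.\<close>

lemma phase_one_decay:
  fixes n F :: real
  assumes x: "0 < x" "x \<le> 1" and n: "2 \<le> n" and m: "0 < m" and F: "m / n \<le> F"
    and T: "8 * (\<bar>A\<bar> + 1 + 2 * \<bar>H\<bar> / m) / x * ln n \<le> real T" and R: "R \<le> H * n powr A"
  shows "(1 - x / 8) ^ T * R \<le> F"
proof -
  define h where "h = \<bar>H\<bar> / m"
  let ?B = "\<bar>A\<bar> + 1 + 2 * h"
  have h: "0 \<le> h" "\<bar>H\<bar> = h * m" using m by (auto simp: h_def)
  have xT: "0 \<le> (1 - x / 8) ^ T" using x by simp
  have T': "8 * ?B / x * ln n \<le> real T" using T by (simp add: h_def)
  have "(1 - x / 8) ^ T \<le> exp (- (x / 8 * (8 * ?B / x * ln n)))" by (rule one_minus_power_le_exp[OF x T'])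
  also have "x / 8 * (8 * ?B / x * ln n) = ?B * ln n" using x by simp
  also have "exp (- (?B * ln n)) = n powr - ?B" using n by (simp add: powr_def algebra_simps)
  finally have 1: "(1 - x / 8) ^ T \<le> n powr - ?B" .
  have "H * n powr A \<le> \<bar>H\<bar> * n powr A" by (intro mult_right_mono) auto
  also have "\<dots> \<le> \<bar>H\<bar> * n powr \<bar>A\<bar>" using n by (intro mult_left_mono powr_mono) auto
  finally have "R \<le> \<bar>H\<bar> * n powr \<bar>A\<bar>" using R by linarith
  then have "(1 - x / 8) ^ T * R \<le> (1 - x / 8) ^ T * (\<bar>H\<bar> * n powr \<bar>A\<bar>)" using xT by (intro mult_left_mono)
  also have "\<dots> \<le> n powr - ?B * (\<bar>H\<bar> * n powr \<bar>A\<bar>)" using 1 by (intro mult_right_mono) auto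
  also have "\<dots> = \<bar>H\<bar> * (n powr - ?B * n powr \<bar>A\<bar>)" by simp
  also have "n powr - ?B * n powr \<bar>A\<bar> = n powr (- 1 + - (2 * h))" by (simp flip: powr_add)
  also have "\<dots> = n powr - (2 * h) / n" using n by (simp only: powr_add) (simp add: powr_minus_divide)
  also have "\<bar>H\<bar> * (n powr - (2 * h) / n) = (h * n powr - (2 * h)) * (m / n)" by (simp add: h)
  also have "\<dots> \<le> 1 * (m / n)"
  proof (intro mult_right_mono)
    have "1 / 2 \<le> ln n" by (rule ln_ge_half[OF n])
    then have "2 * h * (1 / 2) \<le> 2 * h * ln n" using h by (intro mult_left_mono) auto
    then have "h \<le> exp (2 * h * ln n)" using exp_ge_add_one_self[of "2 * h * ln n"] by linarith
    then have "h * exp (- (2 * h * ln n)) \<le> 1" by (simp add: exp_minus field_simps)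
    then show "h * n powr - (2 * h) \<le> 1" using n by (simp add: powr_def)
  qed (use m n in auto)
  finally show ?thesis using F by linarith
qed

text \<open>The two rates differ by the factor \<open>w powr e\<close> with
  \<open>w = ln s / l\<close>, and \<open>w\<close> is at least \<open>1 / (6 * s)\<close>. Since
  \<open>40 / x\<close> is five times \<open>8 / x\<close>, the steps contract by
  \<open>s ^ 5\<close>, enough to gain this factor and a further one half.\<close>

lemma phase_two_decay:
  assumes x: "0 < x" "x \<le> 1" and s: "2 \<le> s" "s \<le> l" "l \<le> 3 * s" and e: "0 \<le> e" "e \<le> 1"
    and v: "0 < v" and T: "40 / x * ln (real s) \<le> real T"
  shows "(1 - x / 8) ^ T * (real l * v) powr e \<le> (ln (real s) * v) powr e / 2"
proof -
  define w where "w = ln (real s) / real l"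
  have s2: "2 \<le> real s" using s by simp
  have lns: "1 / 2 \<le> ln (real s)" by (rule ln_ge_half[OF s2])
  have l0: "0 < real l" using s by simp
  have w0: "0 < w" using lns l0 by (simp add: w_def)
  have "ln (real s) \<le> real l" using ln_le_minus_one[of "real s"] s by simp
  then have w1: "w \<le> 1" using l0 by (simp add: w_def)
  have "1 / (6 * real s) = (1 / 2) / (3 * real s)" by simp
  also have "\<dots> \<le> w" unfolding w_def using lns l0 s by (intro frac_le) auto
  finally have w2: "1 / (6 * real s) \<le> w" .
  have s5: "12 * real s \<le> real s ^ 5"
  proof -
    have "(2::real) ^ 4 * real s \<le> real s ^ 4 * real s" using s2 by (intro mult_right_mono power_mono) auto
    then show ?thesis by (simp add: eval_nat_numeral mult_ac)
  qed
  have "(1 - x / 8) ^ T \<le> exp (- (x / 8 * (40 / x * ln (real s))))" by (rule one_minus_power_le_exp[OF x T])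
  also have "x / 8 * (40 / x * ln (real s)) = real 5 * ln (real s)" using x by simp
  also have "exp (- (real 5 * ln (real s))) = 1 / real s ^ 5"
    using s2 by (simp only: exp_minus exp_of_nat_mult) (simp add: inverse_eq_divide)
  also have "\<dots> \<le> 1 / (12 * real s)" using s5 s2 by (intro divide_left_mono) auto
  also have "\<dots> \<le> w / 2" using w2 by simp
  also have "w \<le> w powr e" using powr_mono'[of e 1 w] e w0 w1 by simp
  finally have 1: "(1 - x / 8) ^ T \<le> w powr e / 2" by simp
  have "(1 - x / 8) ^ T * (real l * v) powr e \<le> w powr e / 2 * (real l * v) powr e"
    using 1 by (intro mult_right_mono) auto
  also have "\<dots> = (w * (real l * v)) powr e / 2" by (simp add: powr_mult)
  also have "w * (real l * v) = ln (real s) * v" using l0 by (simp add: w_def)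
  finally show ?thesis .
qed

section \<open>Explicit constants\<close>

definition sparsity_const :: "real \<Rightarrow> real \<Rightarrow> real \<Rightarrow> real" where
  "sparsity_const a b \<eta>0 = 2 + 1 / \<bar>2 * a * b * \<eta>0\<bar> + 1 / (2 * a * b * \<eta>0)\<^sup>2"

text \<open>\<open>T\<close> is the constant in \<open>T2 \<le> T * ln s\<close>. The failure level has to beat the number of phase-two
  steps, because the constants in the failure probability may not depend on \<open>T\<close>.\<close>

definition failure_level :: "real \<Rightarrow> real" where
  "failure_level T = exp (- (10 + \<bar>T\<bar>)) / 2"

text \<open>Block sizes are at least this fraction of \<open>n / X\<close>, with \<open>X\<close>
  the order of the number of blocks. The four stands for two halvings, from cutting data into
  batches and batches into blocks. The inner maxima keep the quotient meaningful for all
  \<open>k\<close> and \<open>T\<close>; the bound by one makes \<open>n\<close> at least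
  \<open>X\<close>.\<close>

definition block_frac :: "real \<Rightarrow> real \<Rightarrow> real \<Rightarrow> real" where
  "block_frac \<alpha> k T = min 1 (\<alpha> / (4 * max k 1 * max T 1))"

text \<open>The second argument of the maximum forces every block to be nonempty; it comes from the lower
  bound \<open>(\<kappa>0 / 2) powr (1 + lam)\<close> of the moment of the covariate.\<close>

definition signal_const :: "real \<Rightarrow> real \<Rightarrow> real \<Rightarrow> real" where
  "signal_const \<kappa>0 T lam = max ((120 / (failure_level T ^ 6 * (\<kappa>0 / 24) powr (1 + lam))) powr (1 / lam))
     ((\<kappa>0 / 2) powr (- ((1 + lam) / lam)))"

definition noise_const :: "real \<Rightarrow> real \<Rightarrow> real \<Rightarrow> real \<Rightarrow> real" where
  "noise_const \<alpha> k T \<delta> = (6 / (block_frac \<alpha> k T powr \<delta> * failure_level T ^ 6)) powr (1 / (1 + \<delta>))"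

text \<open>\<open>2 * a * b * \<eta>0\<close> equals \<open>x / 2\<close>, the weight
  \<open>\<beta>\<close> used in thresholding. The expansion condition solved for \<open>s\<close>
  reads \<open>s \<ge> (1 + 1 / \<beta> + 1 / \<beta>\<^sup>2) * s'\<close>; raising the one to two
  also secures \<open>2 * s' \<le> s\<close>.\<close>

lemma sparsity_const_ratio:
  assumes ab: "a = \<kappa>m / (2 * \<kappa>p\<^sup>2)" "b = \<kappa>m / 2" and \<kappa>: "0 < \<kappa>m" "\<kappa>m \<le> \<kappa>p" and \<eta>0: "0 < \<eta>0"
    and x: "x = \<eta>0 * (\<kappa>m / \<kappa>p)\<^sup>2" and s: "sparsity_const a b \<eta>0 * real s' \<le> real s"
  shows "(1 + 1 / (x / 2)) * real s' \<le> x / 2 * (real s - real s')" "2 * real s' \<le> real s"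
proof -
  have x0: "0 < x" unfolding x using \<eta>0 \<kappa> by (intro mult_pos_pos zero_less_power divide_pos_pos) auto
  have be: "2 * a * b * \<eta>0 = x / 2"
    by (simp add: ab x power2_eq_square)
  have c: "sparsity_const a b \<eta>0 = 2 + 1 / (x / 2) + 1 / (x / 2)\<^sup>2"
    unfolding sparsity_const_def be using x0 by simp
  have "2 * real s' \<le> sparsity_const a b \<eta>0 * real s'"
    unfolding c using x0 by (intro mult_right_mono) auto
  then show "2 * real s' \<le> real s" using s by linarith
  have "(1 + 1 / (x / 2)) * real s' \<le> x / 2 * (sparsity_const a b \<eta>0 * real s' - real s')"
  proof -
    have "x / 2 * (sparsity_const a b \<eta>0 * real s' - real s') = (x / 2 + 1 + 1 / (x / 2)) * real s'"
      unfolding c using x0 by (simp add: field_simps power2_eq_square)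
    also have "\<dots> \<ge> (1 + 1 / (x / 2)) * real s'" using x0 by (intro mult_right_mono) auto
    finally show ?thesis .
  qed
  also have "\<dots> \<le> x / 2 * (real s - real s')" using s x0 by (intro mult_left_mono) auto
  finally show "(1 + 1 / (x / 2)) * real s' \<le> x / 2 * (real s - real s')" .
qed

lemma failure_level: "0 < failure_level T" "failure_level T \<le> 1"
proof -
  show "0 < failure_level T" by (simp add: failure_level_def)
  have "exp (- (10 + \<bar>T\<bar>)) \<le> 1" by simp
  then show "failure_level T \<le> 1" unfolding failure_level_def by linarith
qed

lemma block_frac:
  assumes "0 < \<alpha>"
  shows "0 < block_frac \<alpha> k T" "block_frac \<alpha> k T \<le> 1"
    "block_frac \<alpha> k T * (4 * max k 1 * max T 1) \<le> \<alpha>"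
proof -
  have d: "0 < 4 * max k 1 * max T 1" by (intro mult_pos_pos) auto
  then show "0 < block_frac \<alpha> k T" using assms by (simp add: block_frac_def)
  show "block_frac \<alpha> k T \<le> 1" by (simp add: block_frac_def)
  have "block_frac \<alpha> k T * (4 * max k 1 * max T 1) \<le> \<alpha> / (4 * max k 1 * max T 1) * (4 * max k 1 * max T 1)"
    unfolding block_frac_def using d by (intro mult_right_mono) auto
  also have "\<dots> = \<alpha>" using d by simp
  finally show "block_frac \<alpha> k T * (4 * max k 1 * max T 1) \<le> \<alpha>" .
qed

lemma signal_const:
  assumes "0 < \<kappa>0" "0 < lam"
  shows "0 < signal_const \<kappa>0 T lam"
    "120 / (failure_level T ^ 6 * (\<kappa>0 / 24) powr (1 + lam)) \<le> signal_const \<kappa>0 T lam powr lam"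
    "(\<kappa>0 / 2) powr (- ((1 + lam) / lam)) \<le> signal_const \<kappa>0 T lam"
proof -
  let ?Q = "120 / (failure_level T ^ 6 * (\<kappa>0 / 24) powr (1 + lam))"
  have Q: "0 < ?Q" using failure_level(1)[of T] assms by simp
  show 3: "(\<kappa>0 / 2) powr (- ((1 + lam) / lam)) \<le> signal_const \<kappa>0 T lam" by (simp add: signal_const_def)
  have "0 < (\<kappa>0 / 2) powr (- ((1 + lam) / lam))" using assms by simp
  then show "0 < signal_const \<kappa>0 T lam" using 3 by linarith
  have "(?Q powr (1 / lam)) powr lam \<le> signal_const \<kappa>0 T lam powr lam"
    using assms by (intro powr_mono2) (auto simp: signal_const_def)
  moreover have "(?Q powr (1 / lam)) powr lam = ?Q" using Q assms by (simp only: powr_powr) simp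
  ultimately show "?Q \<le> signal_const \<kappa>0 T lam powr lam" by simp
qed

lemma noise_const:
  assumes "0 < \<alpha>" "0 < \<delta>"
  shows "0 < noise_const \<alpha> k T \<delta>"
    "noise_const \<alpha> k T \<delta> powr (1 + \<delta>) = 6 / (block_frac \<alpha> k T powr \<delta> * failure_level T ^ 6)"
proof -
  have Q: "0 < 6 / (block_frac \<alpha> k T powr \<delta> * failure_level T ^ 6)"
    using failure_level[of T] block_frac(1)[OF assms(1), of k T] by simp
  then show "0 < noise_const \<alpha> k T \<delta>"
    unfolding noise_const_def powr_gt_zero by (rule less_imp_neq[THEN not_sym])
  show "noise_const \<alpha> k T \<delta> powr (1 + \<delta>) = 6 / (block_frac \<alpha> k T powr \<delta> * failure_level T ^ 6)"
    unfolding noise_const_def using Q assms by (simp only: powr_powr) simp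
qed

text \<open>With all constants given as explicit functions, their arguments show which quantities
  each may depend on, and the quantifiers of the theorem only have to be instantiated.\<close>

lemma ts_right_error_bound:
  fixes \<alpha> k \<kappa> \<kappa>0 \<eta>0 T lam \<delta> A H m0 a b \<eta> \<kappa>m \<kappa>p R0 :: real
  defines "Cn \<equiv> signal_const \<kappa>0 T lam / block_frac \<alpha> k T"
    and "Ce \<equiv> 2 + 32 * noise_const \<alpha> k T \<delta> / \<kappa>0"
  assumes \<alpha>: "0 < \<alpha>" and \<kappa>0: "0 < \<kappa>0" and \<eta>0: "0 < \<eta>0" "\<eta>0 \<le> 1"
    and lam: "0 < lam" "lam \<le> 1" and \<delta>: "0 < \<delta>" "\<delta> \<le> 1" and m0: "0 < m0"
    and model: "linear_model p \<theta>s P" and w: "l0_norm p \<theta>s \<le> s'"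
    and s: "2 \<le> s" "s \<le> p" and l: "l = 2 * s + s'"
    and Mx_fin: "moment_x p P (2 + 2 * lam) l < \<infinity>" and Me_fin: "moment_eps p \<theta>s P (1 + \<delta>) < \<infinity>"
    and \<kappa>: "0 < \<kappa>m" "\<kappa>m \<le> \<kappa>p" and eig: "sparse_eigenvalues p P l \<kappa>m \<kappa>p"
    and \<kappa>e: "\<kappa> = \<kappa>p / \<kappa>m" "\<kappa>0 \<le> \<kappa>m" and ab: "a = \<kappa>m / (2 * \<kappa>p\<^sup>2)" "b = \<kappa>m / 2"
    and split: "ts_right_split n D1 D2 K1 B1 T2 D2b K2 B2"
    and D: "\<alpha> * real n \<le> real (card D1)" "\<alpha> * real n \<le> real (card D2)"
    and cs: "sparsity_const a b \<eta>0 * real s' \<le> real s" and s': "real s \<le> \<rho> * real s'"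
    and \<eta>: "\<eta> = 2 * a * \<eta>0"
    and K1: "real l * ln (real p) \<le> real K1" "real K1 \<le> k * (real l * ln (real p))"
    and K2: "ln (real p) \<le> real K2" "real K2 \<le> k * ln (real p)"
    and T1: "8 * (\<bar>A\<bar> + 1 + 2 * \<bar>H\<bar> / m0 powr (1 / (1 + \<delta>))) / (\<eta>0 / \<kappa>\<^sup>2) * ln (real n) \<le> real T1"
    and T2: "40 / (\<eta>0 / \<kappa>\<^sup>2) * ln (real s) \<le> real T2" "real T2 \<le> T * ln (real s)"
    and init: "l0_norm p \<theta>0 \<le> s" "l2_dist p \<theta>0 \<theta>s \<le> R0" "R0 \<le> H * real n powr A"
    and Mlow: "ennreal m0 \<le> moment_eff p \<theta>s P (1 + \<delta>) l"
    and n: "Cn * enn2real (moment_x p P (2 + 2 * lam) l) powr (1 / lam)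
                  * real l powr (1 + (1 + lam) / (2 * lam)) * ln (real p) \<le> real n"
  shows "1 - 3 * exp (- (real l * ln (real p))) - 3 * real p powr - 1 \<le>
    measure (sample n P)
        {z \<in> space (sample n P).
           l2_dist p (phase_one p s \<eta> K1 B1 T1 \<theta>0 z) \<theta>s
             \<le> Ce * (sqrt (real l)
                    * enn2real (moment_eff p \<theta>s P (1 + \<delta>) l) powr (1 / (1 + \<delta>))
                    * (real l * ln (real p) / real n) powr (\<delta> / (1 + \<delta>))) \<and>
           l2_dist p (ts_right p s \<eta> K1 B1 T1 K2 B2 T2 \<theta>0 z) \<theta>s
             \<le> Ce * (sqrt (real l)
                    * enn2real (moment_eff p \<theta>s P (1 + \<delta>) l) powr (1 / (1 + \<delta>))
                    * (ln (real s) * ln (real p) / real n) powr (\<delta> / (1 + \<delta>)))}"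
proof -
  \<comment> \<open>\<open>s' = 0\<close> is excluded by \<open>s \<le> \<rho> * s'\<close> together
    with \<open>2 \<le> s\<close>.\<close>
  have s'1: "1 \<le> s'" using s s' by (cases s') auto
  define x where "x = \<eta>0 * (\<kappa>m / \<kappa>p)\<^sup>2"
  have xe: "\<eta>0 / \<kappa>\<^sup>2 = x" using \<kappa> by (simp add: x_def \<kappa>e power_divide)
  have r: "0 < \<kappa>m / \<kappa>p" "\<kappa>m / \<kappa>p \<le> 1" using \<kappa> by auto
  then have "0 < (\<kappa>m / \<kappa>p)\<^sup>2" "(\<kappa>m / \<kappa>p)\<^sup>2 \<le> 1" by (intro zero_less_power power_le_one; linarith)+
  then have x: "0 < x" "x \<le> 1" unfolding x_def using \<eta>0 by (intro mult_pos_pos mult_le_one; linarith)+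
  note ratio = sparsity_const_ratio[OF ab \<kappa> \<eta>0(1) x_def cs]
  have s's: "s' < s" "2 * s + s' \<le> l" and ls: "s \<le> l" "l \<le> 3 * s" "5 \<le> l" "1 \<le> l" "l \<le> 3 * p" "2 \<le> p"
    using ratio(2) s'1 s l by linarith+
  interpret M: heavy_tailed_model p l \<theta>s P lam \<delta> \<kappa>m \<kappa>p
    by unfold_locales (use model ls lam \<delta> Mx_fin Me_fin \<kappa> eig in auto)
  have \<eta>': "\<eta> = \<kappa>m * \<eta>0 / \<kappa>p\<^sup>2" by (simp add: \<eta> ab)
  define c where "c = block_frac \<alpha> k T"
  define y where "y = failure_level T"
  define U where "U = signal_const \<kappa>0 T lam"
  define C1 where "C1 = noise_const \<alpha> k T \<delta>"
  define kk where "kk = max k 1"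
  define TT where "TT = max T 1"
  have kT: "1 \<le> kk" "k \<le> kk" "1 \<le> TT" "T \<le> TT" by (auto simp: kk_def TT_def)
  have c: "0 < c" "c \<le> 1" "c * (4 * kk * TT) \<le> \<alpha>"
    using block_frac[OF \<alpha>] by (auto simp: c_def kk_def TT_def)
  have y: "0 < y" "y \<le> 1" using failure_level by (auto simp: y_def)
  have y6: "0 < y ^ 6" using y by simp
  have U: "0 < U" "120 / (y ^ 6 * (\<kappa>0 / 24) powr (1 + lam)) \<le> U powr lam" "(\<kappa>0 / 2) powr (- ((1 + lam) / lam)) \<le> U"
    using signal_const[OF \<kappa>0 lam(1)] by (auto simp: U_def y_def)
  have C1: "0 < C1" "C1 powr (1 + \<delta>) = 6 / (c powr \<delta> * y ^ 6)"
    using noise_const[OF \<alpha> \<delta>(1)] by (auto simp: C1_def c_def y_def)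
  have lp: "1 / 2 \<le> ln (real p)" using ls by (intro ln_ge_half) auto
  have lsn: "1 / 2 \<le> ln (real s)" using s by (intro ln_ge_half) auto
  have lsp: "ln (real s) \<le> ln (real p)" using s by simp
  \<comment> \<open>Block sizes are of order \<open>n / X1\<close> in phase one and
    \<open>n / X2\<close> in phase two, where the batches multiply the number of blocks by about
    \<open>ln s\<close>.\<close>
  define X1 where "X1 = real l * ln (real p)"
  define X2 where "X2 = ln (real s) * ln (real p)"
  have lsl: "ln (real s) \<le> real l" using ln_le_minus_one[of "real s"] s ls by simp
  have "5 * (1 / 2) \<le> X1" unfolding X1_def using lp ls by (intro mult_mono) auto
  then have X1: "2 \<le> X1" by simp
  have "0 < ln (real s) * ln (real p)" using lp lsn by (intro mult_pos_pos) auto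
  then have X2: "0 < X2" by (simp add: X2_def)
  have X21: "X2 \<le> X1" unfolding X1_def X2_def using lsl lp by (intro mult_right_mono) auto
  have "1 * ln (real p) \<le> real l * ln (real p)" using lp ls by (intro mult_right_mono) auto
  then have lsX: "ln (real s) \<le> X1" using lsp by (simp add: X1_def)
  \<comment> \<open>The block size that \<open>signal_failure_le\<close> asks for; the sample size
    assumption says precisely that \<open>S * X1 \<le> c * n\<close>.\<close>
  define S where "S = U * M.Mx powr (1 / lam) * real l powr ((1 + lam) / (2 * lam))"
  have S: "S \<le> c * real n / X1"
  proof -
    have "S * X1 = c * (Cn * M.Mx powr (1 / lam) * real l powr (1 + (1 + lam) / (2 * lam)) * ln (real p))"
      using c ls by (simp add: S_def X1_def Cn_def U_def[symmetric] c_def[symmetric] powr_add)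
    also have "\<dots> \<le> c * real n" using n c by (intro mult_left_mono) (auto simp: M.Mx_def)
    finally show ?thesis using X1 by (simp add: field_simps)
  qed
  \<comment> \<open>The lower bound on the covariate moment and the second entry of
    \<open>signal_const\<close> cancel. Hence \<open>X1 \<le> c * n\<close>, which is what keeps
    \<open>n\<close> at least two and the blocks nonempty.\<close>
  have S1: "1 \<le> S"
  proof -
    have "(\<kappa>0 / 2) powr (1 + lam) \<le> (\<kappa>m / 2) powr (1 + lam)"
      using \<kappa>0 \<kappa>e lam by (intro powr_mono2) auto
    then have "(\<kappa>0 / 2) powr (1 + lam) \<le> M.Mx" using M.Mx_lower by linarith
    then have "((\<kappa>0 / 2) powr (1 + lam)) powr (1 / lam) \<le> M.Mx powr (1 / lam)"
      using lam by (intro powr_mono2) auto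
    then have 1: "(\<kappa>0 / 2) powr ((1 + lam) / lam) \<le> M.Mx powr (1 / lam)" by (simp add: powr_powr)
    have 2: "1 \<le> real l powr ((1 + lam) / (2 * lam))" using ls lam by (intro ge_one_powr_ge_zero) auto
    have "1 = (\<kappa>0 / 2) powr (- ((1 + lam) / lam)) * (\<kappa>0 / 2) powr ((1 + lam) / lam) * 1"
      using \<kappa>0 by (simp flip: powr_add)
    also have "\<dots> \<le> S" unfolding S_def using 1 2 U by (intro mult_mono) auto
    finally show ?thesis .
  qed
  have "1 * X1 \<le> S * X1" using S1 X1 by (intro mult_right_mono) auto
  moreover have "S * X1 \<le> c * real n" using S X1 by (simp add: field_simps)
  ultimately have cn: "X1 \<le> c * real n" by simp
  have "c * real n \<le> 1 * real n" using c by (intro mult_right_mono) auto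
  then have n2: "2 \<le> real n" using cn X1 by auto
  \<comment> \<open>The average size of at least two that \<open>block_card_lower\<close> demands,
    for the blocks of phase one, the batches, and the blocks of a batch.\<close>
  have sizes: "2 \<le> \<alpha> * real n / Z" if Z: "0 < Z" "Z \<le> 2 * kk * TT * X1" for Z
  proof -
    have "2 * Z \<le> 4 * kk * TT * X1" using Z by linarith
    also have "\<dots> \<le> (4 * kk * TT) * (c * real n)" using cn kT by (intro mult_left_mono) auto
    also have "\<dots> \<le> \<alpha> * real n" using c(3) by (simp add: mult.assoc[symmetric] mult.commute[of _ c] mult_right_mono)
    finally show ?thesis using Z by (simp add: field_simps)
  qed
  have size_le: "c * real n / X \<le> \<alpha> * real n / Z" if Z: "0 < Z" "Z \<le> 4 * kk * TT * X" "0 < X" for Z X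
  proof -
    have "c * real n * Z \<le> c * real n * (4 * kk * TT * X)" using Z c by (intro mult_left_mono) auto
    also have "\<dots> = (c * (4 * kk * TT)) * (real n * X)" by simp
    also have "\<dots> \<le> \<alpha> * (real n * X)" using c(3) Z by (intro mult_right_mono) auto
    finally show ?thesis using Z by (simp add: field_simps)
  qed
  have pt: "near_equal_partition K1 D1 B1" "near_equal_partition T2 D2 D2b"
    "\<And>b. b < T2 \<Longrightarrow> near_equal_partition K2 (D2b b) (B2 b)"
    using split by (auto simp: ts_right_split_def)
  have size1: "c * real n / X1 \<le> real (card (B1 i))" if i: "i < K1" for i
  proof -
    have Y0: "0 < kk * X1" using kT X1 by simp
    have "real K1 \<le> k * X1" using K1 by (simp add: X1_def)
    also have "\<dots> \<le> kk * X1" using kT X1 by (intro mult_right_mono) auto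
    finally have K: "real K1 \<le> kk * X1" .
    have kX: "kk * X1 \<le> kk * TT * X1" using kT X1 by simp
    have "\<alpha> * real n / (2 * (kk * X1)) \<le> real (card (B1 i))"
      by (rule block_card_lower[OF pt(1) i Y0 K D(1) sizes]) (use Y0 kX in linarith)+
    moreover have "c * real n / X1 \<le> \<alpha> * real n / (2 * (kk * X1))"
      by (rule size_le) (use Y0 X1 kX in linarith)+
    ultimately show ?thesis by linarith
  qed
  have size2: "c * real n / X2 \<le> real (card (B2 b i))" if b: "b < T2" and i: "i < K2" for b i
  proof -
    have Y0: "0 < TT * ln (real s)" using kT lsn by simp
    have "T * ln (real s) \<le> TT * ln (real s)" using kT lsn by (intro mult_right_mono) auto
    then have K: "real T2 \<le> TT * ln (real s)" using T2(2) by linarith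
    have "TT * ln (real s) \<le> kk * TT * X1"
      using kT lsX lsn by (intro mult_mono) auto
    then have b1: "\<alpha> * real n / (2 * (TT * ln (real s))) \<le> real (card (D2b b))"
      using Y0 by (intro block_card_lower[OF pt(2) b Y0 K D(2) sizes]; linarith)
    have Y1: "0 < kk * ln (real p)" using kT lp by simp
    have "k * ln (real p) \<le> kk * ln (real p)" using kT lp by (intro mult_right_mono) auto
    then have K': "real K2 \<le> kk * ln (real p)" using K2(2) by linarith
    \<comment> \<open>The lower bound on a batch now plays the role of the sample size; the second
      halving produces the four in \<open>block_frac\<close>.\<close>
    have e: "\<alpha> * real n / (2 * (TT * ln (real s))) / (kk * ln (real p)) = \<alpha> * real n / (2 * kk * TT * X2)"
      by (simp add: X2_def field_simps)
    have Z0: "0 < 2 * kk * TT * X2" using kT X2 by simp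
    have Z1: "2 * kk * TT * X2 \<le> 2 * kk * TT * X1" using kT X21 by (intro mult_left_mono) auto
    have "\<alpha> * real n / (2 * (TT * ln (real s))) / (2 * (kk * ln (real p))) \<le> real (card (B2 b i))"
      by (rule block_card_lower[OF pt(3)[OF b] i Y1 K' b1]) (unfold e, rule sizes[OF Z0 Z1])
    moreover have "\<alpha> * real n / (2 * (TT * ln (real s))) / (2 * (kk * ln (real p))) = \<alpha> * real n / (4 * kk * TT * X2)"
      by (simp add: X2_def field_simps)
    moreover have "c * real n / X2 \<le> \<alpha> * real n / (4 * kk * TT * X2)"
      by (rule size_le) (use Z0 X2 in linarith)+
    ultimately show ?thesis by linarith
  qed
  have "c * real n / X1 \<le> c * real n / X2"
    using X2 X21 c by (intro divide_left_mono) auto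
  then have S2: "S \<le> c * real n / X2" using S by linarith
  have sig: "120 * M.Mx / (m powr lam * (\<kappa>m / (24 * sqrt (real l))) powr (1 + lam)) \<le> y ^ 6" if "S \<le> m" for m
    using that M.Mx_pos ls by (intro signal_failure_le[OF lam(1) _ _ y6 \<kappa>0 \<kappa>e(2) U(1,2)]) (auto simp: S_def)
  have Meff_m0: "m0 \<le> M.Meff"
  proof -
    have "enn2real (ennreal m0) \<le> M.Meff" unfolding M.Meff_def
      using Mlow M.moment_eff_fin by (intro enn2real_mono) auto
    then show ?thesis using m0 by simp
  qed
  then have Meff0: "0 < M.Meff" using m0 by linarith
  \<comment> \<open>\<open>C1 * F X\<close> is the noise tolerance that keeps block failures below
    \<open>y ^ 6\<close>, and \<open>G X\<close> the resulting rate in norm.\<close>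
  define F where "F X = M.Meff powr (1 / (1 + \<delta>)) * (X / real n) powr (\<delta> / (1 + \<delta>))" for X
  have F0: "0 < F X" if "0 < X" for X using that Meff0 n2 by (simp add: F_def)
  have noi: "6 * M.Meff / (m powr \<delta> * (C1 * F X) powr (1 + \<delta>)) \<le> y ^ 6"
    if "c * real n / X \<le> m" "0 < X" for m X
    unfolding F_def using that n2 by (intro noise_failure_le[OF \<delta>(1) Meff0 y6 c(1) _ _ C1]) auto
  define G where "G X = sqrt (real l) * M.Meff powr (1 / (1 + \<delta>)) * (X / real n) powr (\<delta> / (1 + \<delta>))" for X
  have G: "G X = sqrt (real l) * F X" for X by (simp add: G_def F_def)
  have G0: "0 < G X" if "0 < X" for X using F0[OF that] ls by (simp add: G)
  have stat: "16 * sqrt (real l) * (C1 * F X) / \<kappa>m \<le> 16 * C1 / \<kappa>0 * G X" if "0 < X" for X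
  proof -
    have "16 * sqrt (real l) * (C1 * F X) / \<kappa>m = 16 * C1 / \<kappa>m * G X" by (simp add: G)
    also have "\<dots> \<le> 16 * C1 / \<kappa>0 * G X"
      using C1 \<kappa>0 \<kappa>e G0[OF that] by (intro mult_right_mono divide_left_mono) auto
    finally show ?thesis .
  qed
  \<comment> \<open>With \<open>q = 16 * C1 / \<kappa>0\<close>, phase two halves
    \<open>(2 + 2 * q) * G\<close> to \<open>1 + q\<close> and adds its own noise \<open>q\<close>,
    which again fits into \<open>2 + 2 * q\<close>. Phase one needs only
    \<open>1 + q\<close>.\<close>
  have Ce: "Ce = 2 + 2 * (16 * C1 / \<kappa>0)" by (simp add: Ce_def C1_def)
  have st0: "0 \<le> 16 * C1 / \<kappa>0" using C1 \<kappa>0 by simp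
  have e: "0 \<le> \<delta> / (1 + \<delta>)" "\<delta> / (1 + \<delta>) \<le> 1" using \<delta> by auto
  have a1: "(1 - x / 8) ^ T1 * l2_dist p \<theta>0 \<theta>s + 16 * sqrt (real l) * (C1 * F X1) / \<kappa>m \<le> Ce * G X1"
  proof -
    let ?m = "m0 powr (1 / (1 + \<delta>))"
    \<comment> \<open>The exponent \<open>\<delta> / (1 + \<delta>)\<close> is at most one and
      \<open>X1\<close> at least one, so the rate cannot fall below \<open>1 / n\<close> times a
      constant. Logarithmically many steps can reach such a target.\<close>
    have low: "?m / real n \<le> G X1"
    proof -
      have 1: "?m \<le> M.Meff powr (1 / (1 + \<delta>))" using Meff_m0 m0 \<delta> by (intro powr_mono2) auto
      have "1 / real n = (1 / real n) powr 1" using n2 by simp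
      also have "\<dots> \<le> (1 / real n) powr (\<delta> / (1 + \<delta>))" using n2 e by (intro powr_mono') auto
      also have "\<dots> \<le> (X1 / real n) powr (\<delta> / (1 + \<delta>))"
        using e X1 n2 by (intro powr_mono2 divide_right_mono) auto
      finally have 2: "1 / real n \<le> (X1 / real n) powr (\<delta> / (1 + \<delta>))" .
      have "1 * ?m * (1 / real n) \<le> G X1" unfolding G_def
        using 1 2 ls by (intro mult_mono) auto
      then show ?thesis by simp
    qed
    have "(1 - x / 8) ^ T1 * l2_dist p \<theta>0 \<theta>s \<le> G X1"
      by (rule phase_one_decay[OF x n2 _ low T1[unfolded xe]]) (use m0 init in auto)
    then have "(1 - x / 8) ^ T1 * l2_dist p \<theta>0 \<theta>s + 16 * sqrt (real l) * (C1 * F X1) / \<kappa>m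
        \<le> (1 + 16 * C1 / \<kappa>0) * G X1"
      using stat[of X1] X1 by (simp add: distrib_right)
    also have "\<dots> \<le> Ce * G X1" using G0[of X1] X1 st0 by (intro mult_right_mono) (auto simp: Ce)
    finally show ?thesis .
  qed
  have a2: "(1 - x / 8) ^ T2 * (Ce * G X1) + 16 * sqrt (real l) * (C1 * F X2) / \<kappa>m \<le> Ce * G X2"
  proof -
    let ?M = "sqrt (real l) * M.Meff powr (1 / (1 + \<delta>))"
    have "(1 - x / 8) ^ T2 * (real l * (ln (real p) / real n)) powr (\<delta> / (1 + \<delta>))
        \<le> (ln (real s) * (ln (real p) / real n)) powr (\<delta> / (1 + \<delta>)) / 2"
      using lp n2 by (intro phase_two_decay[OF x s(1) ls(1,2) e _ T2(1)[unfolded xe]]) auto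
    then have "?M * ((1 - x / 8) ^ T2 * (X1 / real n) powr (\<delta> / (1 + \<delta>))) \<le> ?M * ((X2 / real n) powr (\<delta> / (1 + \<delta>)) / 2)"
      by (intro mult_left_mono) (auto simp: X1_def X2_def)
    then have "(1 - x / 8) ^ T2 * G X1 \<le> G X2 / 2" by (simp add: G_def mult_ac)
    then have "Ce * ((1 - x / 8) ^ T2 * G X1) \<le> Ce * (G X2 / 2)"
      using st0 by (intro mult_left_mono) (auto simp: Ce)
    also have "\<dots> = G X2 + 16 * C1 / \<kappa>0 * G X2" by (simp add: Ce distrib_right)
    finally have "(1 - x / 8) ^ T2 * (Ce * G X1) \<le> G X2 + 16 * C1 / \<kappa>0 * G X2" by (simp add: mult_ac)
    moreover have "G X2 + 16 * C1 / \<kappa>0 * G X2 + 16 * C1 / \<kappa>0 * G X2 \<le> Ce * G X2"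
      using G0[OF X2] by (simp add: Ce distrib_right)
    ultimately show ?thesis using stat[OF X2] by linarith
  qed
  have "0 < real K1" "0 < real K2" using K1(1) K2(1) X1 lp by (auto simp: X1_def)
  then have K0: "0 < K1" "0 < K2" by auto
  have pos: "0 < c * real n / X" if "0 < X" for X using that c n2 by simp
  have X10: "0 < X1" using X1 by simp
  have ne1: "B1 i \<noteq> {}" if "i < K1" for i
    using size1[OF that] pos[OF X10] by auto
  have ne2: "B2 b i \<noteq> {}" if "b < T2" "i < K2" for b i
    using size2[OF that] pos[OF X2] by auto
  have main: "1 - real p * real ((p * (2 * l\<^sup>2 + 1)) ^ l) * (3 * (2 * y) ^ K1) - real T2 * (real p * (2 * (2 * y) ^ K2))
    \<le> measure (sample n P) {z \<in> space (sample n P).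
        l2_dist p (phase_one p s \<eta> K1 B1 T1 \<theta>0 z) \<theta>s \<le> Ce * G X1 \<and>
        l2_dist p (ts_right p s \<eta> K1 B1 T1 K2 B2 T2 \<theta>0 z) \<theta>s \<le> Ce * G X2}"
  proof (rule M.two_phase_error[OF split K0 s(2) s's w init(1) \<eta>0 \<eta>' x_def ratio(1) refl _ _ _ y(2) ne1 _ _ ne2 _ _ a1 a2])
    show "0 < C1 * F X1" "0 < C1 * F X2" using C1 F0 X10 X2 by auto
    show "0 \<le> y" using y by simp
    show "120 * M.Mx / (real (card (B1 i)) powr lam * (\<kappa>m / (24 * sqrt (real l))) powr (1 + lam)) \<le> y ^ 6" if "i < K1" for i
      using size1[OF that] S by (intro sig) linarith
    show "6 * M.Meff / (real (card (B1 i)) powr \<delta> * (C1 * F X1) powr (1 + \<delta>)) \<le> y ^ 6" if "i < K1" for i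
      by (rule noi[OF size1[OF that] X10])
    show "120 * M.Mx / (real (card (B2 b i)) powr lam * (\<kappa>m / (24 * sqrt (real l))) powr (1 + lam)) \<le> y ^ 6"
      if "b < T2" "i < K2" for b i
      using size2[OF that] S2 by (intro sig) linarith
    show "6 * M.Meff / (real (card (B2 b i)) powr \<delta> * (C1 * F X2) powr (1 + \<delta>)) \<le> y ^ 6" if "b < T2" "i < K2" for b i
      by (rule noi[OF size2[OF that] X2])
  qed
  have f1: "real p * real ((p * (2 * l\<^sup>2 + 1)) ^ l) * (3 * (2 * y) ^ K1) \<le> 3 * exp (- (real l * ln (real p)))"
    unfolding y_def failure_level_def by (rule phase_one_failure[OF ls(6,4,5) K1(1)]) simp
  have f2: "real T2 * (real p * (2 * (2 * y) ^ K2)) \<le> 3 * real p powr - 1"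
    unfolding y_def failure_level_def by (rule phase_two_failure[OF s T2(2) K2(1)])
  show ?thesis
    using main f1 f2 unfolding G_def X1_def X2_def M.Meff_def by linarith
qed

text \<open>The order of the quantifiers records the dependence of the constants. \<open>C\<close>
  and \<open>c\<close> precede all upper constants; \<open>C\<^sub>n\<close> may use the number of
  batches, which fixes their size; \<open>C\<^sub>e\<close> may also use \<open>\<delta>\<close>.
  Both need \<open>\<kappa>0\<close>, since the error bound divides by \<open>\<kappa>m\<close>.
  \<open>m0\<close> keeps the accuracy demanded of phase one above a multiple of
  \<open>1 / n\<close>, and \<open>\<tau>1\<close> depends on it.\<close>

theorem theorem2:
  shows
  "\<exists>c\<^sub>s :: real \<Rightarrow> real \<Rightarrow> real \<Rightarrow> real. (\<forall>a b \<eta>0. c\<^sub>s a b \<eta>0 > 1) \<and>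
   (\<exists>k0 C c :: real. k0 > 0 \<and> C > 0 \<and> c > 0 \<and>
   (\<forall>\<alpha> \<rho> k :: real. \<alpha> > 0 \<longrightarrow>
   (\<forall>\<kappa> \<kappa>0 \<eta>0 :: real. \<kappa> \<ge> 1 \<longrightarrow> \<kappa>0 > 0 \<longrightarrow> 0 < \<eta>0 \<longrightarrow> \<eta>0 \<le> 1 \<longrightarrow>
   (\<exists>\<tau>2 > 0. \<forall>\<tau>2' :: real.
   (\<forall>lam :: real. 0 < lam \<longrightarrow> lam \<le> 1 \<longrightarrow>
   (\<exists>C\<^sub>n > 0.
   (\<forall>\<delta> :: real. 0 < \<delta> \<longrightarrow> \<delta> \<le> 1 \<longrightarrow>
   (\<exists>C\<^sub>e > 0. \<forall>A H m0 :: real. m0 > 0 \<longrightarrow>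
   (\<exists>\<tau>1 > 0. \<forall>\<tau>1' :: real.
   (\<forall>(n::nat) (p::nat) (s::nat) (sstar::nat) (sbar::nat) (P :: obs measure) (\<theta>star :: vec)
      (\<kappa>m::real) (\<kappa>p::real) (a::real) (b::real) (\<eta>::real)
      (D1 :: nat set) (D2 :: nat set) (K1::nat) (B1 :: nat \<Rightarrow> nat set) (T1::nat)
      (K2::nat) (T2::nat) (D2b :: nat \<Rightarrow> nat set) (B2 :: nat \<Rightarrow> nat \<Rightarrow> nat set)
      (\<theta>init :: vec) (R0::real).
      linear_model p \<theta>star P \<longrightarrow> l0_norm p \<theta>star \<le> sstar \<longrightarrow>
      2 \<le> s \<longrightarrow> s \<le> p \<longrightarrow> sbar = 2 * s + sstar \<longrightarrow>
      moment_x p P (2 + 2 * lam) sbar < \<infinity> \<longrightarrow> moment_eps p \<theta>star P (1 + \<delta>) < \<infinity> \<longrightarrow>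
      0 < \<kappa>m \<longrightarrow> \<kappa>m \<le> \<kappa>p \<longrightarrow> sparse_eigenvalues p P sbar \<kappa>m \<kappa>p \<longrightarrow>
      \<kappa> = \<kappa>p / \<kappa>m \<longrightarrow> \<kappa>0 \<le> \<kappa>m \<longrightarrow>
      a = \<kappa>m / (2 * \<kappa>p\<^sup>2) \<longrightarrow> b = \<kappa>m / 2 \<longrightarrow>
      ts_right_split n D1 D2 K1 B1 T2 D2b K2 B2 \<longrightarrow>
      comparable \<alpha> 1 (real (card D1)) (real n) \<longrightarrow> comparable \<alpha> 1 (real (card D2)) (real n) \<longrightarrow>
      c\<^sub>s a b \<eta>0 * real sstar \<le> real s \<longrightarrow> comparable 1 \<rho> (real s) (real sstar) \<longrightarrow>
      \<eta> = 2 * a * \<eta>0 \<longrightarrow>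
      comparable k0 k (real K1) (real sbar * ln (real p)) \<longrightarrow>
      comparable k0 k (real K2) (ln (real p)) \<longrightarrow>
      comparable \<tau>1 \<tau>1' (real T1) (ln (real n)) \<longrightarrow>
      comparable \<tau>2 \<tau>2' (real T2) (ln (real s)) \<longrightarrow>
      l0_norm p \<theta>init \<le> s \<longrightarrow> l2_dist p \<theta>init \<theta>star \<le> R0 \<longrightarrow> R0 \<le> H * real n powr A \<longrightarrow>
      ennreal m0 \<le> moment_eff p \<theta>star P (1 + \<delta>) sbar \<longrightarrow>
      real n \<ge> C\<^sub>n * enn2real (moment_x p P (2 + 2 * lam) sbar) powr (1 / lam)
                  * real sbar powr (1 + (1 + lam) / (2 * lam)) * ln (real p) \<longrightarrow>
      measure (sample n P)
        {z \<in> space (sample n P).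
           l2_dist p (phase_one p s \<eta> K1 B1 T1 \<theta>init z) \<theta>star
             \<le> C\<^sub>e * (sqrt (real sbar)
                    * enn2real (moment_eff p \<theta>star P (1 + \<delta>) sbar) powr (1 / (1 + \<delta>))
                    * (real sbar * ln (real p) / real n) powr (\<delta> / (1 + \<delta>))) \<and>
           l2_dist p (ts_right p s \<eta> K1 B1 T1 K2 B2 T2 \<theta>init z) \<theta>star
             \<le> C\<^sub>e * (sqrt (real sbar)
                    * enn2real (moment_eff p \<theta>star P (1 + \<delta>) sbar) powr (1 / (1 + \<delta>))
                    * (ln (real s) * ln (real p) / real n) powr (\<delta> / (1 + \<delta>)))}
        \<ge> 1 - C * exp (- c * real sbar * ln (real p)) - C * real p powr (- c)))))))))))"
proof (rule exI[of _ sparsity_const], intro conjI, goal_cases)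
  case 1
  show ?case by (auto simp: sparsity_const_def intro!: add_pos_nonneg)
next
  case 2
  show ?case
  \<comment> \<open>Block numbers with lower constant one suffice because the failure level carries
    all the smallness. The three comes from \<open>phase_one_failure\<close> and
    \<open>phase_two_failure\<close>.\<close>
  proof (rule exI[of _ 1], rule exI[of _ 3], rule exI[of _ 1], intro conjI allI impI, goal_cases)
    case (4 \<alpha> \<rho> k \<kappa> \<kappa>0 \<eta>0)
    note rate = 4
    show ?case
    \<comment> \<open>\<open>\<eta>0 / \<kappa>\<^sup>2\<close> is the contraction parameter
      \<open>x\<close>, known before the data.\<close>
    proof (rule exI[of _ "40 / (\<eta>0 / \<kappa>\<^sup>2)"], intro conjI allI impI, goal_cases)
      case 1
      show ?case using rate by simp
    next
      case (2 T lam)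
      note lam = 2
      show ?case
      proof (rule exI[of _ "signal_const \<kappa>0 T lam / block_frac \<alpha> k T"], intro conjI allI impI, goal_cases)
        case 1
        show ?case using signal_const(1) block_frac(1) rate lam by simp
      next
        case (2 \<delta>)
        note \<delta> = 2
        show ?case
        proof (rule exI[of _ "2 + 32 * noise_const \<alpha> k T \<delta> / \<kappa>0"], intro conjI allI impI, goal_cases)
          case 1
          show ?case using noise_const(1)[of \<alpha> \<delta> k T] rate \<delta> by (simp add: add_pos_pos)
        next
          case (2 A H m0)
          note m0 = 2
          show ?case
          proof (rule exI[of _ "8 * (\<bar>A\<bar> + 1 + 2 * \<bar>H\<bar> / m0 powr (1 / (1 + \<delta>))) / (\<eta>0 / \<kappa>\<^sup>2)"],
              intro conjI allI impI, goal_cases)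
            case 1
            have "0 < \<bar>A\<bar> + 1 + 2 * \<bar>H\<bar> / m0 powr (1 / (1 + \<delta>))" by (intro add_pos_nonneg add_nonneg_pos) auto
            then show ?case using rate by simp
          next
            case (2 T1' n p s sstar sbar P \<theta>star \<kappa>m \<kappa>p a b \<eta> D1 D2 K1 B1 T1 K2 T2 D2b B2 \<theta>init R0)
            note h = 2
            have cmp: "\<alpha> * real n \<le> real (card D1)" "\<alpha> * real n \<le> real (card D2)" "real s \<le> \<rho> * real sstar"
              "real sbar * ln (real p) \<le> real K1" "real K1 \<le> k * (real sbar * ln (real p))"
              "ln (real p) \<le> real K2" "real K2 \<le> k * ln (real p)"
              "8 * (\<bar>A\<bar> + 1 + 2 * \<bar>H\<bar> / m0 powr (1 / (1 + \<delta>))) / (\<eta>0 / \<kappa>\<^sup>2) * ln (real n) \<le> real T1"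
              "40 / (\<eta>0 / \<kappa>\<^sup>2) * ln (real s) \<le> real T2" "real T2 \<le> T * ln (real s)"
              using h(16,17,19,21-24) by (simp_all only: comparable_def mult_1)
            have "1 - 3 * exp (- 1 * real sbar * ln (real p)) - 3 * real p powr - 1
                = 1 - 3 * exp (- (real sbar * ln (real p))) - 3 * real p powr - 1" by simp
            then show ?case
              using ts_right_error_bound[OF rate(1,3,4,5) lam \<delta> m0 h(1-15) cmp(1,2) h(18) cmp(3) h(20)
                  cmp(4-10) h(25-29)]
              by (simp only:)
          qed
        qed
      qed
    qed
  qed (simp_all only: zero_less_one zero_less_numeral)
qed

end
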